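(* Let $G$ be a profinite group, $R$ a unital ring, $X$ a profinite $G$-space, $x\in X$, $O=Gx$ the orbit of $x$, and $i\colon O\to X$ the inclusion. The stalk functor $E\mapsto E_x$, from $G$-sheaves of $R$-modules over $X$ to discrete $R[\mathrm{stab}_G(x)]$-modules, is left adjoint to the equivariant skyscraper functor $$M\longmapsto i_*\Big(G\underset{\mathrm{stab}_G(x)}{\times}M\Big).$$
   Context: A profinite space is a compact, Hausdorff, totally disconnected space; a profinite group is a topological group whose underlying space is profinite. A $G$-sheaf of $R$-modules over $X$ is a $G$-equivariant local homeomorphism $p\colon E\to X$, with $E$ a space with continuous $G$-action, such that each stalk $E_x=p^{-1}(x)$ is an $R$-module, the fibrewise subtraction $E\times_XE\to E$ and each map $e\mapsto re$ ($r\in R$) are continuous, and each map $g\colon E_x\to E_{gx}$ is $R$-linear. Morphisms are continuous $G$-equivariant maps over $X$, $R$-linear on stalks. A discrete $R[H]$-module, for a topological group $H$, is an $R$-module with an $R$-linear $H$-action that is continuous for the discrete topology on the module; morphisms are $R$-linear $H$-equivariant maps. The stalk $E_x$ is a discrete $R[\mathrm{stab}_G(x)]$-module. For a discrete $R[\mathrm{stab}_G(x)]$-module $M$, $G\times_{\mathrm{stab}_G(x)}M\to O\cong G/\mathrm{stab}_G(x)$, $[g,m]\mapsto gx$, is a $G$-sheaf of $R$-modules over the closed $G$-subspace $O$. The extension by zero $i_*F$ of a $G$-sheaf $F$ over $O$ is the $G$-sheaf over $X$ with sections $(i_*F)(U)=F(U\cap O)$ and $G$-action induced by $s\mapsto g\circ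 s\circ g^{-1}$. *)

theory Defs
  imports "HOL-Analysis.Analysis" "HOL-Algebra.Module" "HOL-Algebra.Group_Action"
begin

section \<open>Categories of structures, functors\<close>

text \<open>Composition takes the three objects as arguments because set-theoretic composition of
  extensional functions depends on the domain.\<close>

record ('o, 'a) cat =
  Obj :: "'o set"
  Hom :: "'o \<Rightarrow> 'o \<Rightarrow> 'a set"
  Ident :: "'o \<Rightarrow> 'a"
  Comp :: "'o \<Rightarrow> 'o \<Rightarrow> 'o \<Rightarrow> 'a \<Rightarrow> 'a \<Rightarrow> 'a"

definition is_category :: "('o, 'a) cat \<Rightarrow> bool" where
  "is_category C \<longleftrightarrow>
    (\<forall>A\<in>Obj C. Ident C A \<in> Hom C A A) \<and>
    (\<forall>A\<in>Obj C. \<forall>B\<in>Obj C. \<forall>D\<in>Obj C. \<forall>f\<in>Hom C A B. \<forall>g\<in>Hom C B D.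
       Comp C A B D g f \<in> Hom C A D) \<and>
    (\<forall>A\<in>Obj C. \<forall>B\<in>Obj C. \<forall>f\<in>Hom C A B.
       Comp C A A B f (Ident C A) = f \<and> Comp C A B B (Ident C B) f = f) \<and>
    (\<forall>A\<in>Obj C. \<forall>B\<in>Obj C. \<forall>D\<in>Obj C. \<forall>E\<in>Obj C.
       \<forall>f\<in>Hom C A B. \<forall>g\<in>Hom C B D. \<forall>h\<in>Hom C D E.
       Comp C A D E h (Comp C A B D g f) = Comp C A B E (Comp C B D E h g) f)"

definition is_functor ::
  "('o, 'a) cat \<Rightarrow> ('p, 'b) cat \<Rightarrow> ('o \<Rightarrow> 'p) \<Rightarrow> ('o \<Rightarrow> 'o \<Rightarrow> 'a \<Rightarrow> 'b) \<Rightarrow> bool" where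
  "is_functor C D F0 F1 \<longleftrightarrow> is_category C \<and> is_category D \<and>
    (\<forall>A\<in>Obj C. F0 A \<in> Obj D) \<and>
    (\<forall>A\<in>Obj C. \<forall>B\<in>Obj C. \<forall>f\<in>Hom C A B. F1 A B f \<in> Hom D (F0 A) (F0 B)) \<and>
    (\<forall>A\<in>Obj C. F1 A A (Ident C A) = Ident D (F0 A)) \<and>
    (\<forall>A\<in>Obj C. \<forall>B\<in>Obj C. \<forall>E\<in>Obj C. \<forall>f\<in>Hom C A B. \<forall>g\<in>Hom C B E.
       F1 A E (Comp C A B E g f) = Comp D (F0 A) (F0 B) (F0 E) (F1 B E g) (F1 A B f))"


section \<open>Profinite groups and spaces\<close>

definition totally_disconnected_space :: "'a topology \<Rightarrow> bool" where
  "totally_disconnected_space T \<longleftrightarrow> (\<forall>S. connectedin T S \<longrightarrow> (\<exists>a. S \<subseteq> {a}))"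

definition profinite_space :: "'a topology \<Rightarrow> bool" where
  "profinite_space T \<longleftrightarrow>
    compact_space T \<and> Hausdorff_space T \<and> totally_disconnected_space T"

definition topological_group :: "('g, 'b) monoid_scheme \<Rightarrow> 'g topology \<Rightarrow> bool" where
  "topological_group G TG \<longleftrightarrow> group G \<and> topspace TG = carrier G \<and>
    continuous_map (prod_topology TG TG) TG (\<lambda>(g, h). g \<otimes>\<^bsub>G\<^esub> h) \<and>
    continuous_map TG TG (\<lambda>g. inv\<^bsub>G\<^esub> g)"

definition profinite_group :: "('g, 'b) monoid_scheme \<Rightarrow> 'g topology \<Rightarrow> bool" where
  "profinite_group G TG \<longleftrightarrow> topological_group G TG \<and> profinite_space TG"

definition G_space ::
  "('g, 'b) monoid_scheme \<Rightarrow> 'g topology \<Rightarrow> 'x topology \<Rightarrow> ('g \<Rightarrow> 'x \<Rightarrow> 'x) \<Rightarrow> bool" where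
  "G_space G TG TX \<phi> \<longleftrightarrow> group_action G (topspace TX) \<phi> \<and>
    continuous_map (prod_topology TG TX) TX (\<lambda>(g, y). \<phi> g y)"

definition local_homeo :: "'a topology \<Rightarrow> 'b topology \<Rightarrow> ('a \<Rightarrow> 'b) \<Rightarrow> bool" where
  "local_homeo S T p \<longleftrightarrow> continuous_map S T p \<and>
    (\<forall>e\<in>topspace S. \<exists>U. openin S U \<and> e \<in> U \<and> openin T (p ` U) \<and>
       homeomorphic_map (subtopology S U) (subtopology T (p ` U)) p)"


section \<open>Modules with a discrete group action\<close>

text \<open>The library locale \<open>module\<close> assumes a commutative ring of scalars.\<close>

definition left_module :: "('r, 'c) ring_scheme \<Rightarrow> ('r, 'm, 'd) module_scheme \<Rightarrow> bool" where
  "left_module R M \<longleftrightarrow> ring R \<and> abelian_group M \<and>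
    (\<forall>r\<in>carrier R. \<forall>a\<in>carrier M. r \<odot>\<^bsub>M\<^esub> a \<in> carrier M) \<and>
    (\<forall>r\<in>carrier R. \<forall>s\<in>carrier R. \<forall>a\<in>carrier M.
       (r \<oplus>\<^bsub>R\<^esub> s) \<odot>\<^bsub>M\<^esub> a = (r \<odot>\<^bsub>M\<^esub> a) \<oplus>\<^bsub>M\<^esub> (s \<odot>\<^bsub>M\<^esub> a)) \<and>
    (\<forall>r\<in>carrier R. \<forall>a\<in>carrier M. \<forall>b\<in>carrier M.
       r \<odot>\<^bsub>M\<^esub> (a \<oplus>\<^bsub>M\<^esub> b) = (r \<odot>\<^bsub>M\<^esub> a) \<oplus>\<^bsub>M\<^esub> (r \<odot>\<^bsub>M\<^esub> b)) \<and>
    (\<forall>r\<in>carrier R. \<forall>s\<in>carrier R. \<forall>a\<in>carrier M.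
       (r \<otimes>\<^bsub>R\<^esub> s) \<odot>\<^bsub>M\<^esub> a = r \<odot>\<^bsub>M\<^esub> (s \<odot>\<^bsub>M\<^esub> a)) \<and>
    (\<forall>a\<in>carrier M. \<one>\<^bsub>R\<^esub> \<odot>\<^bsub>M\<^esub> a = a)"

definition linear_maps ::
  "('r, 'c) ring_scheme \<Rightarrow> ('r, 'm, 'd) module_scheme \<Rightarrow> ('r, 'n, 'e) module_scheme \<Rightarrow> ('m \<Rightarrow> 'n) set"
  where
  "linear_maps R M N = {f \<in> carrier M \<rightarrow> carrier N.
    (\<forall>a\<in>carrier M. \<forall>b\<in>carrier M. f (a \<oplus>\<^bsub>M\<^esub> b) = f a \<oplus>\<^bsub>N\<^esub> f b) \<and>
    (\<forall>r\<in>carrier R. \<forall>a\<in>carrier M. f (r \<odot>\<^bsub>M\<^esub> a) = r \<odot>\<^bsub>N\<^esub> f a)}"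

text \<open>The ring multiplication and unit inherited from the record \<open>module\<close> play no role.\<close>

record ('r, 'm, 'h) gmodule = "('r, 'm) module" +
  gact :: "'h \<Rightarrow> 'm \<Rightarrow> 'm"

definition discrete_gmodule ::
  "('h, 'b) monoid_scheme \<Rightarrow> 'h topology \<Rightarrow> ('r, 'c) ring_scheme \<Rightarrow> ('r, 'm, 'h) gmodule \<Rightarrow> bool"
  where
  "discrete_gmodule H TH R M \<longleftrightarrow> left_module R M \<and>
    group_action H (carrier M) (gact M) \<and>
    (\<forall>h\<in>carrier H. gact M h \<in> linear_maps R M M) \<and>
    continuous_map (prod_topology TH (discrete_topology (carrier M)))
      (discrete_topology (carrier M)) (\<lambda>(h, m). gact M h m)"

text \<open>Morphisms are extensional functions, so that equality of morphisms is equality on the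
  carrier.\<close>

definition gmodule_hom ::
  "('h, 'b) monoid_scheme \<Rightarrow> ('r, 'c) ring_scheme \<Rightarrow> ('r, 'm, 'h) gmodule \<Rightarrow> ('r, 'n, 'h) gmodule
    \<Rightarrow> ('m \<Rightarrow> 'n) set" where
  "gmodule_hom H R M N = {f \<in> extensional (carrier M) \<inter> linear_maps R M N.
    \<forall>h\<in>carrier H. \<forall>m\<in>carrier M. f (gact M h m) = gact N h (f m)}"

definition gmodule_cat ::
  "('h, 'b) monoid_scheme \<Rightarrow> 'h topology \<Rightarrow> ('r, 'c) ring_scheme
    \<Rightarrow> (('r, 'm, 'h) gmodule, 'm \<Rightarrow> 'm) cat" where
  "gmodule_cat H TH R = \<lparr>
    Obj = {M. discrete_gmodule H TH R M},
    Hom = gmodule_hom H R,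
    Ident = (\<lambda>M. \<lambda>m\<in>carrier M. m),
    Comp = (\<lambda>M N P g f. compose (carrier M) g f)\<rparr>"


section \<open>Equivariant sheaves of modules\<close>

text \<open>A sheaf is given by its total space. The operations \<open>fadd\<close> and \<open>fsmult\<close> are only meaningful
  within a fibre, and \<open>fzero E y\<close> is the zero element of the fibre over \<open>y\<close>.\<close>

record ('x, 'e, 'r, 'g) gsheaf =
  total :: "'e topology"
  proj :: "'e \<Rightarrow> 'x"
  eact :: "'g \<Rightarrow> 'e \<Rightarrow> 'e"
  fadd :: "'e \<Rightarrow> 'e \<Rightarrow> 'e"
  fzero :: "'x \<Rightarrow> 'e"
  fsmult :: "'r \<Rightarrow> 'e \<Rightarrow> 'e"

text \<open>On \<open>stalk E y\<close> the component \<open>gact\<close> is an action of the stabilizer of \<open>y\<close> only.\<close>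

definition stalk :: "('x, 'e, 'r, 'g) gsheaf \<Rightarrow> 'x \<Rightarrow> ('r, 'e, 'g) gmodule" where
  "stalk E y = \<lparr>
    carrier = {e \<in> topspace (total E). proj E e = y},
    mult = undefined, one = undefined,
    ring.zero = fzero E y, add = fadd E, smult = fsmult E,
    gact = (\<lambda>g. restrict (eact E g) {e \<in> topspace (total E). proj E e = y})\<rparr>"

definition is_gsheaf ::
  "('g, 'b) monoid_scheme \<Rightarrow> 'g topology \<Rightarrow> ('r, 'c) ring_scheme \<Rightarrow> 'x topology
    \<Rightarrow> ('g \<Rightarrow> 'x \<Rightarrow> 'x) \<Rightarrow> ('x, 'e, 'r, 'g) gsheaf \<Rightarrow> bool" where
  "is_gsheaf G TG R TX \<phi> E \<longleftrightarrow>
    G_space G TG (total E) (eact E) \<and>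
    local_homeo (total E) TX (proj E) \<and>
    (\<forall>g\<in>carrier G. \<forall>e\<in>topspace (total E). proj E (eact E g e) = \<phi> g (proj E e)) \<and>
    (\<forall>y\<in>topspace TX. left_module R (stalk E y)) \<and>
    continuous_map
      (subtopology (prod_topology (total E) (total E)) {(a, b). proj E a = proj E b})
      (total E) (\<lambda>(a, b). a \<ominus>\<^bsub>stalk E (proj E a)\<^esub> b) \<and>
    (\<forall>r\<in>carrier R. continuous_map (total E) (total E) (fsmult E r)) \<and>
    (\<forall>g\<in>carrier G. \<forall>y\<in>topspace TX. eact E g \<in> linear_maps R (stalk E y) (stalk E (\<phi> g y)))"

definition gsheaf_hom ::
  "('g, 'b) monoid_scheme \<Rightarrow> ('r, 'c) ring_scheme \<Rightarrow> 'x topology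
    \<Rightarrow> ('x, 'e, 'r, 'g) gsheaf \<Rightarrow> ('x, 'f, 'r, 'g) gsheaf \<Rightarrow> ('e \<Rightarrow> 'f) set" where
  "gsheaf_hom G R TX E F = {f \<in> extensional (topspace (total E)).
    continuous_map (total E) (total F) f \<and>
    (\<forall>e\<in>topspace (total E). proj F (f e) = proj E e) \<and>
    (\<forall>g\<in>carrier G. \<forall>e\<in>topspace (total E). f (eact E g e) = eact F g (f e)) \<and>
    (\<forall>y\<in>topspace TX. f \<in> linear_maps R (stalk E y) (stalk F y))}"

definition gsheaf_cat ::
  "('g, 'b) monoid_scheme \<Rightarrow> 'g topology \<Rightarrow> ('r, 'c) ring_scheme \<Rightarrow> 'x topology
    \<Rightarrow> ('g \<Rightarrow> 'x \<Rightarrow> 'x) \<Rightarrow> (('x, 'e, 'r, 'g) gsheaf, 'e \<Rightarrow> 'e) cat" where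
  "gsheaf_cat G TG R TX \<phi> = \<lparr>
    Obj = {E. is_gsheaf G TG R TX \<phi> E},
    Hom = gsheaf_hom G R TX,
    Ident = (\<lambda>E. \<lambda>e\<in>topspace (total E). e),
    Comp = (\<lambda>E F D g f. compose (topspace (total E)) g f)\<rparr>"

definition stab_group ::
  "('g, 'b) monoid_scheme \<Rightarrow> ('g \<Rightarrow> 'x \<Rightarrow> 'x) \<Rightarrow> 'x \<Rightarrow> ('g, 'b) monoid_scheme" where
  "stab_group G \<phi> x = G\<lparr>carrier := stabilizer G \<phi> x\<rparr>"

definition stab_topology ::
  "('g, 'b) monoid_scheme \<Rightarrow> 'g topology \<Rightarrow> ('g \<Rightarrow> 'x \<Rightarrow> 'x) \<Rightarrow> 'x \<Rightarrow> 'g topology" where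
  "stab_topology G TG \<phi> x = subtopology TG (stabilizer G \<phi> x)"

definition stalk_map ::
  "'x \<Rightarrow> ('x, 'e, 'r, 'g) gsheaf \<Rightarrow> ('x, 'f, 'r, 'g) gsheaf \<Rightarrow> ('e \<Rightarrow> 'f) \<Rightarrow> ('e \<Rightarrow> 'f)" where
  "stalk_map x E F f = restrict f (carrier (stalk E x))"


section \<open>The sheaf \<open>G \<times>\<^bsub>H\<^esub> M\<close> over the orbit, \<open>H\<close> the stabilizer of \<open>x\<close>\<close>

text \<open>Points are the classes of \<open>(g h, m) \<sim> (g, h m)\<close>, with the quotient topology: the preimage of a
  set \<open>U\<close> of classes in \<open>G \<times> M\<close> is \<open>\<Union>U\<close>.\<close>

definition balanced_rel ::
  "('g, 'b) monoid_scheme \<Rightarrow> ('g \<Rightarrow> 'x \<Rightarrow> 'x) \<Rightarrow> 'x \<Rightarrow> ('r, 'm, 'g) gmodule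
    \<Rightarrow> (('g \<times> 'm) \<times> ('g \<times> 'm)) set" where
  "balanced_rel G \<phi> x M = {((k, m), (k', m')).
    k \<in> carrier G \<and> m \<in> carrier M \<and> k' \<in> carrier G \<and> m' \<in> carrier M \<and>
    (\<exists>h\<in>stabilizer G \<phi> x. k = k' \<otimes>\<^bsub>G\<^esub> h \<and> m' = gact M h m)}"

definition balanced_points ::
  "('g, 'b) monoid_scheme \<Rightarrow> ('g \<Rightarrow> 'x \<Rightarrow> 'x) \<Rightarrow> 'x \<Rightarrow> ('r, 'm, 'g) gmodule
    \<Rightarrow> ('g \<times> 'm) set set" where
  "balanced_points G \<phi> x M = (carrier G \<times> carrier M) // balanced_rel G \<phi> x M"

text \<open>The operations are \<open>[g, m] \<mapsto> g x\<close>, \<open>g' [g, m] = [g' g, m]\<close>, \<open>[g, m] + [g, m'] = [g, m + m']\<close>,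
  \<open>0 = [g, 0]\<close> and \<open>r [g, m] = [g, r m]\<close>; in each case the set of representatives of this form, for
  all choices of representatives of the arguments, is the entire class.\<close>

definition balanced_sheaf ::
  "('g, 'b) monoid_scheme \<Rightarrow> 'g topology \<Rightarrow> ('g \<Rightarrow> 'x \<Rightarrow> 'x) \<Rightarrow> 'x \<Rightarrow> ('r, 'm, 'g) gmodule
    \<Rightarrow> ('x, ('g \<times> 'm) set, 'r, 'g) gsheaf" where
  "balanced_sheaf G TG \<phi> x M = \<lparr>
    total = topology (\<lambda>U. U \<subseteq> balanced_points G \<phi> x M \<and>
      openin (prod_topology TG (discrete_topology (carrier M))) (\<Union>U)),
    proj = (\<lambda>A. the_elem ((\<lambda>(k, m). \<phi> k x) ` A)),
    eact = (\<lambda>g. \<lambda>A\<in>balanced_points G \<phi> x M. (\<lambda>(k, m). (g \<otimes>\<^bsub>G\<^esub> k, m)) ` A),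
    fadd = (\<lambda>A B. {(k, m \<oplus>\<^bsub>M\<^esub> m') | k m m'. (k, m) \<in> A \<and> (k, m') \<in> B}),
    fzero = (\<lambda>y. {(k, \<zero>\<^bsub>M\<^esub>) | k. k \<in> carrier G \<and> \<phi> k x = y}),
    fsmult = (\<lambda>r A. (\<lambda>(k, m). (k, r \<odot>\<^bsub>M\<^esub> m)) ` A)\<rparr>"

definition balanced_map ::
  "('g, 'b) monoid_scheme \<Rightarrow> ('g \<Rightarrow> 'x \<Rightarrow> 'x) \<Rightarrow> 'x \<Rightarrow> ('r, 'm, 'g) gmodule
    \<Rightarrow> ('m \<Rightarrow> 'n) \<Rightarrow> (('g \<times> 'm) set \<Rightarrow> ('g \<times> 'n) set)" where
  "balanced_map G \<phi> x M f = (\<lambda>A\<in>balanced_points G \<phi> x M. (\<lambda>(k, m). (k, f m)) ` A)"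


section \<open>Extension by zero\<close>

definition sections :: "'x topology \<Rightarrow> ('x, 'f, 'r, 'g) gsheaf \<Rightarrow> 'x set \<Rightarrow> ('x \<Rightarrow> 'f) set" where
  "sections TB F V = {s \<in> extensional V.
    continuous_map (subtopology TB V) (total F) s \<and> (\<forall>z\<in>V. proj F (s z) = z)}"

text \<open>For a sheaf \<open>F\<close> over the subspace \<open>Z\<close> of \<open>X\<close>, the total space of \<open>i\<^sub>*F\<close> is the space of germs of
  \<open>U \<mapsto> F(U \<inter> Z)\<close>. A point is a pair \<open>(y, A)\<close> with \<open>A\<close> an equivalence class of pairs \<open>(U, s)\<close>,
  where \<open>U\<close> is an open neighbourhood of \<open>y\<close> in \<open>X\<close> and \<open>s \<in> F(U \<inter> Z)\<close>.\<close>

definition germ ::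
  "'x topology \<Rightarrow> 'x set \<Rightarrow> ('x, 'f, 'r, 'g) gsheaf \<Rightarrow> 'x \<Rightarrow> 'x set \<Rightarrow> ('x \<Rightarrow> 'f)
    \<Rightarrow> ('x set \<times> ('x \<Rightarrow> 'f)) set" where
  "germ TX Z F y U s = {(V, t).
    openin TX V \<and> y \<in> V \<and> t \<in> sections (subtopology TX Z) F (V \<inter> Z) \<and>
    (\<exists>W. openin TX W \<and> y \<in> W \<and> W \<subseteq> U \<inter> V \<and> (\<forall>z\<in>W \<inter> Z. s z = t z))}"

definition germ_topology ::
  "'x topology \<Rightarrow> 'x set \<Rightarrow> ('x, 'f, 'r, 'g) gsheaf \<Rightarrow> ('x \<times> ('x set \<times> ('x \<Rightarrow> 'f)) set) topology"
  where
  "germ_topology TX Z F = topology_generated_by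
    {(\<lambda>y. (y, germ TX Z F y U s)) ` U | U s.
       openin TX U \<and> s \<in> sections (subtopology TX Z) F (U \<inter> Z)}"

text \<open>Operations on germs are operations on sections; the unions over representatives are unions of
  equal sets.\<close>

definition extension_by_zero ::
  "('g, 'b) monoid_scheme \<Rightarrow> 'x topology \<Rightarrow> ('g \<Rightarrow> 'x \<Rightarrow> 'x) \<Rightarrow> 'x set
    \<Rightarrow> ('x, 'f, 'r, 'g) gsheaf
    \<Rightarrow> ('x, 'x \<times> ('x set \<times> ('x \<Rightarrow> 'f)) set, 'r, 'g) gsheaf" where
  "extension_by_zero G TX \<phi> Z F = \<lparr>
    total = germ_topology TX Z F,
    proj = fst,
    eact = (\<lambda>g. restrict
      (\<lambda>(y, A). (\<phi> g y, \<Union>(U, s)\<in>A. germ TX Z F (\<phi> g y) (\<phi> g ` U)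
          (\<lambda>z\<in>\<phi> g ` U \<inter> Z. eact F g (s (\<phi> (inv\<^bsub>G\<^esub> g) z)))))
      (topspace (germ_topology TX Z F))),
    fadd = (\<lambda>(y, A) (y', B). (y, \<Union>(U, s)\<in>A. \<Union>(V, t)\<in>B.
        germ TX Z F y (U \<inter> V) (\<lambda>z\<in>U \<inter> V \<inter> Z. fadd F (s z) (t z)))),
    fzero = (\<lambda>y. (y, germ TX Z F y (topspace TX) (\<lambda>z\<in>topspace TX \<inter> Z. fzero F z))),
    fsmult = (\<lambda>r (y, A). (y, \<Union>(U, s)\<in>A.
        germ TX Z F y U (\<lambda>z\<in>U \<inter> Z. fsmult F r (s z))))\<rparr>"

definition extension_by_zero_map ::
  "'x topology \<Rightarrow> 'x set \<Rightarrow> ('x, 'f, 'r, 'g) gsheaf \<Rightarrow> ('x, 'h, 'r, 'g) gsheaf \<Rightarrow> ('f \<Rightarrow> 'h)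
    \<Rightarrow> 'x \<times> ('x set \<times> ('x \<Rightarrow> 'f)) set \<Rightarrow> 'x \<times> ('x set \<times> ('x \<Rightarrow> 'h)) set" where
  "extension_by_zero_map TX Z F F' p = restrict
    (\<lambda>(y, A). (y, \<Union>(U, s)\<in>A. germ TX Z F' y U (\<lambda>z\<in>U \<inter> Z. p (s z))))
    (topspace (germ_topology TX Z F))"


section \<open>The equivariant skyscraper functor\<close>

definition skyscraper ::
  "('g, 'b) monoid_scheme \<Rightarrow> 'g topology \<Rightarrow> 'x topology \<Rightarrow> ('g \<Rightarrow> 'x \<Rightarrow> 'x) \<Rightarrow> 'x
    \<Rightarrow> ('r, 'm, 'g) gmodule
    \<Rightarrow> ('x, 'x \<times> ('x set \<times> ('x \<Rightarrow> ('g \<times> 'm) set)) set, 'r, 'g) gsheaf" where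
  "skyscraper G TG TX \<phi> x M =
    extension_by_zero G TX \<phi> (orbit G \<phi> x) (balanced_sheaf G TG \<phi> x M)"

definition skyscraper_map ::
  "('g, 'b) monoid_scheme \<Rightarrow> 'g topology \<Rightarrow> 'x topology \<Rightarrow> ('g \<Rightarrow> 'x \<Rightarrow> 'x) \<Rightarrow> 'x
    \<Rightarrow> ('r, 'm, 'g) gmodule \<Rightarrow> ('r, 'n, 'g) gmodule \<Rightarrow> ('m \<Rightarrow> 'n)
    \<Rightarrow> 'x \<times> ('x set \<times> ('x \<Rightarrow> ('g \<times> 'm) set)) set
    \<Rightarrow> 'x \<times> ('x set \<times> ('x \<Rightarrow> ('g \<times> 'n) set)) set" where
  "skyscraper_map G TG TX \<phi> x M N f =
    extension_by_zero_map TX (orbit G \<phi> x)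
      (balanced_sheaf G TG \<phi> x M) (balanced_sheaf G TG \<phi> x N) (balanced_map G \<phi> x M f)"

end

theory Submission
  imports Defs
begin

text \<open>The stalk of \<open>i\<^sub>*(G \<times>\<^bsub>H\<^esub> M)\<close> at \<open>x\<close> is \<open>M\<close>, a germ being sent to the \<open>m\<close> such that its value at \<open>x\<close>
  is \<open>[1, m]\<close>; a morphism \<open>E \<rightarrow> i\<^sub>*(G \<times>\<^bsub>H\<^esub> M)\<close> is thereby sent to a map \<open>E\<^sub>x \<rightarrow> M\<close>. It is determined by this
  map: equivariance gives its values over the orbit, and the stalks of \<open>i\<^sub>*\<close> off the closed orbit
  vanish. Conversely, \<open>f : E\<^sub>x \<rightarrow> M\<close> extends to \<open>e \<mapsto> [g, f (g\<^sup>-\<^sup>1 e)]\<close> for \<open>e\<close> over \<open>g x\<close>. This is continuous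
  because \<open>G \<rightarrow> G x\<close> is open: if \<open>\<sigma>\<close> is a local section of \<open>E\<close> with \<open>\<sigma>(g x) = e\<close>, then
  \<open>\<sigma>(k x) = k g\<^sup>-\<^sup>1 e\<close> for all \<open>k\<close> near \<open>g\<close>, and the extension sends these values to \<open>[k, f (g\<^sup>-\<^sup>1 e)]\<close>.\<close>

section \<open>Local homeomorphisms and group actions\<close>

text \<open>The formula \<open>[g, f (inv g e)]\<close> makes sense only over the orbit. It becomes
  a morphism on all of \<open>X\<close> by passing to germs: \<open>e\<close> is sent to the germ of
  the formula applied to any local section through \<open>e\<close> (\<open>germ_lift\<close>). Off
  the orbit this germ is forced, and over the orbit the choice of the section does not matter,
  because two local sections of a local homeomorphism that agree at a point agree near it. The same
  fact shows that a germ at \<open>x\<close> is determined by its value at \<open>x\<close>, which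
  is the injectivity of the counit. Compactness of \<open>G\<close> and the Hausdorff property of
  \<open>X\<close> make the orbit map closed; this gives both the closed orbit and the openness of
  \<open>G \<rightarrow> G x\<close>. Discreteness of \<open>M\<close> makes the balanced product a
  local homeomorphism over the orbit. The bijection of morphism sets is composition with the counit
  on stalks, so its naturality is that of the counit.\<close>

lemma continuous_map_nbhd:
  assumes "continuous_map X Y f" "a \<in> topspace X" "openin Y U" "f a \<in> U"
  obtains V where "openin X V" "a \<in> V" "\<And>b. b \<in> V \<Longrightarrow> f b \<in> U"
proof (rule that)
  show "openin X {x \<in> topspace X. f x \<in> U}"
    using openin_continuous_map_preimage[OF assms(1,3)] .
qed (use assms in auto)

lemma continuous_map_prod_nbhd:
  assumes c: "continuous_map (prod_topology X X') Y (\<lambda>(a, b). f a b)"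
    and "a \<in> topspace X" "b \<in> topspace X'" "openin Y U" "f a b \<in> U"
  obtains N W where "openin X N" "openin X' W" "a \<in> N" "b \<in> W"
    "\<And>n w. \<lbrakk>n \<in> N; w \<in> W\<rbrakk> \<Longrightarrow> f n w \<in> U"
proof -
  obtain Q where Q: "openin (prod_topology X X') Q" "(a, b) \<in> Q"
    "\<And>q. q \<in> Q \<Longrightarrow> (\<lambda>(a, b). f a b) q \<in> U"
    using continuous_map_nbhd[OF c, of "(a, b)" U] assms by auto
  obtain N W where "openin X N" "openin X' W" "a \<in> N" "b \<in> W" "N \<times> W \<subseteq> Q"
    using Q(1,2) unfolding openin_prod_topology_alt by meson
  then show thesis using that[of N W] Q(3) by fastforce
qed

lemma continuous_map_nbhdI:
  assumes "\<And>a. a \<in> topspace X \<Longrightarrow> f a \<in> topspace Y"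
    and nb: "\<And>a U. \<lbrakk>a \<in> topspace X; openin Y U; f a \<in> U\<rbrakk> \<Longrightarrow>
      \<exists>V. openin X V \<and> a \<in> V \<and> (\<forall>b\<in>V. f b \<in> U)"
  shows "continuous_map X Y f"
proof -
  have "openin X {x \<in> topspace X. f x \<in> U}" if U: "openin Y U" for U
  proof (subst openin_subopen, intro ballI)
    fix a assume a: "a \<in> {x \<in> topspace X. f x \<in> U}"
    then obtain V where "openin X V" "a \<in> V" "\<forall>b\<in>V. f b \<in> U" using nb[OF _ U, of a] by blast
    then show "\<exists>T. openin X T \<and> a \<in> T \<and> T \<subseteq> {x \<in> topspace X. f x \<in> U}"
      using openin_subset[of X V] by blast
  qed
  then show ?thesis using assms(1) by (auto simp: continuous_map_def)
qed

lemma continuous_map_localI: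
  assumes "\<And>a. a \<in> topspace X \<Longrightarrow>
    \<exists>W. openin X W \<and> a \<in> W \<and> continuous_map (subtopology X W) Y f"
  shows "continuous_map X Y f"
proof (rule continuous_map_nbhdI)
  fix a assume a: "a \<in> topspace X"
  then obtain W where W: "openin X W" "a \<in> W" "continuous_map (subtopology X W) Y f"
    using assms by blast
  then show "f a \<in> topspace Y" using a by (auto simp: continuous_map_def Pi_iff)
  fix U assume U: "openin Y U" "f a \<in> U"
  have "a \<in> topspace (subtopology X W)" using a W(2) by simp
  then obtain V where "openin (subtopology X W) V" "a \<in> V" "\<And>b. b \<in> V \<Longrightarrow> f b \<in> U"
    using continuous_map_nbhd[OF W(3) _ U] by metis
  then show "\<exists>V. openin X V \<and> a \<in> V \<and> (\<forall>b\<in>V. f b \<in> U)"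
    using openin_open_subtopology[OF W(1)] by blast
qed

section \<open>Local homeomorphisms and their local sections\<close>

text \<open>The criterion for the balanced product, whose projection inherits openness from the
  orbit map and whose local injectivity comes from the discreteness of the module.\<close>

lemma local_homeo_if_open_map:
  assumes "continuous_map S T p" "open_map S T p"
    and inj: "\<And>e. e \<in> topspace S \<Longrightarrow> \<exists>U. openin S U \<and> e \<in> U \<and> inj_on p U"
  shows "local_homeo S T p"
  unfolding local_homeo_def
proof (intro conjI ballI)
  fix e assume "e \<in> topspace S"
  then obtain U where U: "openin S U" "e \<in> U" "inj_on p U" using inj by blast
  have pU: "openin T (p ` U)" using assms(2) U(1) by (auto simp: open_map_def)
  have sub: "U \<subseteq> topspace S" "p ` U \<subseteq> topspace T"
    using U(1) pU openin_subset by blast+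
  have "homeomorphic_map (subtopology S U) (subtopology T (p ` U)) p"
  proof (rule bijective_open_imp_homeomorphic_map)
    show "continuous_map (subtopology S U) (subtopology T (p ` U)) p"
      using assms(1) by (auto simp: continuous_map_in_subtopology continuous_map_from_subtopology)
    show "open_map (subtopology S U) (subtopology T (p ` U)) p"
      using assms(2) U(1) pU by (auto simp: open_map_def openin_open_subtopology)
  qed (use U sub in \<open>auto simp: inf.absorb2\<close>)
  then show "\<exists>U. openin S U \<and> e \<in> U \<and> openin T (p ` U) \<and>
       homeomorphic_map (subtopology S U) (subtopology T (p ` U)) p" using U pU by blast
qed (fact assms(1))

text \<open>The criterion for spaces of germs: there the image of \<open>V\<close> under
  \<open>s\<close> is a generating open set, and \<open>s\<close> inverts the projection on
  it.\<close>

lemma local_homeo_if_local_sections: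
  assumes p: "continuous_map S T p"
    and sec: "\<And>e. e \<in> topspace S \<Longrightarrow> \<exists>V s. openin T V \<and> e \<in> s ` V \<and> openin S (s ` V) \<and>
      continuous_map (subtopology T V) S s \<and> (\<forall>z\<in>V. p (s z) = z)"
  shows "local_homeo S T p"
  unfolding local_homeo_def
proof (intro conjI ballI)
  fix e assume "e \<in> topspace S"
  then obtain V s where V: "openin T V" "e \<in> s ` V" "openin S (s ` V)"
      "continuous_map (subtopology T V) S s" and ps: "\<forall>z\<in>V. p (s z) = z"
    using sec by metis
  have im: "p ` s ` V = V" using ps by force
  have "homeomorphic_maps (subtopology S (s ` V)) (subtopology T V) p s"
    unfolding homeomorphic_maps_def
    using V p ps by (auto simp: continuous_map_in_subtopology continuous_map_from_subtopology)
  then have "homeomorphic_map (subtopology S (s ` V)) (subtopology T (p ` s ` V)) p"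
    unfolding im using homeomorphic_map_maps by blast
  then show "\<exists>U. openin S U \<and> e \<in> U \<and> openin T (p ` U) \<and>
       homeomorphic_map (subtopology S U) (subtopology T (p ` U)) p"
    using V im by (intro exI[of _ "s ` V"]) auto
qed (fact p)

text \<open>The local inverse of \<open>p\<close>, restricted to \<open>V\<close> so that it is
  extensional as membership in \<open>sections\<close> demands.\<close>

lemma local_homeo_section:
  assumes "local_homeo S T p" "e \<in> topspace S"
  obtains V s where "openin T V" "p e \<in> V" "s (p e) = e" "s \<in> extensional V"
    "continuous_map (subtopology T V) S s" "\<And>z. z \<in> V \<Longrightarrow> p (s z) = z"
proof -
  obtain U where U: "openin S U" "e \<in> U" "openin T (p ` U)"
      "homeomorphic_map (subtopology S U) (subtopology T (p ` U)) p"
    using assms unfolding local_homeo_def by blast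
  obtain s where s: "homeomorphic_maps (subtopology S U) (subtopology T (p ` U)) p s"
    using U(4) homeomorphic_map_maps by blast
  have sub: "U \<subseteq> topspace S" "p ` U \<subseteq> topspace T" using U openin_subset by blast+
  have c: "continuous_map (subtopology T (p ` U)) S s"
    using s unfolding homeomorphic_maps_def by (auto simp: continuous_map_in_subtopology)
  show thesis
  proof (rule that[of "p ` U" "restrict s (p ` U)"])
    show "continuous_map (subtopology T (p ` U)) S (restrict s (p ` U))"
      by (rule continuous_map_eq[OF c]) auto
    show "p (restrict s (p ` U) z) = z" if "z \<in> p ` U" for z
      using that s sub unfolding homeomorphic_maps_def by (auto simp: subset_iff)
    show "restrict s (p ` U) (p e) = e"
      using s U(2) sub unfolding homeomorphic_maps_def by (auto simp: subset_iff)
  qed (use U in auto)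
qed

lemma local_homeo_locally_inj:
  assumes "local_homeo S T p" "e \<in> topspace S"
  obtains U where "openin S U" "e \<in> U" "inj_on p U"
proof -
  obtain U where U: "openin S U" "e \<in> U" "openin T (p ` U)"
      "homeomorphic_map (subtopology S U) (subtopology T (p ` U)) p"
    using assms unfolding local_homeo_def by blast
  have "inj_on p (topspace S \<inter> U)"
    using homeomorphic_imp_injective_map[OF U(4)] by simp
  then show thesis using that U openin_subset[OF U(1)] by (simp add: inf.absorb2)
qed

text \<open>Near \<open>s z\<close> take an open \<open>U\<close> on which \<open>p\<close> is
  injective. A point of \<open>U\<close> that projects to a place where \<open>s\<close> also lands
  in \<open>U\<close> must be the value of \<open>s\<close> there, so a whole neighbourhood of
  \<open>s z\<close> lies in the image.\<close>

lemma local_homeo_section_image_open: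
  assumes "local_homeo S T p" "openin T V" "continuous_map (subtopology T V) S s"
    and "\<And>z. z \<in> V \<Longrightarrow> p (s z) = z"
  shows "openin S (s ` V)"
proof (subst openin_subopen, intro ballI)
  fix e assume "e \<in> s ` V"
  then obtain z where z: "z \<in> V" "e = s z" by blast
  have sub: "V \<subseteq> topspace T" using assms(2) openin_subset by blast
  have "e \<in> topspace S" using z assms(3) sub by (auto simp: continuous_map_def Pi_iff)
  then obtain U where U: "openin S U" "e \<in> U" "inj_on p U"
    using local_homeo_locally_inj[OF assms(1)] by blast
  define V' where "V' = {z \<in> V. s z \<in> U}"
  have "openin (subtopology T V) {z \<in> topspace (subtopology T V). s z \<in> U}"
    using assms(3) U(1) openin_continuous_map_preimage by blast
  moreover have "{z \<in> topspace (subtopology T V). s z \<in> U} = V'"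
    using sub by (auto simp: V'_def)
  ultimately have V': "openin T V'" using assms(2) openin_open_subtopology by metis
  have p: "continuous_map S T p" using assms(1) by (simp add: local_homeo_def)
  have "openin S {e \<in> U. p e \<in> V'}"
    using openin_continuous_map_preimage_gen[OF p U(1) V'] .
  moreover have "{e \<in> U. p e \<in> V'} \<subseteq> s ` V"
  proof
    fix a assume "a \<in> {e \<in> U. p e \<in> V'}"
    then have a: "a \<in> U" "p a \<in> V" "s (p a) \<in> U" by (auto simp: V'_def)
    then have "s (p a) = a" using U(3) assms(4) by (meson inj_onD)
    then show "a \<in> s ` V" using a by force
  qed
  ultimately show "\<exists>T. openin S T \<and> e \<in> T \<and> T \<subseteq> s ` V"
    using z U assms(4) by (intro exI[of _ "{e \<in> U. p e \<in> V'}"]) (auto simp: V'_def)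
qed

section \<open>Abstract and continuous group actions\<close>

text \<open>\<open>group_action\<close> is a homomorphism into the group of extensional bijections
  of \<open>S\<close>, hence the extensionality hypothesis; bijectivity comes from the inverse group
  elements.\<close>

lemma group_actionI:
  assumes "group G"
    and ext: "\<And>g. g \<in> carrier G \<Longrightarrow> \<psi> g \<in> extensional S"
    and cl: "\<And>g a. \<lbrakk>g \<in> carrier G; a \<in> S\<rbrakk> \<Longrightarrow> \<psi> g a \<in> S"
    and one: "\<And>a. a \<in> S \<Longrightarrow> \<psi> \<one>\<^bsub>G\<^esub> a = a"
    and mult: "\<And>g h a. \<lbrakk>g \<in> carrier G; h \<in> carrier G; a \<in> S\<rbrakk> \<Longrightarrow> \<psi> (g \<otimes>\<^bsub>G\<^esub> h) a = \<psi> g (\<psi> h a)"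
  shows "group_action G S \<psi>"
proof -
  interpret group G by fact
  have inv: "\<psi> (inv\<^bsub>G\<^esub> g) (\<psi> g a) = a" "\<psi> g (\<psi> (inv\<^bsub>G\<^esub> g) a) = a" if "g \<in> carrier G" "a \<in> S" for g a
    using that mult[of "inv\<^bsub>G\<^esub> g" g a] mult[of g "inv\<^bsub>G\<^esub> g" a] one by auto
  have bij: "\<psi> g \<in> Bij S" if g: "g \<in> carrier G" for g
  proof -
    have "bij_betw (\<psi> g) S S"
      by (rule bij_betw_byWitness[where f' = "\<psi> (inv\<^bsub>G\<^esub> g)"]) (use g inv cl in auto)
    then show ?thesis using ext g by (simp add: Bij_def)
  qed
  have "\<psi> (g \<otimes>\<^bsub>G\<^esub> h) = compose S (\<psi> g) (\<psi> h)" if "g \<in> carrier G" "h \<in> carrier G" for g h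
  proof (rule extensionalityI[of _ S])
    show "\<psi> (g \<otimes>\<^bsub>G\<^esub> h) \<in> extensional S" using ext that by simp
  qed (auto simp: compose_def mult that)
  then have "\<psi> \<in> hom G (BijGroup S)"
    using bij by (auto simp: hom_def BijGroup_def)
  then have "group_hom G (BijGroup S) \<psi>"
    by (simp add: group_hom_def group_hom_axioms_def group_BijGroup is_group)
  then show ?thesis by (simp add: group_action_def)
qed

lemma group_action_group: "group_action G S \<psi> \<Longrightarrow> group G"
  using group_action.group_hom group_hom.axioms(1) by blast

lemma group_action_one: "\<lbrakk>group_action G S \<psi>; a \<in> S\<rbrakk> \<Longrightarrow> \<psi> \<one>\<^bsub>G\<^esub> a = a"
  by (metis group_action.id_eq_one restrict_apply')

lemma group_action_closed: "\<lbrakk>group_action G S \<psi>; g \<in> carrier G; a \<in> S\<rbrakk> \<Longrightarrow> \<psi> g a \<in> S"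
  using group_action.element_image by metis

lemma group_action_inv:
  assumes "group_action G S \<psi>" "g \<in> carrier G" "a \<in> S"
  shows "\<psi> (inv\<^bsub>G\<^esub> g) (\<psi> g a) = a" "\<psi> g (\<psi> (inv\<^bsub>G\<^esub> g) a) = a"
proof -
  interpret group G using assms(1) by (rule group_action_group)
  have "inv\<^bsub>G\<^esub> g \<in> carrier G" using assms by simp
  then show "\<psi> (inv\<^bsub>G\<^esub> g) (\<psi> g a) = a" "\<psi> g (\<psi> (inv\<^bsub>G\<^esub> g) a) = a"
    using group_action.composition_rule[OF assms(1,3)] assms(2) group_action_one[OF assms(1,3)]
    by (metis l_inv, metis r_inv)
qed

lemma G_space_continuous:
  assumes "G_space G TG T \<psi>" "topspace TG = carrier G" "g \<in> carrier G"
  shows "continuous_map T T (\<psi> g)"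
proof -
  have "continuous_map T (prod_topology TG T) (\<lambda>a. (g, a))"
    using assms by (intro continuous_map_pairedI) auto
  then have "continuous_map T T ((\<lambda>(g, y). \<psi> g y) \<circ> (\<lambda>a. (g, a)))"
    using assms(1) unfolding G_space_def by (blast intro: continuous_map_compose)
  then show ?thesis by (simp add: comp_def)
qed

text \<open>The image under \<open>g\<close> is the preimage under the continuous action of the
  inverse of \<open>g\<close>.\<close>

lemma G_space_image_open:
  assumes GS: "G_space G TG T \<psi>" and tG: "topspace TG = carrier G" and g: "g \<in> carrier G"
    and U: "openin T U"
  shows "openin T (\<psi> g ` U)"
proof -
  have ga: "group_action G (topspace T) \<psi>" using GS by (simp add: G_space_def)
  interpret group G using ga by (rule group_action_group)
  have "openin T {y \<in> topspace T. \<psi> (inv\<^bsub>G\<^esub> g) y \<in> U}"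
    using G_space_continuous[OF GS tG] g U openin_continuous_map_preimage by blast
  moreover have "{y \<in> topspace T. \<psi> (inv\<^bsub>G\<^esub> g) y \<in> U} = \<psi> g ` U"
  proof (intro equalityI subsetI)
    fix y assume "y \<in> {y \<in> topspace T. \<psi> (inv\<^bsub>G\<^esub> g) y \<in> U}"
    then show "y \<in> \<psi> g ` U" using group_action_inv(2)[OF ga g, of y] by force
  next
    fix y assume "y \<in> \<psi> g ` U"
    then show "y \<in> {y \<in> topspace T. \<psi> (inv\<^bsub>G\<^esub> g) y \<in> U}"
      using group_action_inv(1)[OF ga g] group_action_closed[OF ga g] openin_subset[OF U] by auto
  qed
  ultimately show ?thesis by simp
qed

section \<open>Sections of an equivariant sheaf\<close>

lemma stalk_simps [simp]:
  "carrier (stalk E y) = {e \<in> topspace (total E). proj E e = y}"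
  "add (stalk E y) = fadd E"
  "ring.zero (stalk E y) = fzero E y"
  "smult (stalk E y) = fsmult E"
  "gact (stalk E y) = (\<lambda>g. restrict (eact E g) {e \<in> topspace (total E). proj E e = y})"
  by (simp_all add: stalk_def)

section \<open>Linear maps and modules\<close>

lemma linear_mapsD:
  assumes "f \<in> linear_maps R M N"
  shows "a \<in> carrier M \<Longrightarrow> f a \<in> carrier N"
    and "\<lbrakk>a \<in> carrier M; b \<in> carrier M\<rbrakk> \<Longrightarrow> f (a \<oplus>\<^bsub>M\<^esub> b) = f a \<oplus>\<^bsub>N\<^esub> f b"
    and "\<lbrakk>r \<in> carrier R; a \<in> carrier M\<rbrakk> \<Longrightarrow> f (r \<odot>\<^bsub>M\<^esub> a) = r \<odot>\<^bsub>N\<^esub> f a"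
  using assms by (auto simp: linear_maps_def)

lemma left_moduleD:
  assumes "left_module R M"
  shows "abelian_group M"
    and "\<lbrakk>r \<in> carrier R; a \<in> carrier M\<rbrakk> \<Longrightarrow> r \<odot>\<^bsub>M\<^esub> a \<in> carrier M"
    and "\<lbrakk>r \<in> carrier R; s \<in> carrier R; a \<in> carrier M\<rbrakk> \<Longrightarrow>
       (r \<oplus>\<^bsub>R\<^esub> s) \<odot>\<^bsub>M\<^esub> a = (r \<odot>\<^bsub>M\<^esub> a) \<oplus>\<^bsub>M\<^esub> (s \<odot>\<^bsub>M\<^esub> a)"
    and "\<lbrakk>r \<in> carrier R; a \<in> carrier M; b \<in> carrier M\<rbrakk> \<Longrightarrow>
       r \<odot>\<^bsub>M\<^esub> (a \<oplus>\<^bsub>M\<^esub> b) = (r \<odot>\<^bsub>M\<^esub> a) \<oplus>\<^bsub>M\<^esub> (r \<odot>\<^bsub>M\<^esub> b)"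
    and "\<lbrakk>r \<in> carrier R; s \<in> carrier R; a \<in> carrier M\<rbrakk> \<Longrightarrow>
       (r \<otimes>\<^bsub>R\<^esub> s) \<odot>\<^bsub>M\<^esub> a = r \<odot>\<^bsub>M\<^esub> (s \<odot>\<^bsub>M\<^esub> a)"
    and "a \<in> carrier M \<Longrightarrow> \<one>\<^bsub>R\<^esub> \<odot>\<^bsub>M\<^esub> a = a"
  using assms by (auto simp: left_module_def)

text \<open>The module laws are equations, so they pass to the image under any map respecting the
  operations, and images of negatives are negatives. With \<open>h = cls g\<close> this gives the
  module structure on the fibre of the balanced product over \<open>g x\<close>.\<close>

lemma left_module_image:
  assumes L: "left_module R M" and im: "carrier N = h ` carrier M"
    and add: "\<And>a b. \<lbrakk>a \<in> carrier M; b \<in> carrier M\<rbrakk> \<Longrightarrow> h a \<oplus>\<^bsub>N\<^esub> h b = h (a \<oplus>\<^bsub>M\<^esub> b)"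
    and zero: "\<zero>\<^bsub>N\<^esub> = h \<zero>\<^bsub>M\<^esub>"
    and smult: "\<And>r a. \<lbrakk>r \<in> carrier R; a \<in> carrier M\<rbrakk> \<Longrightarrow> r \<odot>\<^bsub>N\<^esub> h a = h (r \<odot>\<^bsub>M\<^esub> a)"
  shows "left_module R N"
proof -
  interpret M: abelian_group M using L by (rule left_moduleD)
  interpret R: ring R using L by (simp add: left_module_def)
  have "\<exists>b\<in>h ` carrier M. b \<oplus>\<^bsub>N\<^esub> h a = h \<zero>\<^bsub>M\<^esub>" if a: "a \<in> carrier M" for a
    using add[OF M.a_inv_closed[OF a] a] M.l_neg[OF a] M.a_inv_closed[OF a] by auto
  then have "abelian_group N"
    by (intro abelian_groupI) (auto simp: im add zero M.a_ac)
  then show ?thesis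
    unfolding left_module_def im
    using left_moduleD[OF L] R.ring_axioms by (simp add: add smult)
qed

lemma linear_maps_zero:
  assumes "f \<in> linear_maps R M N" "abelian_group M" "abelian_group N"
  shows "f \<zero>\<^bsub>M\<^esub> = \<zero>\<^bsub>N\<^esub>"
proof -
  interpret M: abelian_group M by fact
  interpret N: abelian_group N by fact
  have "f \<zero>\<^bsub>M\<^esub> \<oplus>\<^bsub>N\<^esub> f \<zero>\<^bsub>M\<^esub> = f \<zero>\<^bsub>M\<^esub>"
    using linear_mapsD(2)[OF assms(1), of "\<zero>\<^bsub>M\<^esub>" "\<zero>\<^bsub>M\<^esub>"] by simp
  then show ?thesis
    using linear_mapsD(1)[OF assms(1), of "\<zero>\<^bsub>M\<^esub>"] N.add.l_cancel_one by force
qed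

section \<open>Continuous sections and pointwise operations on them\<close>

lemma sectionsD:
  assumes "s \<in> sections TB F V"
  shows "s \<in> extensional V" "continuous_map (subtopology TB V) (total F) s"
    "z \<in> V \<Longrightarrow> proj F (s z) = z"
  using assms by (auto simp: sections_def)

lemma sections_mem:
  assumes "s \<in> sections TB F V" "z \<in> V" "z \<in> topspace TB"
  shows "s z \<in> topspace (total F)"
  using sectionsD(2)[OF assms(1)] assms(2,3) by (auto simp: continuous_map_def Pi_iff)

lemma sectionsI:
  assumes "continuous_map (subtopology TB V) (total F) s" "\<And>z. z \<in> V \<Longrightarrow> proj F (s z) = z"
  shows "restrict s V \<in> sections TB F V"
proof -
  have "continuous_map (subtopology TB V) (total F) (restrict s V)"
    by (rule continuous_map_eq[OF assms(1)]) auto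
  then show ?thesis using assms(2) by (auto simp: sections_def)
qed

lemma sections_restrict:
  assumes "s \<in> sections TB F V" "W \<subseteq> V"
  shows "restrict s W \<in> sections TB F W"
  by (rule sectionsI)
    (use sectionsD[OF assms(1)] assms(2) continuous_map_from_subtopology_mono in blast)+

text \<open>The base \<open>TB\<close> is kept general so that the facts on sections serve both
  sheaves over \<open>X\<close> and sheaves over a closed subspace.\<close>

locale gsheaf_on =
  fixes G :: "('g, 'b) monoid_scheme" and TG :: "'g topology" and R :: "('r, 'c) ring_scheme"
    and TB :: "'x topology" and \<phi> :: "'g \<Rightarrow> 'x \<Rightarrow> 'x" and E :: "('x, 'e, 'r, 'g) gsheaf"
  assumes sheaf: "is_gsheaf G TG R TB \<phi> E"
begin

lemma G_space_total: "G_space G TG (total E) (eact E)"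
  and local_homeo_proj: "local_homeo (total E) TB (proj E)"
  and left_module_stalk: "y \<in> topspace TB \<Longrightarrow> left_module R (stalk E y)"
  and continuous_fsmult: "r \<in> carrier R \<Longrightarrow> continuous_map (total E) (total E) (fsmult E r)"
  and eact_linear: "\<lbrakk>g \<in> carrier G; y \<in> topspace TB\<rbrakk> \<Longrightarrow>
      eact E g \<in> linear_maps R (stalk E y) (stalk E (\<phi> g y))"
  and proj_eact: "\<lbrakk>g \<in> carrier G; e \<in> topspace (total E)\<rbrakk> \<Longrightarrow>
      proj E (eact E g e) = \<phi> g (proj E e)"
  and continuous_fminus: "continuous_map
      (subtopology (prod_topology (total E) (total E)) {(a, b). proj E a = proj E b})
      (total E) (\<lambda>(a, b). a \<ominus>\<^bsub>stalk E (proj E a)\<^esub> b)"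
  using sheaf unfolding is_gsheaf_def by blast+

lemma action_total: "group_action G (topspace (total E)) (eact E)"
  using G_space_total by (simp add: G_space_def)

lemma continuous_proj: "continuous_map (total E) TB (proj E)"
  using local_homeo_proj by (simp add: local_homeo_def)

lemma abelian_group_stalk: "y \<in> topspace TB \<Longrightarrow> abelian_group (stalk E y)"
  using left_module_stalk left_moduleD(1) by blast

lemma section_through:
  assumes "e \<in> topspace (total E)"
  obtains V s where "openin TB V" "proj E e \<in> V" "s \<in> sections TB E V" "s (proj E e) = e"
proof -
  obtain V s where V: "openin TB V" "proj E e \<in> V" "s (proj E e) = e" "s \<in> extensional V"
    "continuous_map (subtopology TB V) (total E) s" "\<And>z. z \<in> V \<Longrightarrow> proj E (s z) = z"
    using local_homeo_section[OF local_homeo_proj assms] by metis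
  show thesis by (rule that[of V s]) (use V in \<open>auto simp: sections_def\<close>)
qed

lemma section_image_open:
  assumes "s \<in> sections TB E V" "openin TB V"
  shows "openin (total E) (s ` V)"
  using local_homeo_section_image_open[OF local_homeo_proj assms(2)] sectionsD[OF assms(1)] by blast

text \<open>A value \<open>t z\<close> lies in the open image of \<open>s\<close> exactly when it
  equals \<open>s z\<close>, since the projection recovers the point. The set of agreement is
  therefore a preimage under \<open>t\<close> of an open set.\<close>

lemma sections_agree_open:
  assumes s: "s \<in> sections TB E U" and t: "t \<in> sections TB E V"
    and "openin TB U" "openin TB V"
  shows "openin TB {z \<in> U \<inter> V. s z = t z}"
proof -
  have sub: "V \<subseteq> topspace TB" using assms(4) openin_subset by blast
  have "openin (subtopology TB V) {z \<in> topspace (subtopology TB V). t z \<in> s ` U}"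
    using sectionsD(2)[OF t] section_image_open[OF s assms(3)] openin_continuous_map_preimage
    by blast
  moreover have "{z \<in> topspace (subtopology TB V). t z \<in> s ` U} = {z \<in> U \<inter> V. s z = t z}"
  proof -
    have "z \<in> U \<and> s z = t z" if "z \<in> V" "t z = s u" "u \<in> U" for z u
      using sectionsD(3)[OF s] sectionsD(3)[OF t] that by metis
    then show ?thesis using sub by (auto intro: rev_image_eqI)
  qed
  ultimately show ?thesis using openin_open_subtopology[OF assms(4)] by simp
qed

lemma sections_stalk:
  "\<lbrakk>s \<in> sections TB E U; z \<in> U; U \<subseteq> topspace TB\<rbrakk> \<Longrightarrow> s z \<in> carrier (stalk E z)"
  using sections_mem[of s TB E U z] sectionsD(3)[of s TB E U z] by auto

text \<open>Subtraction is the additive operation whose continuity the sheaf axioms supply. The zero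
  section, negation and addition are obtained from it below, as \<open>s - s\<close>,
  \<open>0 - s\<close> and \<open>s - (- t)\<close>.\<close>

lemma sections_minus:
  assumes s: "s \<in> sections TB E U" and t: "t \<in> sections TB E U" and U: "U \<subseteq> topspace TB"
  shows "(\<lambda>z\<in>U. s z \<ominus>\<^bsub>stalk E z\<^esub> t z) \<in> sections TB E U"
proof (rule sectionsI)
  have "continuous_map (subtopology TB U)
      (subtopology (prod_topology (total E) (total E)) {(a, b). proj E a = proj E b})
      (\<lambda>z. (s z, t z))"
    unfolding continuous_map_in_subtopology
    using sectionsD[OF s] sectionsD[OF t] by (auto intro!: continuous_map_pairedI)
  from continuous_map_compose[OF this continuous_fminus]
  show "continuous_map (subtopology TB U) (total E) (\<lambda>z. s z \<ominus>\<^bsub>stalk E z\<^esub> t z)"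
    by (rule continuous_map_eq) (use sectionsD[OF s] in auto)
next
  fix z assume z: "z \<in> U"
  then interpret abelian_group "stalk E z" using U abelian_group_stalk by blast
  show "proj E (s z \<ominus>\<^bsub>stalk E z\<^esub> t z) = z"
    using minus_closed[OF sections_stalk[OF s z U] sections_stalk[OF t z U]] by simp
qed

text \<open>Continuity is local, and near any point the zero section is \<open>s - s\<close> for a
  section \<open>s\<close> defined there.\<close>

lemma sections_zero:
  assumes U: "U \<subseteq> topspace TB"
  shows "(\<lambda>z\<in>U. fzero E z) \<in> sections TB E U"
proof (rule sectionsI)
  show "proj E (fzero E z) = z" if "z \<in> U" for z
  proof -
    interpret abelian_group "stalk E z" using that U abelian_group_stalk by blast
    show ?thesis using zero_closed by simp
  qed
  show "continuous_map (subtopology TB U) (total E) (fzero E)"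
  proof (rule continuous_map_localI)
    fix a assume "a \<in> topspace (subtopology TB U)"
    then have a: "a \<in> topspace TB" "a \<in> U" by auto
    interpret abelian_group "stalk E a" using a abelian_group_stalk by blast
    \<comment> \<open>The zero of the fibre over \<open>a\<close> only guarantees that some point
      lies over \<open>a\<close>, hence that some section exists near \<open>a\<close>.\<close>
    have "fzero E a \<in> topspace (total E)" "proj E (fzero E a) = a"
      using zero_closed by auto
    then obtain V s where V: "openin TB V" "a \<in> V" "s \<in> sections TB E V"
      using section_through by metis
    have Vt: "V \<subseteq> topspace TB" using V openin_subset by blast
    have d: "(\<lambda>z\<in>V. s z \<ominus>\<^bsub>stalk E z\<^esub> s z) \<in> sections TB E V"
      using sections_minus V Vt by blast
    have "continuous_map (subtopology TB V) (total E) (fzero E)"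
    proof (rule continuous_map_eq[OF sectionsD(2)[OF d]])
      fix z assume "z \<in> topspace (subtopology TB V)"
      then have z: "z \<in> V" by simp
      then interpret abelian_group "stalk E z" using Vt abelian_group_stalk by blast
      show "(\<lambda>z\<in>V. s z \<ominus>\<^bsub>stalk E z\<^esub> s z) z = fzero E z"
        using r_neg[OF sections_stalk[OF V(3) z Vt]] z by (simp add: a_minus_def)
    qed
    then have "continuous_map (subtopology (subtopology TB U) (V \<inter> U)) (total E) (fzero E)"
      unfolding subtopology_subtopology by (rule continuous_map_from_subtopology_mono) auto
    then show "\<exists>W. openin (subtopology TB U) W \<and> a \<in> W \<and>
        continuous_map (subtopology (subtopology TB U) W) (total E) (fzero E)"
      using a V by (auto simp: openin_subtopology)
  qed
qed

lemma sections_uminus: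
  assumes s: "s \<in> sections TB E U" and U: "U \<subseteq> topspace TB"
  shows "(\<lambda>z\<in>U. \<ominus>\<^bsub>stalk E z\<^esub> s z) \<in> sections TB E U"
proof -
  have "(\<lambda>z\<in>U. (\<lambda>z\<in>U. fzero E z) z \<ominus>\<^bsub>stalk E z\<^esub> s z) = (\<lambda>z\<in>U. \<ominus>\<^bsub>stalk E z\<^esub> s z)"
  proof (rule restrict_ext)
    fix z assume z: "z \<in> U"
    then interpret abelian_group "stalk E z" using U abelian_group_stalk by blast
    show "(\<lambda>z\<in>U. fzero E z) z \<ominus>\<^bsub>stalk E z\<^esub> s z = \<ominus>\<^bsub>stalk E z\<^esub> s z"
      using l_zero[OF a_inv_closed[OF sections_stalk[OF s z U]]] z by (simp add: a_minus_def)
  qed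
  then show ?thesis using sections_minus[OF sections_zero[OF U] s U] by simp
qed

lemma sections_add:
  assumes s: "s \<in> sections TB E U" and t: "t \<in> sections TB E U" and U: "U \<subseteq> topspace TB"
  shows "(\<lambda>z\<in>U. fadd E (s z) (t z)) \<in> sections TB E U"
proof -
  have "(\<lambda>z\<in>U. s z \<ominus>\<^bsub>stalk E z\<^esub> (\<lambda>z\<in>U. \<ominus>\<^bsub>stalk E z\<^esub> t z) z) = (\<lambda>z\<in>U. fadd E (s z) (t z))"
  proof (rule restrict_ext)
    fix z assume z: "z \<in> U"
    then interpret abelian_group "stalk E z" using U abelian_group_stalk by blast
    show "s z \<ominus>\<^bsub>stalk E z\<^esub> (\<lambda>z\<in>U. \<ominus>\<^bsub>stalk E z\<^esub> t z) z = fadd E (s z) (t z)"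
      using minus_minus[OF sections_stalk[OF t z U]] z by (simp add: a_minus_def)
  qed
  then show ?thesis using sections_minus[OF s sections_uminus[OF t U] U] by simp
qed

lemma sections_smult:
  assumes s: "s \<in> sections TB E U" and r: "r \<in> carrier R" and U: "U \<subseteq> topspace TB"
  shows "(\<lambda>z\<in>U. fsmult E r (s z)) \<in> sections TB E U"
proof (rule sectionsI)
  show "continuous_map (subtopology TB U) (total E) (\<lambda>z. fsmult E r (s z))"
    using continuous_map_compose[OF sectionsD(2)[OF s] continuous_fsmult[OF r]]
    by (simp add: comp_def)
  show "proj E (fsmult E r (s z)) = z" if z: "z \<in> U" for z
    using left_moduleD(2)[OF left_module_stalk r sections_stalk[OF s z U]] z U by auto
qed

end

section \<open>Germs\<close>

definition local_section ::
  "'x topology \<Rightarrow> 'x set \<Rightarrow> ('x, 'f, 'r, 'g) gsheaf \<Rightarrow> 'x set \<Rightarrow> ('x \<Rightarrow> 'f) \<Rightarrow> bool" where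
  "local_section TX Z F U s \<longleftrightarrow> openin TX U \<and> s \<in> sections (subtopology TX Z) F (U \<inter> Z)"

lemma local_section_subset: "local_section TX Z F U s \<Longrightarrow> U \<subseteq> topspace TX"
  by (simp add: local_section_def openin_subset)

lemma germ_mem: "\<lbrakk>local_section TX Z F U s; y \<in> U\<rbrakk> \<Longrightarrow> (U, s) \<in> germ TX Z F y U s"
  by (auto simp: germ_def local_section_def)

text \<open>A germ is encoded as the set of all its representatives, so equality is a pair of
  inclusions. Each holds because agreement near \<open>y\<close> is transitive once the two
  neighbourhoods are intersected.\<close>

lemma germ_eqI:
  assumes "openin TX W" "y \<in> W" "W \<subseteq> U \<inter> V" "\<And>z. z \<in> W \<inter> Z \<Longrightarrow> s z = t z"
  shows "germ TX Z F y U s = germ TX Z F y V t"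
proof -
  \<comment> \<open>Stated for arbitrary representatives so that exchanging the roles of the two
    gives the reverse inclusion.\<close>
  have "germ TX Z F y U1 s1 \<subseteq> germ TX Z F y V1 t1"
    if sub: "W \<subseteq> U1 \<inter> V1" and eq: "\<And>z. z \<in> W \<inter> Z \<Longrightarrow> s1 z = t1 z" for U1 V1 s1 t1
  proof
    fix p assume "p \<in> germ TX Z F y U1 s1"
    then obtain V' t' W' where p: "p = (V', t')" and V': "openin TX V'" "y \<in> V'"
        "t' \<in> sections (subtopology TX Z) F (V' \<inter> Z)"
      and W': "openin TX W'" "y \<in> W'" "W' \<subseteq> U1 \<inter> V'" "\<forall>z\<in>W' \<inter> Z. s1 z = t' z"
      unfolding germ_def by blast
    have "t1 z = t' z" if "z \<in> (W \<inter> W') \<inter> Z" for z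
      using eq[of z] W'(4) that by auto
    moreover have "openin TX (W \<inter> W')" "y \<in> W \<inter> W'" "W \<inter> W' \<subseteq> V1 \<inter> V'"
      using assms(1,2) W' sub by auto
    ultimately have "\<exists>W. openin TX W \<and> y \<in> W \<and> W \<subseteq> V1 \<inter> V' \<and> (\<forall>z\<in>W \<inter> Z. t1 z = t' z)"
      by blast
    then show "p \<in> germ TX Z F y V1 t1" using V' unfolding p germ_def by blast
  qed
  from this[of U V s t] this[of V U t s] show ?thesis using assms(3,4) by (metis Int_commute subset_antisym)
qed

lemma germ_eqD:
  assumes "local_section TX Z F U s" "y \<in> U" "germ TX Z F y U s = germ TX Z F y V t"
  obtains W where "openin TX W" "y \<in> W" "W \<subseteq> U \<inter> V" "\<And>z. z \<in> W \<inter> Z \<Longrightarrow> s z = t z"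
proof -
  have "(U, s) \<in> germ TX Z F y V t" using germ_mem[OF assms(1,2)] assms(3) by simp
  then obtain W where "openin TX W" "y \<in> W" "W \<subseteq> V \<inter> U" "\<forall>z\<in>W \<inter> Z. t z = s z"
    unfolding germ_def by blast
  then show thesis using that[of W] by auto
qed

lemma germ_memD:
  assumes "(V, t) \<in> germ TX Z F y U s"
  shows "local_section TX Z F V t" "y \<in> V" "germ TX Z F y V t = germ TX Z F y U s"
proof -
  obtain W where W: "openin TX W" "y \<in> W" "W \<subseteq> U \<inter> V" "\<forall>z\<in>W \<inter> Z. s z = t z"
    and "openin TX V" "y \<in> V" "t \<in> sections (subtopology TX Z) F (V \<inter> Z)"
    using assms unfolding germ_def by blast
  then show "local_section TX Z F V t" "y \<in> V" by (auto simp: local_section_def)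
  show "germ TX Z F y V t = germ TX Z F y U s"
    by (rule germ_eqI[OF W(1,2)]) (use W in auto)
qed

lemma local_section_restrict:
  assumes "local_section TX Z F U s" "openin TX W" "W \<subseteq> U"
  shows "local_section TX Z F W (restrict s (W \<inter> Z))"
  using assms sections_restrict[of s _ F "U \<inter> Z" "W \<inter> Z"] by (auto simp: local_section_def)

lemma germ_restrict:
  assumes "openin TX W" "W \<subseteq> U" "y \<in> W"
  shows "germ TX Z F y W (restrict s (W \<inter> Z)) = germ TX Z F y U s"
  by (rule germ_eqI[OF assms(1,3)]) (use assms in auto)

section \<open>The topology on the space of germs\<close>

lemma topspace_germ_topology:
  "topspace (germ_topology TX Z F) = {(y, germ TX Z F y U s) | y U s. local_section TX Z F U s \<and> y \<in> U}"
  unfolding germ_topology_def topology_generated_by_topspace local_section_def by blast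

lemma germ_in_topspace:
  "\<lbrakk>local_section TX Z F U s; y \<in> U\<rbrakk> \<Longrightarrow> (y, germ TX Z F y U s) \<in> topspace (germ_topology TX Z F)"
  unfolding topspace_germ_topology by blast

lemma germ_topology_cases:
  assumes "a \<in> topspace (germ_topology TX Z F)"
  obtains U s where "a = (fst a, germ TX Z F (fst a) U s)" "local_section TX Z F U s" "fst a \<in> U"
  using assms unfolding topspace_germ_topology by force

text \<open>The generating open sets are images of full domains; an image over a smaller
  \<open>W\<close> is one of them after restricting the section to \<open>W\<close>.\<close>

lemma germ_image_open:
  assumes "local_section TX Z F U s" "openin TX W" "W \<subseteq> U"
  shows "openin (germ_topology TX Z F) ((\<lambda>y. (y, germ TX Z F y U s)) ` W)"
proof -
  have "(\<lambda>y. (y, germ TX Z F y U s)) ` W = (\<lambda>y. (y, germ TX Z F y W (restrict s (W \<inter> Z)))) ` W"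
    by (rule image_cong) (simp_all add: germ_restrict[OF assms(2,3)])
  then show ?thesis
    using local_section_restrict[OF assms] unfolding germ_topology_def local_section_def
    by (auto intro!: topology_generated_by_Basis)
qed

text \<open>The germ topology is given by generators, so continuity is tested on them: whenever
  \<open>f a\<close> is the germ of some \<open>t\<close>, nearby points must go to germs of the
  same \<open>t\<close>.\<close>

lemma continuous_map_into_germs:
  assumes im: "\<And>a. a \<in> topspace X \<Longrightarrow> f a \<in> topspace (germ_topology TX Z F)"
    and nb: "\<And>a V t. \<lbrakk>a \<in> topspace X; local_section TX Z F V t; fst (f a) \<in> V;
        f a = (fst (f a), germ TX Z F (fst (f a)) V t)\<rbrakk> \<Longrightarrow>
      \<exists>T. openin X T \<and> a \<in> T \<and> (\<forall>b\<in>T. f b \<in> (\<lambda>y. (y, germ TX Z F y V t)) ` V)"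
  shows "continuous_map X (germ_topology TX Z F) f"
  unfolding germ_topology_def
proof (rule continuous_on_generated_topo)
  show "f ` topspace X \<subseteq> \<Union> {(\<lambda>y. (y, germ TX Z F y U s)) ` U |U s.
      openin TX U \<and> s \<in> sections (subtopology TX Z) F (U \<inter> Z)}"
    using im unfolding germ_topology_def topology_generated_by_topspace by blast
  fix B assume "B \<in> {(\<lambda>y. (y, germ TX Z F y U s)) ` U |U s.
      openin TX U \<and> s \<in> sections (subtopology TX Z) F (U \<inter> Z)}"
  then obtain V t where B: "B = (\<lambda>y. (y, germ TX Z F y V t)) ` V"
    and t: "local_section TX Z F V t" by (auto simp: local_section_def)
  show "openin X (f -` B \<inter> topspace X)"
  proof (subst openin_subopen, intro ballI)
    fix a assume "a \<in> f -` B \<inter> topspace X"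
    then have a: "a \<in> topspace X" "fst (f a) \<in> V" "f a = (fst (f a), germ TX Z F (fst (f a)) V t)"
      unfolding B by auto
    obtain T where T: "openin X T" "a \<in> T" "\<forall>b\<in>T. f b \<in> B"
      using nb[OF a(1) t a(2,3)] unfolding B by blast
    then have "T \<subseteq> f -` B \<inter> topspace X" using openin_subset[OF T(1)] by blast
    then show "\<exists>T. openin X T \<and> a \<in> T \<and> T \<subseteq> f -` B \<inter> topspace X" using T by blast
  qed
qed

text \<open>If \<open>s\<close> and \<open>t\<close> have the same germ at \<open>y\<close>, they
  agree on an open set around \<open>y\<close> and so have the same germ at each of its
  points.\<close>

lemma continuous_germ:
  assumes s: "local_section TX Z F U s"
  shows "continuous_map (subtopology TX U) (germ_topology TX Z F) (\<lambda>y. (y, germ TX Z F y U s))"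
proof (rule continuous_map_into_germs)
  fix y V t assume "y \<in> topspace (subtopology TX U)" and t: "local_section TX Z F V t"
    and y: "fst (y, germ TX Z F y U s) \<in> V"
      "(y, germ TX Z F y U s) = (fst (y, germ TX Z F y U s), germ TX Z F (fst (y, germ TX Z F y U s)) V t)"
  then have yU: "y \<in> U" and eq: "germ TX Z F y U s = germ TX Z F y V t" by auto
  obtain W where W: "openin TX W" "y \<in> W" "W \<subseteq> U \<inter> V" "\<And>z. z \<in> W \<inter> Z \<Longrightarrow> s z = t z"
    using germ_eqD[OF s yU eq] by metis
  have "(z, germ TX Z F z U s) \<in> (\<lambda>y. (y, germ TX Z F y V t)) ` V" if "z \<in> W" for z
    using germ_eqI[OF W(1) that W(3,4), where F = F] W(3) that by auto
  moreover have "openin (subtopology TX U) W" using W(1,3) by (auto intro: subset_openin_subtopology)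
  ultimately show "\<exists>T. openin (subtopology TX U) T \<and> y \<in> T \<and>
      (\<forall>b\<in>T. (b, germ TX Z F b U s) \<in> (\<lambda>y. (y, germ TX Z F y V t)) ` V)"
    using W(2) by blast
qed (use germ_in_topspace[OF s] in auto)

lemma continuous_fst_germ: "continuous_map (germ_topology TX Z F) TX fst"
proof (rule continuous_map_nbhdI)
  fix a assume "a \<in> topspace (germ_topology TX Z F)"
  then obtain U s where a: "a = (fst a, germ TX Z F (fst a) U s)" "local_section TX Z F U s" "fst a \<in> U"
    by (rule germ_topology_cases)
  then show "fst a \<in> topspace TX" using local_section_subset by blast
  fix V assume V: "openin TX V" "fst a \<in> V"
  have "openin TX (U \<inter> V)" using a(2) V by (auto simp: local_section_def)
  then show "\<exists>W. openin (germ_topology TX Z F) W \<and> a \<in> W \<and> (\<forall>b\<in>W. fst b \<in> V)"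
    using germ_image_open[OF a(2), of "U \<inter> V"] a V
    by (intro exI[of _ "(\<lambda>y. (y, germ TX Z F y U s)) ` (U \<inter> V)"]) (auto intro: rev_image_eqI)
qed

lemma local_homeo_fst_germ: "local_homeo (germ_topology TX Z F) TX fst"
proof (rule local_homeo_if_local_sections[OF continuous_fst_germ])
  fix a assume "a \<in> topspace (germ_topology TX Z F)"
  then obtain U s where a: "a = (fst a, germ TX Z F (fst a) U s)" "local_section TX Z F U s" "fst a \<in> U"
    by (rule germ_topology_cases)
  show "\<exists>V s. openin TX V \<and> a \<in> s ` V \<and> openin (germ_topology TX Z F) (s ` V) \<and>
      continuous_map (subtopology TX V) (germ_topology TX Z F) s \<and> (\<forall>z\<in>V. fst (s z) = z)"
    using a germ_image_open[OF a(2) _ order_refl] continuous_germ[OF a(2)]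
    by (intro exI[of _ U] exI[of _ "\<lambda>y. (y, germ TX Z F y U s)"])
      (auto simp: local_section_def intro: rev_image_eqI)
qed

text \<open>The images of the germ sections are open and cover the space, and \<open>fst\<close>
  inverts each section on its image. Continuity may therefore be tested after composing with the
  sections.\<close>

lemma continuous_map_from_germs:
  assumes "\<And>U s. local_section TX Z F U s \<Longrightarrow>
    continuous_map (subtopology TX U) Y (\<lambda>y. f (y, germ TX Z F y U s))"
  shows "continuous_map (germ_topology TX Z F) Y f"
proof (rule continuous_map_localI)
  fix a assume "a \<in> topspace (germ_topology TX Z F)"
  then obtain U s where a: "a = (fst a, germ TX Z F (fst a) U s)" "local_section TX Z F U s" "fst a \<in> U"
    by (rule germ_topology_cases)
  let ?B = "(\<lambda>y. (y, germ TX Z F y U s)) ` U"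
  have "continuous_map (subtopology (germ_topology TX Z F) ?B) (subtopology TX U) fst"
    using continuous_map_from_subtopology[OF continuous_fst_germ]
    by (auto simp: continuous_map_in_subtopology)
  from continuous_map_compose[OF this assms[OF a(2)]]
  have "continuous_map (subtopology (germ_topology TX Z F) ?B) Y f"
    by (rule continuous_map_eq) auto
  moreover have "openin (germ_topology TX Z F) ?B"
    using germ_image_open[OF a(2) _ order_refl] a(2) by (auto simp: local_section_def)
  moreover have "a \<in> ?B" using a(1,3) by (rule image_eqI)
  ultimately show "\<exists>W. openin (germ_topology TX Z F) W \<and> a \<in> W \<and>
      continuous_map (subtopology (germ_topology TX Z F) W) Y f" by blast
qed

lemma germ_common_open:
  assumes "local_section TX Z F U s" "y \<in> U" "openin TX V" "y \<in> V"
  obtains s' where "local_section TX Z F (U \<inter> V) s'" "y \<in> U \<inter> V"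
    "germ TX Z F y U s = germ TX Z F y (U \<inter> V) s'"
proof -
  have o: "openin TX (U \<inter> V)" using assms by (auto simp: local_section_def)
  show thesis
    by (rule that[OF local_section_restrict[OF assms(1) o]])
      (use assms germ_restrict[OF o, of U y Z F s] in auto)
qed

text \<open>Removing the closed set \<open>Z\<close> leaves a neighbourhood of \<open>y\<close>
  whose trace on \<open>Z\<close> is empty, where any two sections agree vacuously. This is the
  vanishing of the stalks off \<open>Z\<close>.\<close>

lemma germ_outside:
  assumes "closedin TX Z" "y \<notin> Z" "local_section TX Z F U s" "local_section TX Z F V t" "y \<in> U" "y \<in> V"
  shows "germ TX Z F y U s = germ TX Z F y V t"
proof (rule germ_eqI[of _ "U \<inter> V - Z"])
  show "openin TX (U \<inter> V - Z)" using assms by (auto simp: local_section_def intro!: openin_diff)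
qed (use assms in auto)

section \<open>Constructions that are independent of the representative\<close>

text \<open>Operations on germs are defined as unions over all representatives. Such a union
  collapses to its value at a single representative once that value depends only on the germ; it is
  not empty because \<open>(U, s)\<close> belongs to its own germ.\<close>

lemma UN_germ_const:
  assumes s: "local_section TX Z F U s" "y \<in> U"
    and eq: "\<And>V t W. \<lbrakk>local_section TX Z F V t; y \<in> V; openin TX W; y \<in> W; W \<subseteq> U \<inter> V;
      \<And>z. z \<in> W \<inter> Z \<Longrightarrow> s z = t z\<rbrakk> \<Longrightarrow> h V t = h U s"
  shows "(\<Union>(V, t)\<in>germ TX Z F y U s. h V t) = h U s"
proof -
  have const: "h V t = h U s" if m: "(V, t) \<in> germ TX Z F y U s" for V t
  proof -
    note d = germ_memD[OF m]
    obtain W where "openin TX W" "y \<in> W" "W \<subseteq> U \<inter> V" "\<And>z. z \<in> W \<inter> Z \<Longrightarrow> s z = t z"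
      using germ_eqD[OF s d(3)[symmetric]] by metis
    then show ?thesis using eq[OF d(1,2)] by metis
  qed
  show ?thesis
  proof (rule SUP_eq_const)
    show "germ TX Z F y U s \<noteq> {}" using germ_mem[OF s] by blast
    fix q assume "q \<in> germ TX Z F y U s"
    then show "(case q of (V, t) \<Rightarrow> h V t) = h U s" by (cases q) (simp only: prod.case const)
  qed
qed

lemma UN_germ_map:
  assumes "local_section TX Z F U s" "y \<in> U"
  shows "(\<Union>(V, t)\<in>germ TX Z F y U s. germ TX Z F' y V (\<lambda>z\<in>V \<inter> Z. p (t z))) =
    germ TX Z F' y U (\<lambda>z\<in>U \<inter> Z. p (s z))"
proof (rule UN_germ_const[OF assms])
  fix V t W assume W: "openin TX W" "y \<in> W" "W \<subseteq> U \<inter> V" "\<And>z. z \<in> W \<inter> Z \<Longrightarrow> s z = t z"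
  show "germ TX Z F' y V (\<lambda>z\<in>V \<inter> Z. p (t z)) = germ TX Z F' y U (\<lambda>z\<in>U \<inter> Z. p (s z))"
    by (rule germ_eqI[OF W(1,2)]) (use W in auto)
qed

lemma extension_by_zero_map_germ:
  assumes "local_section TX Z F U s" "y \<in> U"
  shows "extension_by_zero_map TX Z F F' p (y, germ TX Z F y U s) =
    (y, germ TX Z F' y U (\<lambda>z\<in>U \<inter> Z. p (s z)))"
  using UN_germ_map[OF assms, where F' = F' and p = p] germ_in_topspace[OF assms]
  by (simp add: extension_by_zero_map_def)

lemma extension_simps [simp]:
  "total (extension_by_zero G TX \<phi> Z F) = germ_topology TX Z F"
  "proj (extension_by_zero G TX \<phi> Z F) = fst"
  by (simp_all add: extension_by_zero_def)

section \<open>Extension by zero\<close>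

text \<open>\<open>ring R\<close> is a separate assumption because for empty \<open>Z\<close> there
  is no stalk of \<open>F\<close> to read it off from, while the extension has stalks over all of
  \<open>X\<close>.\<close>

locale closed_gsheaf =
  gsheaf_on G TG R "subtopology TX Z" \<phi> F
  for G :: "('g, 'b) monoid_scheme" (structure) and TG :: "'g topology" and R :: "('r, 'c) ring_scheme"
    and TX :: "'x topology" and \<phi> :: "'g \<Rightarrow> 'x \<Rightarrow> 'x" and Z :: "'x set"
    and F :: "('x, 'f, 'r, 'g) gsheaf" +
  assumes ring: "ring R"
    and topspace_group: "topspace TG = carrier G"
    and G_space_base: "G_space G TG TX \<phi>"
    and closed: "closedin TX Z"
    and invariant: "\<lbrakk>g \<in> carrier G; z \<in> Z\<rbrakk> \<Longrightarrow> \<phi> g z \<in> Z"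
begin

abbreviation lsec :: "'x set \<Rightarrow> ('x \<Rightarrow> 'f) \<Rightarrow> bool" where
  "lsec \<equiv> local_section TX Z F"

abbreviation gm :: "'x \<Rightarrow> 'x set \<Rightarrow> ('x \<Rightarrow> 'f) \<Rightarrow> ('x set \<times> ('x \<Rightarrow> 'f)) set" where
  "gm \<equiv> germ TX Z F"

abbreviation ext :: "('x, 'x \<times> ('x set \<times> ('x \<Rightarrow> 'f)) set, 'r, 'g) gsheaf" where
  "ext \<equiv> extension_by_zero G TX \<phi> Z F"

lemma action_base: "group_action G (topspace TX) \<phi>"
  using G_space_base by (simp add: G_space_def)

lemma is_group: "group G"
  using action_base by (rule group_action_group)

lemma open_trace: "openin TX U \<Longrightarrow> U \<inter> Z \<subseteq> topspace (subtopology TX Z)"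
  using openin_subset by fastforce

lemma lsec_stalk:
  assumes "lsec U s" "z \<in> U" "z \<in> Z"
  shows "s z \<in> carrier (stalk F z)" "s z \<in> topspace (total F)" "proj F (s z) = z"
  using sections_stalk[of s "U \<inter> Z" z] open_trace[of U] assms by (auto simp: local_section_def)

lemma stalk_Z:
  assumes "openin TX U" "z \<in> U" "z \<in> Z"
  shows "abelian_group (stalk F z)" "left_module R (stalk F z)"
  using abelian_group_stalk left_module_stalk open_trace[OF assms(1)] assms(2,3) by blast+

lemma lsec_add: "\<lbrakk>lsec U s; lsec U t\<rbrakk> \<Longrightarrow> lsec U (\<lambda>z\<in>U \<inter> Z. fadd F (s z) (t z))"
  and lsec_zero: "openin TX U \<Longrightarrow> lsec U (\<lambda>z\<in>U \<inter> Z. fzero F z)"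
  and lsec_uminus: "lsec U s \<Longrightarrow> lsec U (\<lambda>z\<in>U \<inter> Z. \<ominus>\<^bsub>stalk F z\<^esub> s z)"
  and lsec_smult: "\<lbrakk>lsec U s; r \<in> carrier R\<rbrakk> \<Longrightarrow> lsec U (\<lambda>z\<in>U \<inter> Z. fsmult F r (s z))"
  using sections_add sections_zero sections_uminus sections_smult open_trace
  by (simp_all add: local_section_def)

section \<open>The operations of the extension in terms of representatives\<close>

text \<open>The double union is collapsed one variable at a time: the outer union is constant
  because the inner unions agree term by term, and the remaining one is of the same kind.\<close>

lemma fadd_germ:
  assumes s: "lsec U s" and t: "lsec V t" and y: "y \<in> U" "y \<in> V"
  shows "fadd ext (y, gm y U s) (y, gm y V t) = (y, gm y (U \<inter> V) (\<lambda>z\<in>U \<inter> V \<inter> Z. fadd F (s z) (t z)))"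
proof -
  have "(\<Union>(U', s')\<in>gm y U s. \<Union>(V', t')\<in>gm y V t.
      gm y (U' \<inter> V') (\<lambda>z\<in>U' \<inter> V' \<inter> Z. fadd F (s' z) (t' z))) =
    (\<Union>(V', t')\<in>gm y V t. gm y (U \<inter> V') (\<lambda>z\<in>U \<inter> V' \<inter> Z. fadd F (s z) (t' z)))"
  proof (rule UN_germ_const[OF s y(1)])
    fix U' s' W assume s': "openin TX W" "y \<in> W" "W \<subseteq> U \<inter> U'" "\<And>z. z \<in> W \<inter> Z \<Longrightarrow> s z = s' z"
    have eq: "gm y (U' \<inter> V') (\<lambda>z\<in>U' \<inter> V' \<inter> Z. fadd F (s' z) (t' z)) =
        gm y (U \<inter> V') (\<lambda>z\<in>U \<inter> V' \<inter> Z. fadd F (s z) (t' z))"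
      if "(V', t') \<in> gm y V t" for V' t'
    proof (rule germ_eqI[of _ "W \<inter> V'"])
      show "openin TX (W \<inter> V')" "y \<in> W \<inter> V'"
        using s' germ_memD[OF that] by (auto simp: local_section_def)
    qed (use s' in auto)
    show "(\<Union>(V', t')\<in>gm y V t. gm y (U' \<inter> V') (\<lambda>z\<in>U' \<inter> V' \<inter> Z. fadd F (s' z) (t' z))) =
      (\<Union>(V', t')\<in>gm y V t. gm y (U \<inter> V') (\<lambda>z\<in>U \<inter> V' \<inter> Z. fadd F (s z) (t' z)))"
      by (rule SUP_cong[OF refl]) (use eq in auto)
  qed
  also have "\<dots> = gm y (U \<inter> V) (\<lambda>z\<in>U \<inter> V \<inter> Z. fadd F (s z) (t z))"
  proof (rule UN_germ_const[OF t y(2)])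
    fix V' t' W assume t': "openin TX W" "y \<in> W" "W \<subseteq> V \<inter> V'" "\<And>z. z \<in> W \<inter> Z \<Longrightarrow> t z = t' z"
    show "gm y (U \<inter> V') (\<lambda>z\<in>U \<inter> V' \<inter> Z. fadd F (s z) (t' z)) =
        gm y (U \<inter> V) (\<lambda>z\<in>U \<inter> V \<inter> Z. fadd F (s z) (t z))"
      by (rule germ_eqI[of _ "W \<inter> U"]) (use s t' y in \<open>auto simp: local_section_def\<close>)
  qed
  finally show ?thesis by (simp add: extension_by_zero_def)
qed

lemma fadd_germ_same:
  assumes "lsec U s" "lsec U t" "y \<in> U"
  shows "fadd ext (y, gm y U s) (y, gm y U t) = (y, gm y U (\<lambda>z\<in>U \<inter> Z. fadd F (s z) (t z)))"
  using fadd_germ[OF assms(1,2,3,3)] by simp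

lemma fsmult_germ:
  assumes "lsec U s" "y \<in> U"
  shows "fsmult ext r (y, gm y U s) = (y, gm y U (\<lambda>z\<in>U \<inter> Z. fsmult F r (s z)))"
  using UN_germ_map[OF assms, where F' = F and p = "fsmult F r"] by (simp add: extension_by_zero_def)

lemma fzero_germ:
  assumes "openin TX U" "y \<in> U"
  shows "fzero ext y = (y, gm y U (\<lambda>z\<in>U \<inter> Z. fzero F z))"
proof -
  have "gm y (topspace TX) (\<lambda>z\<in>topspace TX \<inter> Z. fzero F z) = gm y U (\<lambda>z\<in>U \<inter> Z. fzero F z)"
    by (rule germ_eqI[OF assms]) (use openin_subset[OF assms(1)] in auto)
  then show ?thesis by (simp add: extension_by_zero_def)
qed

abbreviation actsec :: "'g \<Rightarrow> 'x set \<Rightarrow> ('x \<Rightarrow> 'f) \<Rightarrow> 'x \<Rightarrow> 'f" where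
  "actsec g U s \<equiv> \<lambda>z\<in>\<phi> g ` U \<inter> Z. eact F g (s (\<phi> (inv g) z))"

lemma inv_image_mem:
  assumes "g \<in> carrier G" "U \<subseteq> topspace TX" "z \<in> \<phi> g ` U"
  shows "\<phi> (inv g) z \<in> U" "\<phi> g (\<phi> (inv g) z) = z" "z \<in> Z \<Longrightarrow> \<phi> (inv g) z \<in> Z"
proof -
  obtain u where u: "u \<in> U" "z = \<phi> g u" using assms(3) by blast
  have e: "\<phi> (inv g) z = u" using group_action_inv(1)[OF action_base assms(1)] u assms(2) by auto
  show "\<phi> (inv g) z \<in> U" "\<phi> g (\<phi> (inv g) z) = z" using e u by auto
  show "\<phi> (inv g) z \<in> Z" if "z \<in> Z"
    using invariant[of "inv g"] that group.inv_closed[OF is_group assms(1)] by blast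
qed

lemma lsec_act:
  assumes g: "g \<in> carrier G" and s: "lsec U s"
  shows "lsec (\<phi> g ` U) (actsec g U s)"
  unfolding local_section_def
proof
  have U: "U \<subseteq> topspace TX" "openin TX U" using s local_section_subset[OF s] by (simp_all add: local_section_def)
  show "openin TX (\<phi> g ` U)"
    using G_space_image_open[OF G_space_base topspace_group g U(2)] .
  have gi: "inv g \<in> carrier G" using group.inv_closed[OF is_group g] .
  show "actsec g U s \<in> sections (subtopology TX Z) F (\<phi> g ` U \<inter> Z)"
  proof (rule sectionsI)
    have c: "continuous_map (subtopology (subtopology TX Z) (\<phi> g ` U \<inter> Z))
        (subtopology (subtopology TX Z) (U \<inter> Z)) (\<phi> (inv g))"
      unfolding subtopology_subtopology continuous_map_in_subtopology
      using inv_image_mem[OF g U(1)] G_space_continuous[OF G_space_base topspace_group gi]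
      by (auto simp: continuous_map_from_subtopology)
    have cs: "continuous_map (subtopology (subtopology TX Z) (U \<inter> Z)) (total F) s"
      using s by (simp add: local_section_def sections_def)
    show "continuous_map (subtopology (subtopology TX Z) (\<phi> g ` U \<inter> Z)) (total F)
        (\<lambda>z. eact F g (s (\<phi> (inv g) z)))"
      using continuous_map_compose[OF continuous_map_compose[OF c cs]
        G_space_continuous[OF G_space_total topspace_group g]]
      by (simp add: comp_def)
    fix z assume z: "z \<in> \<phi> g ` U \<inter> Z"
    note m = inv_image_mem[OF g U(1), of z]
    show "proj F (eact F g (s (\<phi> (inv g) z))) = z"
      using proj_eact[OF g lsec_stalk(2)[OF s]] lsec_stalk(3)[OF s] m z by auto
  qed
qed

lemma eact_germ:
  assumes g: "g \<in> carrier G" and s: "lsec U s" and y: "y \<in> U"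
  shows "eact ext g (y, gm y U s) = (\<phi> g y, gm (\<phi> g y) (\<phi> g ` U) (actsec g U s))"
proof -
  have "(\<Union>(V, t)\<in>gm y U s. gm (\<phi> g y) (\<phi> g ` V) (actsec g V t)) =
    gm (\<phi> g y) (\<phi> g ` U) (actsec g U s)"
  proof (rule UN_germ_const[OF s y])
    fix V t W assume W: "openin TX W" "y \<in> W" "W \<subseteq> U \<inter> V" "\<And>z. z \<in> W \<inter> Z \<Longrightarrow> s z = t z"
    have WX: "W \<subseteq> topspace TX" using W(1) openin_subset by blast
    show "gm (\<phi> g y) (\<phi> g ` V) (actsec g V t) = gm (\<phi> g y) (\<phi> g ` U) (actsec g U s)"
    proof (rule germ_eqI[OF G_space_image_open[OF G_space_base topspace_group g W(1)]])
      fix z assume z: "z \<in> \<phi> g ` W \<inter> Z"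
      have "s (\<phi> (inv g) z) = t (\<phi> (inv g) z)"
        using inv_image_mem[OF g WX, of z] z W(4) by blast
      moreover have "z \<in> \<phi> g ` V" "z \<in> \<phi> g ` U" using z W(3) by auto
      ultimately show "actsec g V t z = actsec g U s z" using z by simp
    qed (use W in auto)
  qed
  then show ?thesis using germ_in_topspace[OF s y] by (simp add: extension_by_zero_def)
qed

lemma ext_cases:
  assumes "a \<in> topspace (total ext)"
  obtains U s where "a = (fst a, gm (fst a) U s)" "lsec U s" "fst a \<in> U"
  using assms unfolding extension_simps by (rule germ_topology_cases)

text \<open>Finitely many germs at one point have representatives on a common domain, which reduces
  identities between germs to identities between sections. Associativity calls for three.\<close>

lemma ext_cases_common3:
  assumes "a \<in> topspace (total ext)" "b \<in> topspace (total ext)" "c \<in> topspace (total ext)"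
    "fst b = fst a" "fst c = fst a"
  obtains U s t u where "a = (fst a, gm (fst a) U s)" "b = (fst a, gm (fst a) U t)"
    "c = (fst a, gm (fst a) U u)" "lsec U s" "lsec U t" "lsec U u" "fst a \<in> U"
proof -
  obtain U s where a: "a = (fst a, gm (fst a) U s)" "lsec U s" "fst a \<in> U"
    using ext_cases[OF assms(1)] .
  obtain V t where b: "b = (fst a, gm (fst a) V t)" "lsec V t" "fst a \<in> V"
    using ext_cases[OF assms(2)] assms(4) by metis
  obtain W u where c: "c = (fst a, gm (fst a) W u)" "lsec W u" "fst a \<in> W"
    using ext_cases[OF assms(3)] assms(5) by metis
  have o: "openin TX U" "openin TX V" "openin TX W" using a b c by (auto simp: local_section_def)
  define D where "D = U \<inter> V \<inter> W"
  have D: "openin TX D" "fst a \<in> D" "D \<subseteq> U" "D \<subseteq> V" "D \<subseteq> W"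
    using o a(3) b(3) c(3) by (auto simp: D_def)
  note r = germ_restrict[OF D(1) _ D(2), where F = F and Z = Z]
  show thesis
  proof (rule that)
    show "a = (fst a, gm (fst a) D (restrict s (D \<inter> Z)))" unfolding r[OF D(3)] by (rule a(1))
    show "b = (fst a, gm (fst a) D (restrict t (D \<inter> Z)))" unfolding r[OF D(4)] by (rule b(1))
    show "c = (fst a, gm (fst a) D (restrict u (D \<inter> Z)))" unfolding r[OF D(5)] by (rule c(1))
  qed (use a(2) b(2) c(2) D local_section_restrict[OF _ D(1)] in blast)+
qed

lemma ext_cases_common:
  assumes "a \<in> topspace (total ext)" "b \<in> topspace (total ext)" "fst b = fst a"
  obtains U s t where "a = (fst a, gm (fst a) U s)" "b = (fst a, gm (fst a) U t)"
    "lsec U s" "lsec U t" "fst a \<in> U"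
  using ext_cases_common3[OF assms(1,2,2,3,3)] by metis

section \<open>Stalks of the extension as modules\<close>

text \<open>On a common domain the operations are pointwise, so every axiom is inherited from the
  stalks of \<open>F\<close> over the points of \<open>U \<inter> Z\<close>.\<close>

lemma left_module_ext:
  assumes y: "y \<in> topspace TX"
  shows "left_module R (stalk ext y)"
proof -
  have mem: "(y, gm y U s) \<in> carrier (stalk ext y)" if "lsec U s" "y \<in> U" for U s
    using germ_in_topspace[OF that] by simp
  have ab: "abelian_group (stalk ext y)"
  proof (rule abelian_groupI)
    fix a b assume "a \<in> carrier (stalk ext y)" "b \<in> carrier (stalk ext y)"
    then have m: "a \<in> topspace (total ext)" "b \<in> topspace (total ext)" "fst b = fst a" "fst a = y"
      by auto
    obtain U s t where ab: "a = (y, gm y U s)" "b = (y, gm y U t)" and l: "lsec U s" "lsec U t" "y \<in> U"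
      using ext_cases_common[OF m(1-3)] m(4) by metis
    have o: "openin TX U" using l by (simp add: local_section_def)
    show "a \<oplus>\<^bsub>stalk ext y\<^esub> b \<in> carrier (stalk ext y)"
      using fadd_germ_same[OF l] mem[OF lsec_add[OF l(1,2)] l(3)] ab by simp
    have "(\<lambda>z\<in>U \<inter> Z. fadd F (s z) (t z)) = (\<lambda>z\<in>U \<inter> Z. fadd F (t z) (s z))"
    proof (rule restrict_ext)
      fix z assume z: "z \<in> U \<inter> Z"
      then interpret abelian_group "stalk F z" using stalk_Z[OF o] by blast
      show "fadd F (s z) (t z) = fadd F (t z) (s z)"
        using a_comm[OF lsec_stalk(1)[OF l(1)] lsec_stalk(1)[OF l(2)]] z by simp
    qed
    then show "a \<oplus>\<^bsub>stalk ext y\<^esub> b = b \<oplus>\<^bsub>stalk ext y\<^esub> a"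
      using fadd_germ_same[OF l] fadd_germ_same[OF l(2,1,3)] ab by simp
  next
    show "\<zero>\<^bsub>stalk ext y\<^esub> \<in> carrier (stalk ext y)"
      using fzero_germ[OF openin_topspace y] mem[OF lsec_zero[OF openin_topspace] y] by simp
  next
    fix a b c
    assume "a \<in> carrier (stalk ext y)" "b \<in> carrier (stalk ext y)" "c \<in> carrier (stalk ext y)"
    then have m: "a \<in> topspace (total ext)" "b \<in> topspace (total ext)" "c \<in> topspace (total ext)"
      "fst b = fst a" "fst c = fst a" "fst a = y"
      by auto
    obtain U s t u where abc: "a = (y, gm y U s)" "b = (y, gm y U t)" "c = (y, gm y U u)"
      and l: "lsec U s" "lsec U t" "lsec U u" "y \<in> U"
      using ext_cases_common3[OF m(1-5)] m(6) by metis
    have o: "openin TX U" using l by (simp add: local_section_def)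
    have "(\<lambda>z\<in>U \<inter> Z. fadd F ((\<lambda>z\<in>U \<inter> Z. fadd F (s z) (t z)) z) (u z)) =
        (\<lambda>z\<in>U \<inter> Z. fadd F (s z) ((\<lambda>z\<in>U \<inter> Z. fadd F (t z) (u z)) z))"
    proof (rule restrict_ext)
      fix z assume z: "z \<in> U \<inter> Z"
      then interpret abelian_group "stalk F z" using stalk_Z[OF o] by blast
      show "fadd F ((\<lambda>z\<in>U \<inter> Z. fadd F (s z) (t z)) z) (u z) =
          fadd F (s z) ((\<lambda>z\<in>U \<inter> Z. fadd F (t z) (u z)) z)"
        using a_assoc[OF lsec_stalk(1)[OF l(1)] lsec_stalk(1)[OF l(2)] lsec_stalk(1)[OF l(3)]] z
        by simp
    qed
    then show "(a \<oplus>\<^bsub>stalk ext y\<^esub> b) \<oplus>\<^bsub>stalk ext y\<^esub> c = a \<oplus>\<^bsub>stalk ext y\<^esub> (b \<oplus>\<^bsub>stalk ext y\<^esub> c)"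
      using fadd_germ_same[OF l(1,2,4)] fadd_germ_same[OF l(2,3,4)]
        fadd_germ_same[OF lsec_add[OF l(1,2)] l(3,4)] fadd_germ_same[OF l(1) lsec_add[OF l(2,3)] l(4)] abc
      by simp
  next
    fix a assume "a \<in> carrier (stalk ext y)"
    then have m: "a \<in> topspace (total ext)" "fst a = y" by auto
    obtain U s where a: "a = (y, gm y U s)" and l: "lsec U s" "y \<in> U"
      using ext_cases[OF m(1)] m(2) by metis
    have o: "openin TX U" using l by (simp add: local_section_def)
    have "(\<lambda>z\<in>U \<inter> Z. fadd F ((\<lambda>z\<in>U \<inter> Z. fzero F z) z) (s z)) = (\<lambda>z\<in>U \<inter> Z. s z)"
    proof (rule restrict_ext)
      fix z assume z: "z \<in> U \<inter> Z"
      then interpret abelian_group "stalk F z" using stalk_Z[OF o] by blast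
      show "fadd F ((\<lambda>z\<in>U \<inter> Z. fzero F z) z) (s z) = s z"
        using l_zero[OF lsec_stalk(1)[OF l(1)]] z by simp
    qed
    also have "\<dots> = s"
      using l(1) sectionsD(1) by (metis extensional_restrict local_section_def)
    finally show "\<zero>\<^bsub>stalk ext y\<^esub> \<oplus>\<^bsub>stalk ext y\<^esub> a = a"
      using fadd_germ_same[OF lsec_zero[OF o] l] fzero_germ[OF o l(2)] a by simp
    have "(\<lambda>z\<in>U \<inter> Z. fadd F ((\<lambda>z\<in>U \<inter> Z. \<ominus>\<^bsub>stalk F z\<^esub> s z) z) (s z)) = (\<lambda>z\<in>U \<inter> Z. fzero F z)"
    proof (rule restrict_ext)
      fix z assume z: "z \<in> U \<inter> Z"
      then interpret abelian_group "stalk F z" using stalk_Z[OF o] by blast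
      show "fadd F ((\<lambda>z\<in>U \<inter> Z. \<ominus>\<^bsub>stalk F z\<^esub> s z) z) (s z) = fzero F z"
        using l_neg[OF lsec_stalk(1)[OF l(1)]] z by simp
    qed
    then show "\<exists>b\<in>carrier (stalk ext y). b \<oplus>\<^bsub>stalk ext y\<^esub> a = \<zero>\<^bsub>stalk ext y\<^esub>"
      using fadd_germ_same[OF lsec_uminus[OF l(1)] l] fzero_germ[OF o l(2)] a
      by (intro bexI[OF _ mem[OF lsec_uminus[OF l(1)] l(2)]]) simp
  qed
  \<comment> \<open>The laws for scalars are stated together so that common representatives of
    \<open>a\<close> and \<open>b\<close> are chosen once.\<close>
  have "r \<odot>\<^bsub>stalk ext y\<^esub> a \<in> carrier (stalk ext y) \<and>
      (r \<oplus>\<^bsub>R\<^esub> q) \<odot>\<^bsub>stalk ext y\<^esub> a = (r \<odot>\<^bsub>stalk ext y\<^esub> a) \<oplus>\<^bsub>stalk ext y\<^esub> (q \<odot>\<^bsub>stalk ext y\<^esub> a) \<and>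
      r \<odot>\<^bsub>stalk ext y\<^esub> (a \<oplus>\<^bsub>stalk ext y\<^esub> b) = (r \<odot>\<^bsub>stalk ext y\<^esub> a) \<oplus>\<^bsub>stalk ext y\<^esub> (r \<odot>\<^bsub>stalk ext y\<^esub> b) \<and>
      (r \<otimes>\<^bsub>R\<^esub> q) \<odot>\<^bsub>stalk ext y\<^esub> a = r \<odot>\<^bsub>stalk ext y\<^esub> (q \<odot>\<^bsub>stalk ext y\<^esub> a) \<and>
      \<one>\<^bsub>R\<^esub> \<odot>\<^bsub>stalk ext y\<^esub> a = a"
    if r: "r \<in> carrier R" and q: "q \<in> carrier R"
      and "a \<in> carrier (stalk ext y)" "b \<in> carrier (stalk ext y)" for r q a b
  proof -
    interpret R: ring R by (rule ring)
    have m: "a \<in> topspace (total ext)" "b \<in> topspace (total ext)" "fst b = fst a" "fst a = y"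
      using that by auto
    obtain U s t where ab: "a = (y, gm y U s)" "b = (y, gm y U t)" and l: "lsec U s" "lsec U t" "y \<in> U"
      using ext_cases_common[OF m(1-3)] m(4) by metis
    have o: "openin TX U" using l by (simp add: local_section_def)
    note M = left_moduleD[OF stalk_Z(2)[OF o]]
    note st = lsec_stalk(1)[OF l(1)] lsec_stalk(1)[OF l(2)]
    have "(\<lambda>z\<in>U \<inter> Z. fsmult F (r \<oplus>\<^bsub>R\<^esub> q) (s z)) =
        (\<lambda>z\<in>U \<inter> Z. fadd F ((\<lambda>z\<in>U \<inter> Z. fsmult F r (s z)) z) ((\<lambda>z\<in>U \<inter> Z. fsmult F q (s z)) z))"
      by (rule restrict_ext) (use M(3)[OF _ _ r q st(1)] in auto)
    moreover have "(\<lambda>z\<in>U \<inter> Z. fsmult F r ((\<lambda>z\<in>U \<inter> Z. fadd F (s z) (t z)) z)) =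
        (\<lambda>z\<in>U \<inter> Z. fadd F ((\<lambda>z\<in>U \<inter> Z. fsmult F r (s z)) z) ((\<lambda>z\<in>U \<inter> Z. fsmult F r (t z)) z))"
      by (rule restrict_ext) (use M(4)[OF _ _ r st] in auto)
    moreover have "(\<lambda>z\<in>U \<inter> Z. fsmult F (r \<otimes>\<^bsub>R\<^esub> q) (s z)) =
        (\<lambda>z\<in>U \<inter> Z. fsmult F r ((\<lambda>z\<in>U \<inter> Z. fsmult F q (s z)) z))"
      by (rule restrict_ext) (use M(5)[OF _ _ r q st(1)] in auto)
    moreover have "(\<lambda>z\<in>U \<inter> Z. fsmult F \<one>\<^bsub>R\<^esub> (s z)) = (\<lambda>z\<in>U \<inter> Z. s z)"
      by (rule restrict_ext) (use M(6)[OF _ _ st(1)] in auto)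
    moreover have "(\<lambda>z\<in>U \<inter> Z. s z) = s"
      using l(1) sectionsD(1) by (metis extensional_restrict local_section_def)
    ultimately show ?thesis
      using mem[OF lsec_smult[OF l(1) r] l(3)] ab l r q
      by (simp add: fsmult_germ fadd_germ_same lsec_add lsec_smult)
  qed
  note ops = this
  show ?thesis
    unfolding left_module_def
  proof (intro conjI ballI)
    show "\<one>\<^bsub>R\<^esub> \<odot>\<^bsub>stalk ext y\<^esub> a = a" if "a \<in> carrier (stalk ext y)" for a
      using ops[OF ring.ring_simprules(6)[OF ring] ring.ring_simprules(6)[OF ring] that that] by blast
  qed (use ab ring ops in blast)+
qed

text \<open>Over a point of \<open>Z\<close> this is continuity of the action on the total space of \<open>F\<close>; off \<open>Z\<close> all germs
  agree because \<open>Z\<close> is closed.\<close>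

lemma continuous_eact_ext:
  "continuous_map (prod_topology TG (total ext)) (total ext) (\<lambda>(g, a). eact ext g a)"
proof -
  have img: "eact ext g a \<in> topspace (germ_topology TX Z F)"
    if g: "g \<in> carrier G" and at: "a \<in> topspace (germ_topology TX Z F)" for g a
  proof -
    obtain U s where a: "a = (fst a, gm (fst a) U s)" "lsec U s" "fst a \<in> U"
      using germ_topology_cases[OF at] .
    have "eact ext g a = (\<phi> g (fst a), gm (\<phi> g (fst a)) (\<phi> g ` U) (actsec g U s))"
      using eact_germ[OF g a(2,3)] a(1) by simp
    moreover have "\<dots> \<in> topspace (germ_topology TX Z F)"
      by (rule germ_in_topspace[OF lsec_act[OF g a(2)]]) (use a(3) in auto)
    ultimately show ?thesis by simp
  qed
  let ?P = "prod_topology TG (germ_topology TX Z F)" and ?f = "\<lambda>(g, a). eact ext g a"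
  show ?thesis
    unfolding extension_simps
  proof (rule continuous_map_into_germs)
    show "?f q \<in> topspace (germ_topology TX Z F)" if "q \<in> topspace ?P" for q
      using that img topspace_group by auto
    fix q V t
    assume q: "q \<in> topspace ?P" and t: "lsec V t"
      and fq: "fst (?f q) \<in> V" "?f q = (fst (?f q), gm (fst (?f q)) V t)"
    let ?B = "(\<lambda>y. (y, gm y V t)) ` V"
    obtain g a where ga: "q = (g, a)" by (cases q)
    have g: "g \<in> carrier G" and at: "a \<in> topspace (germ_topology TX Z F)"
      using q ga topspace_group by auto
    obtain y U s where a: "a = (y, gm y U s)" "lsec U s" "y \<in> U"
      using germ_topology_cases[OF at] by metis
    have U: "openin TX U" "U \<subseteq> topspace TX" and V: "openin TX V"
      using a t local_section_subset[OF a(2)] by (simp_all add: local_section_def)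
    have gy: "\<phi> g y \<in> V" and eq: "gm (\<phi> g y) (\<phi> g ` U) (actsec g U s) = gm (\<phi> g y) V t"
      using fq unfolding ga a(1) prod.case eact_germ[OF g a(2,3)] by auto
    \<comment> \<open>It is enough to control translates at points of \<open>Z\<close>: for
      \<open>k\<close> near \<open>g\<close>, the section \<open>s\<close> moved by \<open>k\<close>
      must coincide with \<open>t\<close> over points of \<open>Z\<close> close to
      \<open>y\<close>.\<close>
    obtain N U1 where N: "openin TG N" "g \<in> N" and U1: "openin TX U1" "y \<in> U1"
      and NU: "\<And>k u. \<lbrakk>k \<in> N; u \<in> U1 \<inter> U \<inter> Z\<rbrakk> \<Longrightarrow> eact F k (s u) = t (\<phi> k u)"
    proof (cases "y \<in> Z")
      case True
      obtain W where W: "openin TX W" "\<phi> g y \<in> W" "W \<subseteq> \<phi> g ` U \<inter> V"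
        "\<And>z. z \<in> W \<inter> Z \<Longrightarrow> actsec g U s z = t z"
        using germ_eqD[OF lsec_act[OF g a(2)] _ eq] a(3) by (metis image_eqI)
      have gyZ: "\<phi> g y \<in> Z" using invariant[OF g True] .
      have "eact F g (s y) = t (\<phi> g y)"
        using W(4)[of "\<phi> g y"] W(2) gyZ a(3) U(2) group_action_inv(1)[OF action_base g, of y] by auto
      moreover have op: "openin (total F) (t ` (V \<inter> Z))"
        using section_image_open[of t "V \<inter> Z"] t by (auto simp: local_section_def openin_subtopology)
      ultimately have mem: "eact F g (s y) \<in> t ` (V \<inter> Z)" using gy gyZ by auto
      have c: "continuous_map (prod_topology TG (total F)) (total F) (\<lambda>(g, e). eact F g e)"
        using G_space_total by (simp add: G_space_def)
      \<comment> \<open>Near \<open>(g, s y)\<close> the action stays inside the open image of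
        \<open>t\<close>; which value of \<open>t\<close> is taken is then read off from the
        projection.\<close>
      obtain N S where NS: "openin TG N" "openin (total F) S" "g \<in> N" "s y \<in> S"
        "\<And>k e. \<lbrakk>k \<in> N; e \<in> S\<rbrakk> \<Longrightarrow> eact F k e \<in> t ` (V \<inter> Z)"
        using continuous_map_prod_nbhd[OF c _ lsec_stalk(2)[OF a(2,3) True] op mem] g topspace_group
        by metis
      have "openin (subtopology (subtopology TX Z) (U \<inter> Z))
          {z \<in> topspace (subtopology (subtopology TX Z) (U \<inter> Z)). s z \<in> S}"
        using openin_continuous_map_preimage[OF sectionsD(2) NS(2)] a(2)
        by (simp only: local_section_def)
      then obtain U1 where U1: "openin TX U1"
        "{z \<in> topspace (subtopology (subtopology TX Z) (U \<inter> Z)). s z \<in> S} = U1 \<inter> (U \<inter> Z)"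
        by (auto simp: openin_subtopology subtopology_subtopology inf.absorb2)
      have S: "s u \<in> S" if "u \<in> U1 \<inter> U \<inter> Z" for u using that U1(2) by blast
      show ?thesis
      proof (rule that[OF NS(1,3) U1(1)])
        have "y \<in> {z \<in> topspace (subtopology (subtopology TX Z) (U \<inter> Z)). s z \<in> S}"
          using True a(3) NS(4) U(2) by auto
        then show "y \<in> U1" using U1(2) by blast
        fix k u assume k: "k \<in> N" and u: "u \<in> U1 \<inter> U \<inter> Z"
        have kG: "k \<in> carrier G" using k openin_subset[OF NS(1)] topspace_group by blast
        obtain v where v: "v \<in> V" "v \<in> Z" "eact F k (s u) = t v"
          using NS(5)[OF k S[OF u]] by blast
        have "proj F (eact F k (s u)) = \<phi> k u"
          using proj_eact[OF kG lsec_stalk(2)[OF a(2)]] lsec_stalk(3)[OF a(2)] u by auto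
        then show "eact F k (s u) = t (\<phi> k u)" using v lsec_stalk(3)[OF t v(1,2)] by simp
      qed
    next
      case False
      show ?thesis
      \<comment> \<open>The neighbourhood avoids \<open>Z\<close>, so the required equation is
        vacuous.\<close>
      proof (rule that[of "carrier G" "topspace TX - Z"])
        show "openin TG (carrier G)" using topspace_group by (metis openin_topspace)
        show "openin TX (topspace TX - Z)" using closed by (simp add: closedin_def)
      qed (use g False a(3) U(2) in auto)
    qed
    have c: "continuous_map (prod_topology TG TX) TX (\<lambda>(g, y). \<phi> g y)"
      using G_space_base by (simp add: G_space_def)
    have "g \<in> topspace TG" "y \<in> topspace TX" using g topspace_group a(3) U(2) by auto
    then obtain N' U2 where NU2: "openin TG N'" "openin TX U2" "g \<in> N'" "y \<in> U2"
      "\<And>k w. \<lbrakk>k \<in> N'; w \<in> U2\<rbrakk> \<Longrightarrow> \<phi> k w \<in> V"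
      using continuous_map_prod_nbhd[OF c _ _ V gy] by metis
    \<comment> \<open>The translate of \<open>W\<close> by \<open>k\<close> will witness the
      equality of germs at every \<open>k z\<close> with \<open>z\<close> in \<open>W\<close>
      simultaneously; \<open>U2\<close> keeps it inside \<open>V\<close>.\<close>
    define W where "W = U \<inter> U1 \<inter> U2"
    have W: "openin TX W" "W \<subseteq> U" "y \<in> W" using U U1 NU2 a(3) by (auto simp: W_def)
    have "?f (k, z, gm z U s) \<in> ?B" if k: "k \<in> N \<inter> N'" and z: "z \<in> W" for k z
    proof -
      have kG: "k \<in> carrier G" using k openin_subset[OF N(1)] topspace_group by blast
      have zU: "z \<in> U" using z W(2) by blast
      have kW: "\<phi> k ` W \<subseteq> V"
      proof
        fix v assume "v \<in> \<phi> k ` W"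
        then obtain w where w: "w \<in> W" "v = \<phi> k w" by blast
        show "v \<in> V" using w k NU2(5) by (auto simp: W_def)
      qed
      have "gm (\<phi> k z) (\<phi> k ` U) (actsec k U s) = gm (\<phi> k z) V t"
      proof (rule germ_eqI[OF G_space_image_open[OF G_space_base topspace_group kG W(1)]])
        show "\<phi> k z \<in> \<phi> k ` W" using z by blast
        show "\<phi> k ` W \<subseteq> \<phi> k ` U \<inter> V" using kW W(2) by blast
        fix w assume w: "w \<in> \<phi> k ` W \<inter> Z"
        have "W \<subseteq> topspace TX" using W(2) U(2) by blast
        note m = inv_image_mem[OF kG this, of w]
        have "\<phi> (inv k) w \<in> U1 \<inter> U \<inter> Z" using m w by (auto simp: W_def)
        then have "eact F k (s (\<phi> (inv k) w)) = t w"
          using NU[of k "\<phi> (inv k) w"] k m(2) w by auto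
        moreover have "w \<in> \<phi> k ` U \<inter> Z" using w W(2) by blast
        ultimately show "actsec k U s w = t w" by simp
      qed
      moreover have "\<phi> k z \<in> V" using kW z by blast
      ultimately show ?thesis unfolding prod.case eact_germ[OF kG a(2) zU] by auto
    qed
    then have "\<forall>b\<in>(N \<inter> N') \<times> (\<lambda>z. (z, gm z U s)) ` W. ?f b \<in> ?B" by blast
    moreover have "openin ?P ((N \<inter> N') \<times> (\<lambda>z. (z, gm z U s)) ` W)"
      using N(1) NU2(1) germ_image_open[OF a(2) W(1,2)] by (auto simp: openin_prod_Times_iff)
    moreover have "q \<in> (N \<inter> N') \<times> (\<lambda>z. (z, gm z U s)) ` W"
      using ga a(1) N(2) NU2(3) W(3) by auto
    ultimately show "\<exists>T. openin ?P T \<and> q \<in> T \<and> (\<forall>b\<in>T. ?f b \<in> ?B)" by blast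
  qed
qed

end

lemma gsheaf_homD:
  assumes "f \<in> gsheaf_hom G R TX E F"
  shows "f \<in> extensional (topspace (total E))"
    and "continuous_map (total E) (total F) f"
    and "e \<in> topspace (total E) \<Longrightarrow> proj F (f e) = proj E e"
    and "e \<in> topspace (total E) \<Longrightarrow> f e \<in> topspace (total F)"
    and "\<lbrakk>g \<in> carrier G; e \<in> topspace (total E)\<rbrakk> \<Longrightarrow> f (eact E g e) = eact F g (f e)"
    and "y \<in> topspace TX \<Longrightarrow> f \<in> linear_maps R (stalk E y) (stalk F y)"
  using assms by (auto simp: gsheaf_hom_def continuous_map_def Pi_iff)

context closed_gsheaf
begin

section \<open>The remaining sheaf axioms for the extension\<close>

lemma ext_stalk_mem: "\<lbrakk>lsec U s; y \<in> U\<rbrakk> \<Longrightarrow> (y, gm y U s) \<in> carrier (stalk ext y)"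
  using germ_in_topspace by simp

text \<open>Subtraction in a stalk refers to the abstract negative, which is identified with the
  pointwise one by uniqueness of inverses.\<close>

lemma fminus_germ:
  assumes s: "lsec U s" and t: "lsec U t" and y: "y \<in> U"
  shows "(y, gm y U s) \<ominus>\<^bsub>stalk ext y\<^esub> (y, gm y U t) = (y, gm y U (\<lambda>z\<in>U \<inter> Z. s z \<ominus>\<^bsub>stalk F z\<^esub> t z))"
proof -
  have o: "openin TX U" using s by (simp add: local_section_def)
  have "y \<in> topspace TX" using local_section_subset[OF s] y by blast
  then interpret ext: abelian_group "stalk ext y" using left_module_ext left_moduleD(1) by blast
  have "(\<lambda>z\<in>U \<inter> Z. fadd F ((\<lambda>z\<in>U \<inter> Z. \<ominus>\<^bsub>stalk F z\<^esub> t z) z) (t z)) = (\<lambda>z\<in>U \<inter> Z. fzero F z)"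
  proof (rule restrict_ext)
    fix z assume z: "z \<in> U \<inter> Z"
    then interpret abelian_group "stalk F z" using stalk_Z[OF o] by blast
    show "fadd F ((\<lambda>z\<in>U \<inter> Z. \<ominus>\<^bsub>stalk F z\<^esub> t z) z) (t z) = fzero F z"
      using l_neg[OF lsec_stalk(1)[OF t]] z by simp
  qed
  then have "(y, gm y U (\<lambda>z\<in>U \<inter> Z. \<ominus>\<^bsub>stalk F z\<^esub> t z)) \<oplus>\<^bsub>stalk ext y\<^esub> (y, gm y U t) = \<zero>\<^bsub>stalk ext y\<^esub>"
    using fadd_germ_same[OF lsec_uminus[OF t] t y] fzero_germ[OF o y] by simp
  then have "\<ominus>\<^bsub>stalk ext y\<^esub> (y, gm y U t) = (y, gm y U (\<lambda>z\<in>U \<inter> Z. \<ominus>\<^bsub>stalk F z\<^esub> t z))"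
    by (rule ext.minus_equality[OF _ ext_stalk_mem[OF t y] ext_stalk_mem[OF lsec_uminus[OF t] y]])
  moreover have "(\<lambda>z\<in>U \<inter> Z. fadd F (s z) ((\<lambda>z\<in>U \<inter> Z. \<ominus>\<^bsub>stalk F z\<^esub> t z) z)) =
      (\<lambda>z\<in>U \<inter> Z. s z \<ominus>\<^bsub>stalk F z\<^esub> t z)"
    by (rule restrict_ext) (simp add: a_minus_def)
  ultimately show ?thesis
    using fadd_germ_same[OF s lsec_uminus[OF t] y] by (simp add: a_minus_def)
qed

lemma lsec_minus: "\<lbrakk>lsec U s; lsec U t\<rbrakk> \<Longrightarrow> lsec U (\<lambda>z\<in>U \<inter> Z. s z \<ominus>\<^bsub>stalk F z\<^esub> t z)"
  using sections_minus open_trace by (simp add: local_section_def)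

text \<open>Over the open set of pairs of germs of fixed \<open>s\<close> and \<open>t\<close> on a
  common domain \<open>U\<close>, the difference is the projection to \<open>U\<close> followed by
  the continuous germ section of \<open>s - t\<close>.\<close>

lemma continuous_fminus_ext:
  "continuous_map (subtopology (prod_topology (total ext) (total ext)) {(a, b). proj ext a = proj ext b})
    (total ext) (\<lambda>(a, b). a \<ominus>\<^bsub>stalk ext (proj ext a)\<^esub> b)"
proof (rule continuous_map_localI)
  let ?X = "subtopology (prod_topology (total ext) (total ext)) {(a, b). proj ext a = proj ext b}"
  fix q assume q: "q \<in> topspace ?X"
  obtain a b where ab: "q = (a, b)" by (cases q)
  have m: "a \<in> topspace (total ext)" "b \<in> topspace (total ext)" "fst b = fst a" using q ab by auto
  obtain U s t where st: "a = (fst a, gm (fst a) U s)" "b = (fst a, gm (fst a) U t)"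
    "lsec U s" "lsec U t" "fst a \<in> U" using ext_cases_common[OF m] .
  have o: "openin TX U" using st by (simp add: local_section_def)
  let ?B = "((\<lambda>y. (y, gm y U s)) ` U) \<times> ((\<lambda>y. (y, gm y U t)) ` U)"
  let ?S = "subtopology ?X (?B \<inter> {(a, b). proj ext a = proj ext b})"
  have "openin (prod_topology (total ext) (total ext)) ?B"
    using germ_image_open[OF st(3) o] germ_image_open[OF st(4) o] by (simp add: openin_prod_Times_iff)
  then have op: "openin ?X (?B \<inter> {(a, b). proj ext a = proj ext b})"
    by (auto simp: openin_subtopology)
  have "a \<in> (\<lambda>y. (y, gm y U s)) ` U" using st(1,5) by (rule image_eqI)
  moreover have "b \<in> (\<lambda>y. (y, gm y U t)) ` U" using st(2,5) by (rule image_eqI)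
  ultimately have mem: "q \<in> ?B \<inter> {(a, b). proj ext a = proj ext b}" using m(3) ab by simp
  have "continuous_map ?X TX (fst \<circ> fst)"
    by (rule continuous_map_from_subtopology)
      (use continuous_map_compose[OF continuous_map_fst continuous_fst_germ] in simp)
  then have "continuous_map ?S TX (fst \<circ> fst)" by (rule continuous_map_from_subtopology)
  then have "continuous_map ?S (subtopology TX U) (fst \<circ> fst)"
    by (rule continuous_map_into_subtopology) auto
  from continuous_map_compose[OF this continuous_germ[OF lsec_minus[OF st(3,4)]]]
  have "continuous_map ?S (total ext) (\<lambda>(a, b). a \<ominus>\<^bsub>stalk ext (proj ext a)\<^esub> b)"
    unfolding extension_simps by (rule continuous_map_eq) (auto simp: fminus_germ[OF st(3,4)])
  then show "\<exists>W. openin ?X W \<and> q \<in> W \<and> continuous_map (subtopology ?X W) (total ext)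
      (\<lambda>(a, b). a \<ominus>\<^bsub>stalk ext (proj ext a)\<^esub> b)"
    using op mem by blast
qed

text \<open>The action is conjugation of sections, and it is multiplicative because the inverse of
  \<open>h \<otimes> g\<close> moves points by the inverse of \<open>h\<close> followed by the
  inverse of \<open>g\<close>. The rest is bookkeeping of domains.\<close>

lemma action_ext: "group_action G (topspace (total ext)) (eact ext)"
proof (rule group_actionI[OF is_group])
  interpret group G by (rule is_group)
  note im = G_space_image_open[OF G_space_base topspace_group]
  show "eact ext g \<in> extensional (topspace (total ext))" for g
    by (simp add: extension_by_zero_def)
  fix a assume "a \<in> topspace (total ext)"
  then obtain y U s where a: "a = (y, gm y U s)" "lsec U s" "y \<in> U" using ext_cases by metis
  have U: "openin TX U" "U \<subseteq> topspace TX"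
    using a(2) local_section_subset[OF a(2)] by (simp_all add: local_section_def)
  have "gm y (\<phi> \<one> ` U) (actsec \<one> U s) = gm y U s"
  proof (rule germ_eqI[OF U(1) a(3)])
    have id: "\<phi> \<one> u = u" if "u \<in> U" for u
      using group_action_one[OF action_base] that U(2) by blast
    then show "U \<subseteq> \<phi> \<one> ` U \<inter> U" by force
    fix z assume z: "z \<in> U \<inter> Z"
    then have "z \<in> \<phi> \<one> ` U" using id by force
    then show "actsec \<one> U s z = s z"
      using z id group_action_one[OF action_total lsec_stalk(2)[OF a(2)]] by simp
  qed
  then show "eact ext \<one> a = a"
    using eact_germ[OF one_closed a(2,3)] a(1,3) U(2) group_action_one[OF action_base, of y] by auto
  fix g assume g: "g \<in> carrier G"
  have ga: "eact ext g a = (\<phi> g y, gm (\<phi> g y) (\<phi> g ` U) (actsec g U s))"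
    using eact_germ[OF g a(2,3)] a(1) by simp
  then show "eact ext g a \<in> topspace (total ext)"
    using germ_in_topspace[OF lsec_act[OF g a(2)]] a(3) by simp
  fix h assume h: "h \<in> carrier G"
  have comp: "\<phi> (h \<otimes> g) u = \<phi> h (\<phi> g u)" if "u \<in> U" for u
    using group_action.composition_rule[OF action_base] that g h U(2) by blast
  have hgU: "\<phi> (h \<otimes> g) ` U = \<phi> h ` \<phi> g ` U" using comp by force
  have "gm (\<phi> h (\<phi> g y)) (\<phi> (h \<otimes> g) ` U) (actsec (h \<otimes> g) U s) =
      gm (\<phi> h (\<phi> g y)) (\<phi> h ` \<phi> g ` U) (actsec h (\<phi> g ` U) (actsec g U s))"
  proof (rule germ_eqI)
    show "openin TX (\<phi> h ` \<phi> g ` U)" using im[OF h im[OF g U(1)]] .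
    show "\<phi> h (\<phi> g y) \<in> \<phi> h ` \<phi> g ` U" using a(3) by blast
    show "\<phi> h ` \<phi> g ` U \<subseteq> \<phi> (h \<otimes> g) ` U \<inter> \<phi> h ` \<phi> g ` U" using hgU by simp
    fix z assume z: "z \<in> \<phi> h ` \<phi> g ` U \<inter> Z"
    have gU: "\<phi> g ` U \<subseteq> topspace TX" using im[OF g U(1)] openin_subset by blast
    note m = inv_image_mem[OF h gU, of z]
    have zX: "z \<in> topspace TX" using z gU group_action_closed[OF action_base h] by auto
    have e: "\<phi> (inv (h \<otimes> g)) z = \<phi> (inv g) (\<phi> (inv h) z)"
      using group_action.composition_rule[OF action_base zX, of "inv g" "inv h"] g h
      by (simp add: inv_mult_group)
    have k: "\<phi> (inv h) z \<in> \<phi> g ` U \<inter> Z" using m z by blast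
    have u: "\<phi> (inv g) (\<phi> (inv h) z) \<in> U \<inter> Z"
      using inv_image_mem[OF g U(2), of "\<phi> (inv h) z"] k by blast
    have "eact F (h \<otimes> g) (s (\<phi> (inv g) (\<phi> (inv h) z))) =
        eact F h (eact F g (s (\<phi> (inv g) (\<phi> (inv h) z))))"
      using group_action.composition_rule[OF action_total _ h g] lsec_stalk(2)[OF a(2)] u by blast
    then show "actsec (h \<otimes> g) U s z = actsec h (\<phi> g ` U) (actsec g U s) z"
      using z k hgU e by simp
  qed
  then show "eact ext (h \<otimes> g) a = eact ext h (eact ext g a)"
    using eact_germ[OF m_closed[OF h g] a(2,3)] eact_germ[OF h lsec_act[OF g a(2)], of "\<phi> g y"] ga a
      comp[OF a(3)] by simp
qed

lemma eact_ext_linear: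
  assumes g: "g \<in> carrier G" and y: "y \<in> topspace TX"
  shows "eact ext g \<in> linear_maps R (stalk ext y) (stalk ext (\<phi> g y))"
proof -
  have "eact ext g a \<in> carrier (stalk ext (\<phi> g y)) \<and>
      eact ext g (fadd ext a b) = fadd ext (eact ext g a) (eact ext g b) \<and>
      (\<forall>r\<in>carrier R. eact ext g (fsmult ext r a) = fsmult ext r (eact ext g a))"
    if "a \<in> carrier (stalk ext y)" "b \<in> carrier (stalk ext y)" for a b
  proof -
    have m: "a \<in> topspace (total ext)" "b \<in> topspace (total ext)" "fst b = fst a" "fst a = y"
      using that by auto
    obtain U s t where ab: "a = (y, gm y U s)" "b = (y, gm y U t)" and l: "lsec U s" "lsec U t" "y \<in> U"
      using ext_cases_common[OF m(1-3)] m(4) by metis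
    have gy: "\<phi> g y \<in> \<phi> g ` U" using l by blast
    have inv: "\<phi> (inv g) z \<in> U \<inter> Z" if "z \<in> \<phi> g ` U \<inter> Z" for z
      using inv_image_mem[OF g local_section_subset[OF l(1)]] that by blast
    have lin: "eact F g \<in> linear_maps R (stalk F u) (stalk F (\<phi> g u))" if "u \<in> U \<inter> Z" for u
      using eact_linear[OF g] open_trace that l(1) by (auto simp: local_section_def)
    have add: "actsec g U (\<lambda>z\<in>U \<inter> Z. fadd F (s z) (t z)) =
        (\<lambda>z\<in>\<phi> g ` U \<inter> Z. fadd F (actsec g U s z) (actsec g U t z))"
    proof (rule restrict_ext)
      fix z assume z: "z \<in> \<phi> g ` U \<inter> Z"
      let ?u = "\<phi> (inv g) z"
      have "eact F g (fadd F (s ?u) (t ?u)) = fadd F (eact F g (s ?u)) (eact F g (t ?u))"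
        using linear_mapsD(2)[OF lin[OF inv[OF z]] lsec_stalk(1)[OF l(1)] lsec_stalk(1)[OF l(2)]] inv[OF z]
        by simp
      then show "eact F g ((\<lambda>z\<in>U \<inter> Z. fadd F (s z) (t z)) ?u) = fadd F (actsec g U s z) (actsec g U t z)"
        using z inv[OF z] by simp
    qed
    have smult: "actsec g U (\<lambda>z\<in>U \<inter> Z. fsmult F r (s z)) =
        (\<lambda>z\<in>\<phi> g ` U \<inter> Z. fsmult F r (actsec g U s z))" if r: "r \<in> carrier R" for r
    proof (rule restrict_ext)
      fix z assume z: "z \<in> \<phi> g ` U \<inter> Z"
      let ?u = "\<phi> (inv g) z"
      have "eact F g (fsmult F r (s ?u)) = fsmult F r (eact F g (s ?u))"
        using linear_mapsD(3)[OF lin[OF inv[OF z]] r lsec_stalk(1)[OF l(1)]] inv[OF z] by simp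
      then show "eact F g ((\<lambda>z\<in>U \<inter> Z. fsmult F r (s z)) ?u) = fsmult F r (actsec g U s z)"
        using z inv[OF z] by simp
    qed
    have "eact ext g (fadd ext a b) = fadd ext (eact ext g a) (eact ext g b)"
      unfolding ab
      by (simp only: fadd_germ_same[OF l] eact_germ[OF g _ l(3)] l(1,2) lsec_add add
          fadd_germ_same[OF lsec_act[OF g l(1)] lsec_act[OF g l(2)] gy])
    moreover have "eact ext g (fsmult ext r a) = fsmult ext r (eact ext g a)" if "r \<in> carrier R" for r
      unfolding ab
      by (simp only: fsmult_germ[OF _ l(3)] eact_germ[OF g _ l(3)] l(1) lsec_smult smult that
          fsmult_germ[OF lsec_act[OF g l(1)] gy])
    moreover have "eact ext g a \<in> carrier (stalk ext (\<phi> g y))"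
      unfolding ab eact_germ[OF g l(1,3)] by (rule ext_stalk_mem[OF lsec_act[OF g l(1)] gy])
    ultimately show ?thesis by blast
  qed
  then show ?thesis by (auto simp: linear_maps_def)
qed

theorem is_gsheaf_ext: "is_gsheaf G TG R TX \<phi> ext"
  unfolding is_gsheaf_def
proof (intro conjI ballI)
  show "G_space G TG (total ext) (eact ext)"
    using action_ext continuous_eact_ext by (simp add: G_space_def)
  show "local_homeo (total ext) TX (proj ext)" using local_homeo_fst_germ by simp
  show "proj ext (eact ext g e) = \<phi> g (proj ext e)" if "g \<in> carrier G" "e \<in> topspace (total ext)" for g e
    using that by (auto simp: extension_by_zero_def split: prod.splits)
  show "continuous_map (total ext) (total ext) (fsmult ext r)" if r: "r \<in> carrier R" for r
    unfolding extension_simps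
  proof (rule continuous_map_from_germs)
    fix U s assume s: "lsec U s"
    show "continuous_map (subtopology TX U) (germ_topology TX Z F) (\<lambda>y. fsmult ext r (y, gm y U s))"
      by (rule continuous_map_eq[OF continuous_germ[OF lsec_smult[OF s r]]]) (simp add: fsmult_germ[OF s])
  qed
qed (fact left_module_ext continuous_fminus_ext eact_ext_linear)+

end

section \<open>Functoriality of extension by zero\<close>

text \<open>Local sections take values in the total space, so it suffices that \<open>p\<close> is
  the identity there; this admits the restricted identity used as a morphism.\<close>

lemma extension_by_zero_map_id:
  assumes "\<And>e. e \<in> topspace (total F) \<Longrightarrow> p e = e" "a \<in> topspace (germ_topology TX Z F)"
  shows "extension_by_zero_map TX Z F F p a = a"
proof -
  obtain y U s where a: "a = (y, germ TX Z F y U s)" "local_section TX Z F U s" "y \<in> U"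
    using germ_topology_cases[OF assms(2)] by metis
  have "germ TX Z F y U (\<lambda>z\<in>U \<inter> Z. p (s z)) = germ TX Z F y U s"
  proof (rule germ_eqI)
    show "openin TX U" using a by (simp add: local_section_def)
    fix z assume z: "z \<in> U \<inter> Z"
    have "s z \<in> topspace (total F)"
      using sections_mem[of s _ F "U \<inter> Z" z] z a(2) local_section_subset[OF a(2)]
      by (auto simp: local_section_def)
    then show "(\<lambda>z\<in>U \<inter> Z. p (s z)) z = s z" using assms(1) z by simp
  qed (use a in auto)
  then show ?thesis unfolding a(1) extension_by_zero_map_germ[OF a(2,3)] by simp
qed

context closed_gsheaf
begin

lemma lsec_map:
  assumes p: "p \<in> gsheaf_hom G R (subtopology TX Z) F F'" and s: "lsec U s"
  shows "local_section TX Z F' U (\<lambda>z\<in>U \<inter> Z. p (s z))"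
  unfolding local_section_def
proof
  show "openin TX U" using s by (simp add: local_section_def)
  show "(\<lambda>z\<in>U \<inter> Z. p (s z)) \<in> sections (subtopology TX Z) F' (U \<inter> Z)"
  proof (rule sectionsI)
    show "continuous_map (subtopology (subtopology TX Z) (U \<inter> Z)) (total F') (\<lambda>z. p (s z))"
      using continuous_map_compose[OF sectionsD(2) gsheaf_homD(2)[OF p]] s
      by (simp add: comp_def local_section_def)
    show "proj F' (p (s z)) = z" if "z \<in> U \<inter> Z" for z
      using gsheaf_homD(3)[OF p lsec_stalk(2)[OF s]] lsec_stalk(3)[OF s] that by auto
  qed
qed

lemma extension_by_zero_map_comp:
  assumes p: "p \<in> gsheaf_hom G R (subtopology TX Z) F F'" and a: "a \<in> topspace (total ext)"
  shows "extension_by_zero_map TX Z F' F'' q (extension_by_zero_map TX Z F F' p a) =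
    extension_by_zero_map TX Z F F'' (compose (topspace (total F)) q p) a"
proof -
  obtain y U s where a: "a = (y, gm y U s)" "lsec U s" "y \<in> U" using ext_cases[OF a] by metis
  have "(\<lambda>z\<in>U \<inter> Z. q ((\<lambda>z\<in>U \<inter> Z. p (s z)) z)) = (\<lambda>z\<in>U \<inter> Z. compose (topspace (total F)) q p (s z))"
    by (rule restrict_ext) (use lsec_stalk(2)[OF a(2)] in \<open>auto simp: compose_def\<close>)
  then show ?thesis
    unfolding a(1) extension_by_zero_map_germ[OF a(2,3)]
      extension_by_zero_map_germ[OF lsec_map[OF p a(2)] a(3)]
    by simp
qed

lemma extension_by_zero_map_hom:
  assumes F': "closed_gsheaf G TG R TX \<phi> Z F'"
    and p: "p \<in> gsheaf_hom G R (subtopology TX Z) F F'"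
  shows "extension_by_zero_map TX Z F F' p \<in> gsheaf_hom G R TX ext (extension_by_zero G TX \<phi> Z F')"
    (is "?m \<in> _")
proof -
  interpret F': closed_gsheaf G TG R TX \<phi> Z F' by (rule F')
  note im = extension_by_zero_map_germ[where F' = F' and p = p]
  have cont: "continuous_map (germ_topology TX Z F) (germ_topology TX Z F') ?m"
  proof (rule continuous_map_from_germs)
    fix U s assume s: "lsec U s"
    show "continuous_map (subtopology TX U) (germ_topology TX Z F') (\<lambda>y. ?m (y, gm y U s))"
      by (rule continuous_map_eq[OF continuous_germ[OF lsec_map[OF p s]]]) (simp add: im[OF s])
  qed
  have fst: "fst (?m a) = fst a" if "a \<in> topspace (germ_topology TX Z F)" for a
    using that by (simp add: extension_by_zero_map_def split: prod.splits)
  have act: "?m (eact ext g a) = eact F'.ext g (?m a)"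
    if g: "g \<in> carrier G" and a: "a \<in> topspace (total ext)" for g a
  proof -
    obtain y U s where a: "a = (y, gm y U s)" "lsec U s" "y \<in> U" using ext_cases[OF a] by metis
    have "(\<lambda>z\<in>\<phi> g ` U \<inter> Z. p (actsec g U s z)) = F'.actsec g U (\<lambda>z\<in>U \<inter> Z. p (s z))"
    proof (rule restrict_ext)
      fix z assume z: "z \<in> \<phi> g ` U \<inter> Z"
      then have u: "\<phi> (inv g) z \<in> U \<inter> Z"
        using inv_image_mem[OF g local_section_subset[OF a(2)], of z] by blast
      then show "p (actsec g U s z) = eact F' g ((\<lambda>z\<in>U \<inter> Z. p (s z)) (\<phi> (inv g) z))"
        using gsheaf_homD(5)[OF p g lsec_stalk(2)[OF a(2)]] z by auto
    qed
    then show ?thesis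
      unfolding a(1) eact_germ[OF g a(2,3)] im[OF a(2,3)] F'.eact_germ[OF g lsec_map[OF p a(2)] a(3)]
      using im[OF lsec_act[OF g a(2)], of "\<phi> g y"] a(3) by simp
  qed
  have lin: "?m \<in> linear_maps R (stalk ext y) (stalk F'.ext y)" if "y \<in> topspace TX" for y
  proof -
    have "?m a \<in> carrier (stalk F'.ext y) \<and> ?m (fadd ext a b) = fadd F'.ext (?m a) (?m b) \<and>
      (\<forall>r\<in>carrier R. ?m (fsmult ext r a) = fsmult F'.ext r (?m a))"
      if "a \<in> carrier (stalk ext y)" "b \<in> carrier (stalk ext y)" for a b
    proof -
      have m: "a \<in> topspace (total ext)" "b \<in> topspace (total ext)" "fst b = fst a" "fst a = y"
        using that by auto
      obtain U s t where ab: "a = (y, gm y U s)" "b = (y, gm y U t)" and l: "lsec U s" "lsec U t" "y \<in> U"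
        using ext_cases_common[OF m(1-3)] m(4) by metis
      have p_lin: "p \<in> linear_maps R (stalk F z) (stalk F' z)" if "z \<in> U \<inter> Z" for z
        using gsheaf_homD(6)[OF p] open_trace that l(1) by (auto simp: local_section_def)
      have add: "(\<lambda>z\<in>U \<inter> Z. p ((\<lambda>z\<in>U \<inter> Z. fadd F (s z) (t z)) z)) =
          (\<lambda>z\<in>U \<inter> Z. fadd F' ((\<lambda>z\<in>U \<inter> Z. p (s z)) z) ((\<lambda>z\<in>U \<inter> Z. p (t z)) z))"
        by (rule restrict_ext)
          (use linear_mapsD(2)[OF p_lin lsec_stalk(1)[OF l(1)] lsec_stalk(1)[OF l(2)]] in simp)
      have smult: "(\<lambda>z\<in>U \<inter> Z. p ((\<lambda>z\<in>U \<inter> Z. fsmult F r (s z)) z)) =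
          (\<lambda>z\<in>U \<inter> Z. fsmult F' r ((\<lambda>z\<in>U \<inter> Z. p (s z)) z))" if r: "r \<in> carrier R" for r
        by (rule restrict_ext) (use linear_mapsD(3)[OF p_lin r lsec_stalk(1)[OF l(1)]] in simp)
      note ps = lsec_map[OF p l(1)] lsec_map[OF p l(2)]
      have "?m (fadd ext a b) = fadd F'.ext (?m a) (?m b)"
        unfolding ab
        by (simp only: fadd_germ_same[OF l] im[OF _ l(3)] l(1,2) lsec_add add F'.fadd_germ_same[OF ps l(3)])
      moreover have "?m (fsmult ext r a) = fsmult F'.ext r (?m a)" if "r \<in> carrier R" for r
        unfolding ab
        by (simp only: fsmult_germ[OF _ l(3)] im[OF _ l(3)] l(1) lsec_smult that smult F'.fsmult_germ[OF ps(1) l(3)])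
      moreover have "?m a \<in> carrier (stalk F'.ext y)"
        unfolding ab im[OF l(1,3)] by (rule F'.ext_stalk_mem[OF ps(1) l(3)])
      ultimately show ?thesis by blast
    qed
    then show ?thesis by (auto simp: linear_maps_def)
  qed
  show ?thesis
    unfolding gsheaf_hom_def using cont fst act lin
    by (simp add: extension_by_zero_map_def)
qed

end

subsection \<open>Morphisms into an extension by zero\<close>

text \<open>Transposition between restriction to \<open>Z\<close> and extension by zero:
  \<open>\<tau>\<close> stands for a map from the part of \<open>E\<close> over \<open>Z\<close> to
  \<open>F\<close>. The union runs over all sections through \<open>e\<close>, so that no section
  has to be chosen.\<close>

definition germ_lift ::
  "'x topology \<Rightarrow> 'x set \<Rightarrow> ('x, 'f, 'r, 'g) gsheaf \<Rightarrow> ('x, 'e, 'r, 'g) gsheaf \<Rightarrow> ('e \<Rightarrow> 'f)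
    \<Rightarrow> 'e \<Rightarrow> 'x \<times> ('x set \<times> ('x \<Rightarrow> 'f)) set" where
  "germ_lift TX Z F E \<tau> = (\<lambda>e\<in>topspace (total E). (proj E e,
    \<Union>(U, s)\<in>{(U, s). openin TX U \<and> proj E e \<in> U \<and> s \<in> sections TX E U \<and> s (proj E e) = e}.
      germ TX Z F (proj E e) U (\<lambda>z\<in>U \<inter> Z. \<tau> (s z))))"

context closed_gsheaf
begin

text \<open>Two sections of \<open>E\<close> through the same point agree near it by
  \<open>sections_agree_open\<close>, hence their composites with \<open>\<tau>\<close> have the
  same germ.\<close>

lemma germ_lift_section:
  assumes E: "gsheaf_on G TG R TX \<phi> E"
    and U: "openin TX U" "y \<in> U" and s: "s \<in> sections TX E U"
  shows "germ_lift TX Z F E \<tau> (s y) = (y, gm y U (\<lambda>z\<in>U \<inter> Z. \<tau> (s z)))"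
proof -
  interpret E: gsheaf_on G TG R TX \<phi> E by (rule E)
  have sy: "s y \<in> topspace (total E)" "proj E (s y) = y"
    using E.sections_stalk[OF s U(2)] openin_subset[OF U(1)] by auto
  have "(\<Union>(V, t)\<in>{(V, t). openin TX V \<and> y \<in> V \<and> t \<in> sections TX E V \<and> t y = s y}.
      gm y V (\<lambda>z\<in>V \<inter> Z. \<tau> (t z))) = gm y U (\<lambda>z\<in>U \<inter> Z. \<tau> (s z))"
  proof (rule SUP_eq_const)
    fix q assume "q \<in> {(V, t). openin TX V \<and> y \<in> V \<and> t \<in> sections TX E V \<and> t y = s y}"
    then obtain V t where q: "q = (V, t)" and t: "openin TX V" "y \<in> V" "t \<in> sections TX E V" "t y = s y"
      by blast
    have "gm y V (\<lambda>z\<in>V \<inter> Z. \<tau> (t z)) = gm y U (\<lambda>z\<in>U \<inter> Z. \<tau> (s z))"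
      by (rule germ_eqI[OF E.sections_agree_open[OF s t(3) U(1) t(1)]]) (use U t in auto)
    then show "(case q of (V, t) \<Rightarrow> gm y V (\<lambda>z\<in>V \<inter> Z. \<tau> (t z))) = gm y U (\<lambda>z\<in>U \<inter> Z. \<tau> (s z))"
      using q by simp
  qed (use U s in blast)
  then show ?thesis using sy by (simp add: germ_lift_def)
qed

text \<open>Continuity of \<open>\<tau>\<close> is expressed as carrying local sections of
  \<open>E\<close> to local sections of \<open>F\<close>, which is the form in which germs use
  it.\<close>

lemma germ_lift_hom:
  assumes E: "is_gsheaf G TG R TX \<phi> E"
    and sec: "\<And>U s. \<lbrakk>openin TX U; s \<in> sections TX E U\<rbrakk> \<Longrightarrow> lsec U (\<lambda>z\<in>U \<inter> Z. \<tau> (s z))"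
    and act: "\<And>g e. \<lbrakk>g \<in> carrier G; e \<in> topspace (total E); proj E e \<in> Z\<rbrakk> \<Longrightarrow>
      \<tau> (eact E g e) = eact F g (\<tau> e)"
    and lin: "\<And>z. \<lbrakk>z \<in> Z; z \<in> topspace TX\<rbrakk> \<Longrightarrow> \<tau> \<in> linear_maps R (stalk E z) (stalk F z)"
  shows "germ_lift TX Z F E \<tau> \<in> gsheaf_hom G R TX E ext" (is "?l \<in> _")
proof -
  interpret E: gsheaf_on G TG R TX \<phi> E by (simp add: gsheaf_on_def E)
  interpret E': closed_gsheaf G TG R TX \<phi> "topspace TX" E
    by (intro closed_gsheaf.intro gsheaf_on.intro closed_gsheaf_axioms.intro)
      (use E ring topspace_group G_space_base group_action_closed[OF action_base] in auto)
  note lift = germ_lift_section[OF E.gsheaf_on_axioms, where \<tau> = \<tau>]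
  have cont: "continuous_map (total E) (germ_topology TX Z F) ?l"
  proof (rule continuous_map_localI)
    fix e assume e: "e \<in> topspace (total E)"
    obtain U s where U: "openin TX U" "proj E e \<in> U" "s \<in> sections TX E U" "s (proj E e) = e"
      using E.section_through[OF e] .
    have "continuous_map (subtopology (total E) (s ` U)) (subtopology TX U) (proj E)"
      using E.continuous_proj sectionsD(3)[OF U(3)]
      by (auto simp: continuous_map_in_subtopology continuous_map_from_subtopology)
    from continuous_map_compose[OF this continuous_germ[OF sec[OF U(1,3)]]]
    have "continuous_map (subtopology (total E) (s ` U)) (germ_topology TX Z F) ?l"
      by (rule continuous_map_eq) (use lift[OF U(1) _ U(3)] sectionsD(3)[OF U(3)] in auto)
    moreover have "e \<in> s ` U" using U(4)[symmetric] U(2) by (rule image_eqI)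
    ultimately show "\<exists>W. openin (total E) W \<and> e \<in> W \<and>
        continuous_map (subtopology (total E) W) (germ_topology TX Z F) ?l"
      using E.section_image_open[OF U(3,1)] by blast
  qed
  have lact: "?l (eact E g e) = eact ext g (?l e)" if g: "g \<in> carrier G" and e: "e \<in> topspace (total E)" for g e
  proof -
    obtain U s where U: "openin TX U" "proj E e \<in> U" "s \<in> sections TX E U" "s (proj E e) = e"
      using E.section_through[OF e] .
    let ?y = "proj E e"
    have Ut: "U \<subseteq> topspace TX" using U(1) openin_subset by blast
    have ls: "E'.lsec U s" using U Ut by (simp add: local_section_def inf.absorb1)
    note o = G_space_image_open[OF G_space_base topspace_group g U(1)]
    have i: "\<phi> g ` U \<inter> topspace TX = \<phi> g ` U" using openin_subset[OF o] by blast
    \<comment> \<open>The translated section passes through \<open>g e\<close> and so computes the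
      lift at that point.\<close>
    let ?t = "E'.actsec g U s"
    have t: "?t \<in> sections TX E (\<phi> g ` U)"
      using E'.lsec_act[OF g ls] i by (simp add: local_section_def)
    have gy: "\<phi> g ?y \<in> \<phi> g ` U" using U(2) by blast
    have "?t (\<phi> g ?y) = eact E g e"
      using gy i group_action_inv(1)[OF action_base g, of ?y] Ut U(2,4) by auto
    then have "?l (eact E g e) = (\<phi> g ?y, gm (\<phi> g ?y) (\<phi> g ` U) (\<lambda>z\<in>\<phi> g ` U \<inter> Z. \<tau> (?t z)))"
      using lift[OF o gy t] by metis
    moreover have "(\<lambda>z\<in>\<phi> g ` U \<inter> Z. \<tau> (?t z)) = actsec g U (\<lambda>z\<in>U \<inter> Z. \<tau> (s z))"
    proof (rule restrict_ext)
      fix z assume z: "z \<in> \<phi> g ` U \<inter> Z"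
      then have u: "\<phi> (inv g) z \<in> U \<inter> Z" using inv_image_mem[OF g Ut, of z] by blast
      have "s (\<phi> (inv g) z) \<in> topspace (total E)" "proj E (s (\<phi> (inv g) z)) \<in> Z"
        using E.sections_stalk[OF U(3) _ Ut] u by auto
      then show "\<tau> (?t z) = eact F g ((\<lambda>z\<in>U \<inter> Z. \<tau> (s z)) (\<phi> (inv g) z))"
        using act[OF g] u z i by auto
    qed
    ultimately show ?thesis
      using lift[OF U(1,2,3)] U(4) eact_germ[OF g sec[OF U(1,3)] U(2)] by simp
  qed
  have llin: "?l \<in> linear_maps R (stalk E y) (stalk ext y)" if y: "y \<in> topspace TX" for y
  proof -
    have "?l a \<in> carrier (stalk ext y) \<and> ?l (fadd E a b) = fadd ext (?l a) (?l b) \<and>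
      (\<forall>r\<in>carrier R. ?l (fsmult E r a) = fsmult ext r (?l a))"
      if a: "a \<in> carrier (stalk E y)" and b: "b \<in> carrier (stalk E y)" for a b
    proof -
      obtain U0 s0 where s0: "openin TX U0" "y \<in> U0" "s0 \<in> sections TX E U0" "s0 y = a"
        using E.section_through[of a] a by auto
      obtain V0 t0 where t0: "openin TX V0" "y \<in> V0" "t0 \<in> sections TX E V0" "t0 y = b"
        using E.section_through[of b] b by auto
      define U where "U = U0 \<inter> V0"
      define s where "s = restrict s0 U"
      define t where "t = restrict t0 U"
      have U: "openin TX U" "y \<in> U" using s0 t0 by (auto simp: U_def)
      have st: "s \<in> sections TX E U" "t \<in> sections TX E U"
        using sections_restrict[OF s0(3)] sections_restrict[OF t0(3)] by (auto simp: s_def t_def U_def)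
      have ab: "a = s y" "b = t y" using s0 t0 U by (auto simp: s_def t_def)
      have Ut: "U \<subseteq> topspace TX" using U(1) openin_subset by blast
      let ?a = "\<lambda>z\<in>U. fadd E (s z) (t z)"
      have "?l (?a y) = (y, gm y U (\<lambda>z\<in>U \<inter> Z. \<tau> (?a z)))"
        by (rule lift[OF U E.sections_add[OF st Ut]])
      moreover have "(\<lambda>z\<in>U \<inter> Z. \<tau> (?a z)) =
          (\<lambda>z\<in>U \<inter> Z. fadd F ((\<lambda>z\<in>U \<inter> Z. \<tau> (s z)) z) ((\<lambda>z\<in>U \<inter> Z. \<tau> (t z)) z))"
        by (rule restrict_ext)
          (use linear_mapsD(2)[OF lin E.sections_stalk[OF st(1) _ Ut] E.sections_stalk[OF st(2) _ Ut]] Ut in auto)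
      ultimately have "?l (fadd E a b) = fadd ext (?l a) (?l b)"
        using fadd_germ_same[OF sec[OF U(1) st(1)] sec[OF U(1) st(2)] U(2)] lift[OF U st(1)] lift[OF U st(2)] ab U(2)
        by simp
      moreover have "?l (fsmult E r a) = fsmult ext r (?l a)" if r: "r \<in> carrier R" for r
      proof -
        let ?m = "\<lambda>z\<in>U. fsmult E r (s z)"
        have "?l (?m y) = (y, gm y U (\<lambda>z\<in>U \<inter> Z. \<tau> (?m z)))"
          by (rule lift[OF U E.sections_smult[OF st(1) r Ut]])
        moreover have "(\<lambda>z\<in>U \<inter> Z. \<tau> (?m z)) = (\<lambda>z\<in>U \<inter> Z. fsmult F r ((\<lambda>z\<in>U \<inter> Z. \<tau> (s z)) z))"
          by (rule restrict_ext)
            (use linear_mapsD(3)[OF lin r E.sections_stalk[OF st(1) _ Ut]] Ut in auto)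
        ultimately show ?thesis
          using fsmult_germ[OF sec[OF U(1) st(1)] U(2)] lift[OF U st(1)] ab U(2) by simp
      qed
      moreover have "?l a \<in> carrier (stalk ext y)"
        using lift[OF U st(1)] ab ext_stalk_mem[OF sec[OF U(1) st(1)] U(2)] by simp
      ultimately show ?thesis by blast
    qed
    then show ?thesis by (auto simp: linear_maps_def)
  qed
  show ?thesis
    unfolding gsheaf_hom_def using cont lact llin by (simp add: germ_lift_def)
qed

end

section \<open>The induced sheaf over the orbit\<close>

text \<open>Compactness of the group together with the Hausdorff base makes the orbit map closed;
  the closed orbit and the openness of the map onto it rest on this.\<close>

locale orbit_space =
  fixes G :: "('g, 'b) monoid_scheme" (structure) and TG :: "'g topology"
    and TX :: "'x topology" and \<phi> :: "'g \<Rightarrow> 'x \<Rightarrow> 'x" and x :: 'x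
  assumes topological_group: "topological_group G TG"
    and compact_group: "compact_space TG"
    and Hausdorff_base: "Hausdorff_space TX"
    and G_space_base: "G_space G TG TX \<phi>"
    and base_point: "x \<in> topspace TX"
begin

abbreviation stab :: "'g set" where "stab \<equiv> stabilizer G \<phi> x"

abbreviation orb :: "'x set" where "orb \<equiv> orbit G \<phi> x"

abbreviation dmod :: "('r, 'c) ring_scheme \<Rightarrow> ('r, 'm, 'g) gmodule \<Rightarrow> bool" where
  "dmod \<equiv> discrete_gmodule (stab_group G \<phi> x) (stab_topology G TG \<phi> x)"

abbreviation hom_stab where "hom_stab \<equiv> gmodule_hom (stab_group G \<phi> x)"

section \<open>The orbit map of a compact group\<close>

lemma topspace_group: "topspace TG = carrier G"
  and continuous_mult: "continuous_map (prod_topology TG TG) TG (\<lambda>(g, h). g \<otimes> h)"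
  and continuous_inv: "continuous_map TG TG (\<lambda>g. inv g)"
  using topological_group by (auto simp: topological_group_def)

lemma action_base: "group_action G (topspace TX) \<phi>"
  using G_space_base by (simp add: G_space_def)

sublocale group G using action_base by (rule group_action_group)

lemma action_mult: "\<lbrakk>g \<in> carrier G; h \<in> carrier G; y \<in> topspace TX\<rbrakk> \<Longrightarrow> \<phi> (g \<otimes> h) y = \<phi> g (\<phi> h y)"
  using group_action.composition_rule[OF action_base] by blast

lemma stab_iff: "h \<in> stab \<longleftrightarrow> h \<in> carrier G \<and> \<phi> h x = x"
  by (simp add: stabilizer_def)

lemma subgroup_stab: "subgroup stab G"
  using group_action.stabilizer_subgroup[OF action_base base_point] .

lemma stab_carrier: "h \<in> stab \<Longrightarrow> h \<in> carrier G"
  by (simp add: stab_iff)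

lemma orbit_eq_iff:
  assumes "k \<in> carrier G" "g \<in> carrier G"
  shows "\<phi> k x = \<phi> g x \<longleftrightarrow> inv g \<otimes> k \<in> stab"
proof -
  have "\<phi> (inv g \<otimes> k) x = \<phi> (inv g) (\<phi> k x)"
    using action_mult assms base_point by simp
  moreover have "\<phi> k x \<in> topspace TX" "\<phi> g x \<in> topspace TX"
    using group_action_closed[OF action_base] assms base_point by blast+
  ultimately show ?thesis
    using group_action_inv[OF action_base assms(2)] assms base_point by (metis inv_closed m_closed stab_iff)
qed

lemma continuous_orbit_map: "continuous_map TG TX (\<lambda>k. \<phi> k x)"
proof -
  have "continuous_map TG (prod_topology TG TX) (\<lambda>k. (k, x))"
    using base_point by (intro continuous_map_pairedI) auto
  then have "continuous_map TG TX ((\<lambda>(g, y). \<phi> g y) \<circ> (\<lambda>k. (k, x)))"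
    using G_space_base unfolding G_space_def by (blast intro: continuous_map_compose)
  then show ?thesis by (simp add: comp_def)
qed

lemma orbit_image: "(\<lambda>k. \<phi> k x) ` carrier G = orb"
  by (auto simp: orbit_def)

text \<open>Closed subsets of a compact space are compact, continuous images of them are compact,
  and compact sets in a Hausdorff space are closed.\<close>

lemma orbit_image_closed:
  assumes "closedin TG C"
  shows "closedin TX ((\<lambda>k. \<phi> k x) ` C)"
  using closedin_compact_space[OF compact_group assms] image_compactin[OF _ continuous_orbit_map]
    compactin_imp_closedin[OF Hausdorff_base] by blast

lemma closed_orbit: "closedin TX orb"
  using orbit_image_closed[of "carrier G"] topspace_group orbit_image by (metis closedin_topspace)

lemma orbit_subset: "orb \<subseteq> topspace TX"
  using closed_orbit closedin_subset by blast

lemma topspace_orbit: "topspace (subtopology TX orb) = orb"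
  using orbit_subset by auto

lemma orbit_invariant: "\<lbrakk>g \<in> carrier G; z \<in> orb\<rbrakk> \<Longrightarrow> \<phi> g z \<in> orb"
  using action_mult base_point unfolding orbit_def by (auto intro: m_closed) (metis m_closed)

text \<open>The translate by \<open>h\<close> is the preimage under translation by the inverse of
  \<open>h\<close>. Saturations under the stabilizer, in \<open>G\<close> and in the balanced
  product, are unions of such translates.\<close>

lemma right_translate_open:
  assumes W: "openin TG W" and h: "h \<in> carrier G"
  shows "openin TG ((\<lambda>k. k \<otimes> h) ` W)"
proof -
  have Wc: "W \<subseteq> carrier G" using W openin_subset topspace_group by blast
  have "continuous_map TG (prod_topology TG TG) (\<lambda>k. (k, inv h))"
    using h topspace_group by (intro continuous_map_pairedI) auto
  then have "continuous_map TG TG ((\<lambda>(g, h). g \<otimes> h) \<circ> (\<lambda>k. (k, inv h)))"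
    using continuous_mult by (rule continuous_map_compose)
  then have "openin TG {k \<in> topspace TG. ((\<lambda>(g, h). g \<otimes> h) \<circ> (\<lambda>k. (k, inv h))) k \<in> W}"
    using W by (rule openin_continuous_map_preimage)
  moreover have "{k \<in> topspace TG. ((\<lambda>(g, h). g \<otimes> h) \<circ> (\<lambda>k. (k, inv h))) k \<in> W} = (\<lambda>k. k \<otimes> h) ` W"
  proof (intro equalityI subsetI)
    fix k assume "k \<in> {k \<in> topspace TG. ((\<lambda>(g, h). g \<otimes> h) \<circ> (\<lambda>k. (k, inv h))) k \<in> W}"
    then have k: "k \<in> carrier G" "k \<otimes> inv h \<in> W" using topspace_group by auto
    show "k \<in> (\<lambda>k. k \<otimes> h) ` W" by (rule image_eqI[OF _ k(2)]) (use k h in \<open>simp add: m_assoc\<close>)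
  next
    fix k assume "k \<in> (\<lambda>k. k \<otimes> h) ` W"
    then obtain w where w: "w \<in> W" "k = w \<otimes> h" by blast
    then show "k \<in> {k \<in> topspace TG. ((\<lambda>(g, h). g \<otimes> h) \<circ> (\<lambda>k. (k, inv h))) k \<in> W}"
      using Wc h topspace_group by (auto simp: m_assoc subset_iff)
  qed
  ultimately show ?thesis by simp
qed

text \<open>As the group is compact, the orbit carries the quotient topology of the cosets of the
  stabilizer.\<close>

lemma orbit_map_open:
  assumes W: "openin TG W"
  shows "openin (subtopology TX orb) ((\<lambda>k. \<phi> k x) ` W)"
proof -
  \<comment> \<open>Openness is deduced from the closed orbit map by complements, which requires a
    saturated set: \<open>S\<close> consists of all products of elements of \<open>W\<close> and the
    stabilizer and has the same image as \<open>W\<close>.\<close>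
  define S where "S = (\<Union>h\<in>stab. (\<lambda>k. k \<otimes> h) ` W)"
  have Wc: "W \<subseteq> carrier G" using W openin_subset topspace_group by blast
  have S: "openin TG S" unfolding S_def using right_translate_open[OF W] stab_carrier by blast
  have "closedin TG (carrier G - S)" using S topspace_group by (metis closedin_diff closedin_topspace)
  then have "closedin TX ((\<lambda>k. \<phi> k x) ` (carrier G - S))" by (rule orbit_image_closed)
  then have "openin TX (topspace TX - (\<lambda>k. \<phi> k x) ` (carrier G - S))" by blast
  moreover have "(\<lambda>k. \<phi> k x) ` W = (topspace TX - (\<lambda>k. \<phi> k x) ` (carrier G - S)) \<inter> orb"
  proof (intro equalityI subsetI)
    fix y assume "y \<in> (\<lambda>k. \<phi> k x) ` W"
    then obtain w where w: "w \<in> W" "y = \<phi> w x" by blast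
    have "y \<in> orb" using w Wc by (auto simp: orbit_def)
    moreover have False if k: "k \<in> carrier G - S" "y = \<phi> k x" for k
    proof -
      have "inv w \<otimes> k \<in> stab" using orbit_eq_iff[of k w] k w Wc by auto
      moreover have "k = w \<otimes> (inv w \<otimes> k)" using k w Wc by (auto simp: m_assoc[symmetric] subset_iff)
      ultimately show False using k w unfolding S_def by blast
    qed
    ultimately show "y \<in> (topspace TX - (\<lambda>k. \<phi> k x) ` (carrier G - S)) \<inter> orb"
      using orbit_subset by blast
  next
    fix y assume y: "y \<in> (topspace TX - (\<lambda>k. \<phi> k x) ` (carrier G - S)) \<inter> orb"
    then obtain k where k: "k \<in> carrier G" "y = \<phi> k x" by (auto simp: orbit_def)
    then have "k \<in> S" using y by blast
    then obtain w h where w: "w \<in> W" "h \<in> stab" "k = w \<otimes> h" unfolding S_def by blast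
    have "\<phi> k x = \<phi> w x" using action_mult[of w h x] w Wc base_point by (auto simp: stab_iff)
    then show "y \<in> (\<lambda>k. \<phi> k x) ` W" using k w by blast
  qed
  ultimately show ?thesis by (auto simp: openin_subtopology)
qed

end

locale orbit_module = orbit_space G TG TX \<phi> x
  for G :: "('g, 'b) monoid_scheme" (structure) and TG :: "'g topology"
    and TX :: "'x topology" and \<phi> :: "'g \<Rightarrow> 'x \<Rightarrow> 'x" and x :: 'x +
  fixes R :: "('r, 'c) ring_scheme" and M :: "('r, 'm, 'g) gmodule"
  assumes module: "discrete_gmodule (stab_group G \<phi> x) (stab_topology G TG \<phi> x) R M"
begin

abbreviation bal :: "('x, ('g \<times> 'm) set, 'r, 'g) gsheaf" where
  "bal \<equiv> balanced_sheaf G TG \<phi> x M"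

abbreviation points :: "('g \<times> 'm) set set" where
  "points \<equiv> balanced_points G \<phi> x M"

section \<open>Classes of the balanced product\<close>

text \<open>The point usually written \<open>[g, m]\<close>.\<close>

definition cls :: "'g \<Rightarrow> 'm \<Rightarrow> ('g \<times> 'm) set" where
  "cls g m = balanced_rel G \<phi> x M `` {(g, m)}"

lemma left_module: "left_module R M"
  using module by (simp add: discrete_gmodule_def)

sublocale M: abelian_group M using left_module by (rule left_moduleD)

lemma gact_action: "group_action (stab_group G \<phi> x) (carrier M) (gact M)"
  using module by (simp add: discrete_gmodule_def)

lemma stab_group_simps [simp]:
  "carrier (stab_group G \<phi> x) = stab" "mult (stab_group G \<phi> x) = mult G" "one (stab_group G \<phi> x) = one G"
  by (simp_all add: stab_group_def)

lemma gact_linear: "h \<in> stab \<Longrightarrow> gact M h \<in> linear_maps R M M"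
  using module by (simp add: discrete_gmodule_def)

lemma gact_closed: "\<lbrakk>h \<in> stab; m \<in> carrier M\<rbrakk> \<Longrightarrow> gact M h m \<in> carrier M"
  using linear_mapsD(1)[OF gact_linear] .

lemma gact_one: "m \<in> carrier M \<Longrightarrow> gact M \<one> m = m"
  using group_action_one[OF gact_action] by simp

lemma gact_mult:
  "\<lbrakk>h \<in> stab; k \<in> stab; m \<in> carrier M\<rbrakk> \<Longrightarrow> gact M (h \<otimes> k) m = gact M h (gact M k m)"
  using group_action.composition_rule[OF gact_action] by simp

text \<open>The elements fixing \<open>m\<close> form the preimage of the open singleton
  \<open>{m}\<close> under \<open>h \<mapsto> h m\<close>. This set is open in the subgroup, hence
  the trace of an open subset of the whole group.\<close>

lemma gact_open_stabilizer:
  assumes m: "m \<in> carrier M"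
  obtains V where "openin TG V" "\<one> \<in> V" "\<And>h. \<lbrakk>h \<in> V; h \<in> stab\<rbrakk> \<Longrightarrow> gact M h m = m"
proof -
  let ?T = "subtopology TG stab"
  have "continuous_map ?T (prod_topology ?T (discrete_topology (carrier M))) (\<lambda>h. (h, m))"
    using m by (intro continuous_map_pairedI) auto
  then have "continuous_map ?T (discrete_topology (carrier M)) ((\<lambda>(h, m). gact M h m) \<circ> (\<lambda>h. (h, m)))"
    using module unfolding discrete_gmodule_def stab_topology_def by (blast intro: continuous_map_compose)
  then have "openin ?T {h \<in> topspace ?T. ((\<lambda>(h, m). gact M h m) \<circ> (\<lambda>h. (h, m))) h \<in> {m}}"
    by (rule openin_continuous_map_preimage) (use m in simp)
  then obtain V where V: "openin TG V" "{h \<in> topspace ?T. gact M h m = m} = V \<inter> stab"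
    by (auto simp: openin_subtopology)
  have "\<one> \<in> {h \<in> topspace ?T. gact M h m = m}"
    using gact_one[OF m] topspace_group subgroup.one_closed[OF subgroup_stab] by simp
  then show thesis using that[OF V(1)] V(2) by blast
qed

lemma mem_cls:
  assumes "g \<in> carrier G" "m \<in> carrier M"
  shows "(k, n) \<in> cls g m \<longleftrightarrow> k \<in> carrier G \<and> (\<exists>h\<in>stab. g = k \<otimes> h \<and> n = gact M h m)"
  using assms gact_closed by (auto simp: cls_def balanced_rel_def)

lemma cls_self: "\<lbrakk>g \<in> carrier G; m \<in> carrier M\<rbrakk> \<Longrightarrow> (g, m) \<in> cls g m"
  using mem_cls gact_one subgroup.one_closed[OF subgroup_stab] by force

text \<open>The defining identification \<open>[g h, m] = [g, h m]\<close>. The two sets of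
  representatives correspond by replacing the witness \<open>j\<close> with
  \<open>j \<otimes> inv h\<close>.\<close>

lemma cls_shift:
  assumes g: "g \<in> carrier G" and h: "h \<in> stab" and m: "m \<in> carrier M"
  shows "cls (g \<otimes> h) m = cls g (gact M h m)"
proof -
  have hG: "h \<in> carrier G" using h by (rule stab_carrier)
  have "(k, n) \<in> cls (g \<otimes> h) m \<longleftrightarrow> (k, n) \<in> cls g (gact M h m)" for k n
  proof -
    have "(\<exists>j\<in>stab. g \<otimes> h = k \<otimes> j \<and> n = gact M j m) \<longleftrightarrow>
        (\<exists>j\<in>stab. g = k \<otimes> j \<and> n = gact M j (gact M h m))" if k: "k \<in> carrier G"
    proof
      assume "\<exists>j\<in>stab. g \<otimes> h = k \<otimes> j \<and> n = gact M j m"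
      then obtain j where j: "j \<in> stab" "g \<otimes> h = k \<otimes> j" "n = gact M j m" by blast
      have jG: "j \<in> carrier G" using j(1) by (rule stab_carrier)
      have s: "j \<otimes> inv h \<in> stab"
        using subgroup.m_closed[OF subgroup_stab j(1) subgroup.m_inv_closed[OF subgroup_stab h]] .
      have "g = k \<otimes> (j \<otimes> inv h)"
        using j(2) g hG jG k by (metis inv_closed inv_solve_right m_assoc m_closed)
      moreover have "gact M (j \<otimes> inv h) (gact M h m) = n"
        using gact_mult[OF s h m] j(3) hG jG by (simp add: m_assoc)
      ultimately show "\<exists>j\<in>stab. g = k \<otimes> j \<and> n = gact M j (gact M h m)" using s by blast
    next
      assume "\<exists>j\<in>stab. g = k \<otimes> j \<and> n = gact M j (gact M h m)"
      then obtain j where j: "j \<in> stab" "g = k \<otimes> j" "n = gact M j (gact M h m)" by blast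
      have "g \<otimes> h = k \<otimes> (j \<otimes> h)" using j(2) k hG stab_carrier[OF j(1)] by (simp add: m_assoc)
      then show "\<exists>j\<in>stab. g \<otimes> h = k \<otimes> j \<and> n = gact M j m"
        using gact_mult[OF j(1) h m] j(3)
        by (intro bexI[OF _ subgroup.m_closed[OF subgroup_stab j(1) h]]) simp
    qed
    then show ?thesis using mem_cls[OF m_closed[OF g hG] m] mem_cls[OF g gact_closed[OF h m]] by blast
  qed
  then show ?thesis by auto
qed

lemma cls_mem_eq:
  assumes g: "g \<in> carrier G" and m: "m \<in> carrier M" and "(k, n) \<in> cls g m"
  shows "cls k n = cls g m" "k \<in> carrier G" "n \<in> carrier M" "\<phi> k x = \<phi> g x"
proof -
  obtain h where h: "k \<in> carrier G" "h \<in> stab" "g = k \<otimes> h" "n = gact M h m"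
    using assms mem_cls by blast
  show "cls k n = cls g m" "k \<in> carrier G" "n \<in> carrier M"
    using cls_shift[OF h(1,2) m] h gact_closed[OF h(2) m] by auto
  show "\<phi> k x = \<phi> g x" using action_mult[of k h x] h base_point by (simp add: stab_iff)
qed

lemma cls_eqD:
  assumes "k \<in> carrier G" "g \<in> carrier G" "m \<in> carrier M" "n \<in> carrier M" "cls k n = cls g m"
  obtains h where "h \<in> stab" "k = g \<otimes> h" "m = gact M h n"
  using mem_cls[OF assms(1,4), of g m] cls_self[OF assms(2,3)] assms(5) by auto

lemma points_eq: "points = {cls g m | g m. g \<in> carrier G \<and> m \<in> carrier M}"
  by (auto simp: balanced_points_def quotient_def cls_def)

lemma cls_points: "\<lbrakk>g \<in> carrier G; m \<in> carrier M\<rbrakk> \<Longrightarrow> cls g m \<in> points"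
  unfolding points_eq by blast

section \<open>Topology of the balanced product\<close>

lemma Union_points:
  assumes "U \<subseteq> points"
  shows "\<Union>U = {(k, n). k \<in> carrier G \<and> n \<in> carrier M \<and> cls k n \<in> U}"
proof (intro equalityI subsetI)
  fix q assume "q \<in> \<Union>U"
  then obtain g m where gm: "g \<in> carrier G" "m \<in> carrier M" "cls g m \<in> U" "q \<in> cls g m"
    using assms unfolding points_eq by blast
  obtain k n where q: "q = (k, n)" by (cases q)
  show "q \<in> {(k, n). k \<in> carrier G \<and> n \<in> carrier M \<and> cls k n \<in> U}"
    using cls_mem_eq[OF gm(1,2) gm(4)[unfolded q]] gm(3) by (simp add: q)
next
  fix q assume "q \<in> {(k, n). k \<in> carrier G \<and> n \<in> carrier M \<and> cls k n \<in> U}"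
  then show "q \<in> \<Union>U" using cls_self by auto
qed

text \<open>The module being discrete, its product with \<open>G\<close> is a disjoint sum of copies
  of \<open>G\<close> indexed by \<open>m\<close>, and openness can be checked on each copy.\<close>

lemma openin_Union_points:
  assumes "U \<subseteq> points"
  shows "openin (prod_topology TG (discrete_topology (carrier M))) (\<Union>U) \<longleftrightarrow>
    (\<forall>m\<in>carrier M. openin TG {k \<in> carrier G. cls k m \<in> U})" (is "openin ?P _ \<longleftrightarrow> ?R")
proof
  assume o: "openin ?P (\<Union>U)"
  show ?R
  proof
    fix m assume m: "m \<in> carrier M"
    have "continuous_map TG ?P (\<lambda>k. (k, m))" using m by (intro continuous_map_pairedI) auto
    then have "openin TG {k \<in> topspace TG. (k, m) \<in> \<Union>U}" using o by (rule openin_continuous_map_preimage)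
    then show "openin TG {k \<in> carrier G. cls k m \<in> U}"
      unfolding Union_points[OF assms] topspace_group using m by simp
  qed
next
  assume R: ?R
  show "openin ?P (\<Union>U)"
  proof (subst openin_subopen, intro ballI)
    fix q assume "q \<in> \<Union>U"
    then obtain k n where q: "q = (k, n)" "k \<in> carrier G" "n \<in> carrier M" "cls k n \<in> U"
      unfolding Union_points[OF assms] by blast
    have "openin ?P ({k \<in> carrier G. cls k n \<in> U} \<times> {n})"
      using R q(3) by (auto simp: openin_prod_Times_iff)
    moreover have "{k \<in> carrier G. cls k n \<in> U} \<times> {n} \<subseteq> \<Union>U"
      unfolding Union_points[OF assms] using q(3) by auto
    ultimately show "\<exists>T. openin ?P T \<and> q \<in> T \<and> T \<subseteq> \<Union>U" using q by blast
  qed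
qed

text \<open>The abstraction \<open>topology\<close> has the intended open sets only after the
  predicate is shown to be a topology; this holds because taking the slice at \<open>m\<close>
  commutes with intersections and unions.\<close>

lemma openin_bal:
  "openin (total bal) U \<longleftrightarrow> U \<subseteq> points \<and> (\<forall>m\<in>carrier M. openin TG {k \<in> carrier G. cls k m \<in> U})"
proof -
  let ?L = "\<lambda>U. U \<subseteq> points \<and> (\<forall>m\<in>carrier M. openin TG {k \<in> carrier G. cls k m \<in> U})"
  have e: "(\<lambda>U. U \<subseteq> points \<and> openin (prod_topology TG (discrete_topology (carrier M))) (\<Union>U)) = ?L"
    by (intro ext conj_cong refl openin_Union_points)
  have "istopology ?L"
    unfolding istopology_def
  proof (intro conjI allI impI ballI)
    fix S T m assume "?L S" "?L T" "m \<in> carrier M"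
    then have "openin TG ({k \<in> carrier G. cls k m \<in> S} \<inter> {k \<in> carrier G. cls k m \<in> T})" by blast
    moreover have "{k \<in> carrier G. cls k m \<in> S} \<inter> {k \<in> carrier G. cls k m \<in> T} =
      {k \<in> carrier G. cls k m \<in> S \<inter> T}" by blast
    ultimately show "openin TG {k \<in> carrier G. cls k m \<in> S \<inter> T}" by simp
  next
    fix K m assume "\<forall>S\<in>K. ?L S" "m \<in> carrier M"
    then have "openin TG (\<Union>S\<in>K. {k \<in> carrier G. cls k m \<in> S})" by blast
    moreover have "(\<Union>S\<in>K. {k \<in> carrier G. cls k m \<in> S}) = {k \<in> carrier G. cls k m \<in> \<Union>K}" by blast
    ultimately show "openin TG {k \<in> carrier G. cls k m \<in> \<Union>K}" by simp
  qed blast+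
  then show ?thesis by (simp add: balanced_sheaf_def e)
qed

lemma topspace_bal: "topspace (total bal) = points"
proof
  show "topspace (total bal) \<subseteq> points" using openin_bal openin_topspace by blast
  have "openin TG {k \<in> carrier G. cls k m \<in> points}" if "m \<in> carrier M" for m
  proof -
    have "{k \<in> carrier G. cls k m \<in> points} = topspace TG" using cls_points that topspace_group by blast
    then show ?thesis by simp
  qed
  then have "openin (total bal) points" using openin_bal by blast
  then show "points \<subseteq> topspace (total bal)" by (rule openin_subset)
qed

text \<open>In the slice at \<open>n\<close>, the preimage of the image is the union of the
  translates of \<open>W\<close> by those stabilizer elements that carry \<open>n\<close> to
  \<open>m\<close>.\<close>

lemma cls_image_open:
  assumes W: "openin TG W" and m: "m \<in> carrier M"
  shows "openin (total bal) ((\<lambda>k. cls k m) ` W)"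
  unfolding openin_bal
proof (intro conjI ballI)
  have Wc: "W \<subseteq> carrier G" using W openin_subset topspace_group by blast
  then show "(\<lambda>k. cls k m) ` W \<subseteq> points" using cls_points m by blast
  fix n assume n: "n \<in> carrier M"
  have "{k \<in> carrier G. cls k n \<in> (\<lambda>k. cls k m) ` W} =
      (\<Union>h\<in>{h \<in> stab. gact M h n = m}. (\<lambda>k. k \<otimes> h) ` W)"
  proof (intro equalityI subsetI)
    fix k assume "k \<in> {k \<in> carrier G. cls k n \<in> (\<lambda>k. cls k m) ` W}"
    then obtain w where w: "k \<in> carrier G" "w \<in> W" "cls k n = cls w m" by blast
    obtain h where "h \<in> stab" "k = w \<otimes> h" "m = gact M h n"
      using cls_eqD[OF w(1) _ m n w(3)] w(2) Wc by blast
    then show "k \<in> (\<Union>h\<in>{h \<in> stab. gact M h n = m}. (\<lambda>k. k \<otimes> h) ` W)" using w by blast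
  next
    fix k assume "k \<in> (\<Union>h\<in>{h \<in> stab. gact M h n = m}. (\<lambda>k. k \<otimes> h) ` W)"
    then obtain h w where h: "h \<in> stab" "gact M h n = m" "w \<in> W" "k = w \<otimes> h" by blast
    have wG: "w \<in> carrier G" using h(3) Wc by blast
    then have "cls k n = cls w m" "k \<in> carrier G"
      using cls_shift[OF wG h(1) n] h stab_carrier[OF h(1)] by auto
    then show "k \<in> {k \<in> carrier G. cls k n \<in> (\<lambda>k. cls k m) ` W}" using h(3) by blast
  qed
  moreover have "openin TG (\<Union>h\<in>{h \<in> stab. gact M h n = m}. (\<lambda>k. k \<otimes> h) ` W)"
    using right_translate_open[OF W] stab_carrier by blast
  ultimately show "openin TG {k \<in> carrier G. cls k n \<in> (\<lambda>k. cls k m) ` W}" by simp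
qed

lemma continuous_cls: "m \<in> carrier M \<Longrightarrow> continuous_map TG (total bal) (\<lambda>k. cls k m)"
  unfolding continuous_map_def topspace_bal topspace_group using cls_points openin_bal by auto

text \<open>The universal property of the quotient, tested on one slice of the product at a
  time.\<close>

lemma continuous_from_bal:
  assumes "\<And>m. m \<in> carrier M \<Longrightarrow> continuous_map TG Y (\<lambda>k. f (cls k m))"
  shows "continuous_map (total bal) Y f"
  unfolding continuous_map_def
proof (intro conjI allI impI)
  show "f \<in> topspace (total bal) \<rightarrow> topspace Y"
    using assms unfolding topspace_bal points_eq continuous_map_def topspace_group by auto
  fix U assume U: "openin Y U"
  have "openin TG {k \<in> carrier G. cls k m \<in> {a \<in> points. f a \<in> U}}" if m: "m \<in> carrier M" for m
  proof -
    have "openin TG {k \<in> topspace TG. f (cls k m) \<in> U}"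
      using assms[OF m] U by (rule openin_continuous_map_preimage)
    moreover have "{k \<in> topspace TG. f (cls k m) \<in> U} = {k \<in> carrier G. cls k m \<in> {a \<in> points. f a \<in> U}}"
      using cls_points m topspace_group by auto
    ultimately show ?thesis by simp
  qed
  then show "openin (total bal) {a \<in> topspace (total bal). f a \<in> U}"
    unfolding openin_bal topspace_bal by blast
qed

text \<open>This is where discreteness of the module enters: near \<open>g\<close>, the class \<open>[k, m]\<close> depends only on
  the point \<open>k x\<close>, so \<open>k x \<mapsto> [k, m]\<close> is a local section.\<close>

lemma cls_locally_constant:
  assumes g: "g \<in> carrier G" and m: "m \<in> carrier M"
  obtains W where "openin TG W" "g \<in> W"
    "\<And>k k'. \<lbrakk>k \<in> W; k' \<in> W; \<phi> k x = \<phi> k' x\<rbrakk> \<Longrightarrow> cls k m = cls k' m"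
proof -
  obtain V where V: "openin TG V" "\<one> \<in> V" "\<And>h. \<lbrakk>h \<in> V; h \<in> stab\<rbrakk> \<Longrightarrow> gact M h m = m"
    using gact_open_stabilizer[OF m] by metis
  \<comment> \<open>The map \<open>(k, k') \<mapsto> inv k \<otimes> k'\<close> takes
    \<open>(g, g)\<close> to the identity, so it lands in \<open>V\<close> nearby. If moreover
    \<open>k x = k' x\<close>, its value lies in the stabilizer and hence fixes
    \<open>m\<close>.\<close>
  have "continuous_map (prod_topology TG TG) (prod_topology TG TG) (\<lambda>(k, k'). (inv k, k'))"
    using continuous_map_prod_top[of TG TG TG TG "\<lambda>k. inv k" "\<lambda>k. k"] continuous_inv by auto
  from continuous_map_compose[OF this continuous_mult]
  have c: "continuous_map (prod_topology TG TG) TG (\<lambda>(k, k'). inv k \<otimes> k')"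
    by (rule continuous_map_eq) auto
  have "g \<in> topspace TG" "inv g \<otimes> g \<in> V" using g V(2) topspace_group by auto
  then obtain N1 N2 where N: "openin TG N1" "openin TG N2" "g \<in> N1" "g \<in> N2"
    "\<And>k k'. \<lbrakk>k \<in> N1; k' \<in> N2\<rbrakk> \<Longrightarrow> inv k \<otimes> k' \<in> V"
    using continuous_map_prod_nbhd[OF c _ _ V(1)] by metis
  show thesis
  proof (rule that[of "N1 \<inter> N2"])
    show "openin TG (N1 \<inter> N2)" "g \<in> N1 \<inter> N2" using N by auto
    fix k k' assume k: "k \<in> N1 \<inter> N2" "k' \<in> N1 \<inter> N2" and eq: "\<phi> k x = \<phi> k' x"
    have kG: "k \<in> carrier G" "k' \<in> carrier G" using k openin_subset[OF N(1)] topspace_group by blast+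
    have h: "inv k \<otimes> k' \<in> stab" using orbit_eq_iff[OF kG(2,1)] eq by simp
    have "gact M (inv k \<otimes> k') m = m" using V(3)[OF _ h] N(5)[of k k'] k by blast
    moreover have "k \<otimes> (inv k \<otimes> k') = k'" using kG by (simp add: m_assoc[symmetric])
    ultimately show "cls k m = cls k' m" using cls_shift[OF kG(1) h m] by simp
  qed
qed

section \<open>Operations on classes\<close>

text \<open>The witness \<open>h\<close> is forced to be \<open>inv k \<otimes> g\<close>. With the
  existential gone, identities between classes can be checked representative by
  representative.\<close>

lemma mem_cls_iff:
  assumes "g \<in> carrier G" "m \<in> carrier M"
  shows "(k, n) \<in> cls g m \<longleftrightarrow> k \<in> carrier G \<and> inv k \<otimes> g \<in> stab \<and> n = gact M (inv k \<otimes> g) m"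
proof -
  have "(\<exists>h\<in>stab. g = k \<otimes> h \<and> n = gact M h m) \<longleftrightarrow> inv k \<otimes> g \<in> stab \<and> n = gact M (inv k \<otimes> g) m"
    if k: "k \<in> carrier G"
  proof
    assume "\<exists>h\<in>stab. g = k \<otimes> h \<and> n = gact M h m"
    then obtain h where h: "h \<in> stab" "g = k \<otimes> h" "n = gact M h m" by blast
    have "inv k \<otimes> g = h" using h(2) k stab_carrier[OF h(1)] by (simp add: m_assoc[symmetric])
    then show "inv k \<otimes> g \<in> stab \<and> n = gact M (inv k \<otimes> g) m" using h by simp
  next
    assume "inv k \<otimes> g \<in> stab \<and> n = gact M (inv k \<otimes> g) m"
    moreover have "g = k \<otimes> (inv k \<otimes> g)" using k assms(1) by (simp add: m_assoc[symmetric])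
    ultimately show "\<exists>h\<in>stab. g = k \<otimes> h \<and> n = gact M h m" by blast
  qed
  then show ?thesis using mem_cls[OF assms] by blast
qed

lemma points_cases:
  assumes "A \<in> points"
  obtains g m where "g \<in> carrier G" "m \<in> carrier M" "A = cls g m"
  using assms unfolding points_eq by blast

lemma proj_cls:
  assumes "g \<in> carrier G" "m \<in> carrier M"
  shows "proj bal (cls g m) = \<phi> g x"
proof -
  have "(\<lambda>(k, m). \<phi> k x) ` cls g m = {\<phi> g x}"
  proof (intro equalityI subsetI)
    fix y assume "y \<in> (\<lambda>(k, m). \<phi> k x) ` cls g m"
    then obtain k n where "(k, n) \<in> cls g m" "y = \<phi> k x" by auto
    then show "y \<in> {\<phi> g x}" using cls_mem_eq(4)[OF assms] by simp
  qed (use cls_self[OF assms] in force)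
  then show ?thesis by (simp add: balanced_sheaf_def)
qed

lemma eact_cls:
  assumes "k \<in> carrier G" "g \<in> carrier G" "m \<in> carrier M"
  shows "eact bal k (cls g m) = cls (k \<otimes> g) m"
proof -
  have kg: "k \<otimes> g \<in> carrier G" using assms by simp
  have "(\<lambda>(j, n). (k \<otimes> j, n)) ` cls g m = cls (k \<otimes> g) m"
  proof (intro equalityI subsetI)
    fix q assume "q \<in> (\<lambda>(j, n). (k \<otimes> j, n)) ` cls g m"
    then obtain j n where q: "q = (k \<otimes> j, n)" "(j, n) \<in> cls g m" by auto
    then obtain h where "j \<in> carrier G" "h \<in> stab" "g = j \<otimes> h" "n = gact M h m"
      using mem_cls[OF assms(2,3)] by blast
    then show "q \<in> cls (k \<otimes> g) m"
      using q(1) mem_cls[OF kg assms(3)] assms(1) stab_carrier m_assoc by auto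
  next
    fix q assume q: "q \<in> cls (k \<otimes> g) m"
    obtain j n where jn: "q = (j, n)" by (cases q)
    obtain h where h: "j \<in> carrier G" "h \<in> stab" "k \<otimes> g = j \<otimes> h" "n = gact M h m"
      using q mem_cls[OF kg assms(3)] jn by blast
    have "g = inv k \<otimes> (k \<otimes> g)" using assms by (simp add: m_assoc[symmetric])
    then have "g = (inv k \<otimes> j) \<otimes> h" using h stab_carrier[OF h(2)] assms(1) by (simp add: m_assoc)
    then have "(inv k \<otimes> j, n) \<in> cls g m"
      using mem_cls[OF assms(2,3)] h assms(1) by blast
    moreover have "q = (\<lambda>(j, n). (k \<otimes> j, n)) (inv k \<otimes> j, n)"
      using jn h(1) assms(1) by (simp add: m_assoc[symmetric])
    ultimately show "q \<in> (\<lambda>(j, n). (k \<otimes> j, n)) ` cls g m" by blast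
  qed
  then show ?thesis using cls_points[OF assms(2,3)] by (simp add: balanced_sheaf_def)
qed

text \<open>Representatives of the two classes with the same first component \<open>k\<close> arise
  from the same element \<open>inv k \<otimes> g\<close>, which acts additively on the
  module.\<close>

lemma fadd_cls:
  assumes g: "g \<in> carrier G" and m: "m \<in> carrier M" "n \<in> carrier M"
  shows "fadd bal (cls g m) (cls g n) = cls g (m \<oplus>\<^bsub>M\<^esub> n)"
proof -
  have "(k, a) \<in> fadd bal (cls g m) (cls g n) \<longleftrightarrow> (k, a) \<in> cls g (m \<oplus>\<^bsub>M\<^esub> n)" for k a
    unfolding mem_cls_iff[OF g M.a_closed[OF m]]
    using linear_mapsD(2)[OF gact_linear m, of "inv k \<otimes> g"]
    by (auto simp: balanced_sheaf_def mem_cls_iff g m)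
  then show ?thesis by auto
qed

lemma fsmult_cls:
  assumes g: "g \<in> carrier G" and m: "m \<in> carrier M" and r: "r \<in> carrier R"
  shows "fsmult bal r (cls g m) = cls g (r \<odot>\<^bsub>M\<^esub> m)"
proof -
  have "(k, a) \<in> fsmult bal r (cls g m) \<longleftrightarrow> (\<exists>n. (k, n) \<in> cls g m \<and> a = r \<odot>\<^bsub>M\<^esub> n)" for k a
    by (auto simp: balanced_sheaf_def intro: rev_image_eqI)
  then have "(k, a) \<in> fsmult bal r (cls g m) \<longleftrightarrow> (k, a) \<in> cls g (r \<odot>\<^bsub>M\<^esub> m)" for k a
    unfolding mem_cls_iff[OF g left_moduleD(2)[OF left_module r m]] mem_cls_iff[OF g m]
    using linear_mapsD(3)[OF gact_linear r m, of "inv k \<otimes> g"] by auto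
  then show ?thesis by auto
qed

lemma fzero_cls:
  assumes g: "g \<in> carrier G"
  shows "fzero bal (\<phi> g x) = cls g \<zero>\<^bsub>M\<^esub>"
proof -
  have "(k, a) \<in> fzero bal (\<phi> g x) \<longleftrightarrow> (k, a) \<in> cls g \<zero>\<^bsub>M\<^esub>" for k a
    unfolding mem_cls_iff[OF g M.zero_closed]
    using linear_maps_zero[OF gact_linear M.abelian_group_axioms M.abelian_group_axioms, of "inv k \<otimes> g"]
      orbit_eq_iff[OF g, of k]
    by (auto simp: balanced_sheaf_def)
  then show ?thesis by auto
qed

text \<open>A class \<open>[k, m]\<close> over \<open>g x\<close> has \<open>k = g h\<close> with
  \<open>h\<close> in the stabilizer, so it can be rewritten as \<open>[g, h m]\<close>.\<close>

lemma stalk_bal: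
  assumes g: "g \<in> carrier G"
  shows "carrier (stalk bal (\<phi> g x)) = cls g ` carrier M"
proof (intro equalityI subsetI)
  fix A assume "A \<in> carrier (stalk bal (\<phi> g x))"
  then have A: "A \<in> points" "proj bal A = \<phi> g x" using topspace_bal by auto
  obtain k m where k: "k \<in> carrier G" "m \<in> carrier M" "A = cls k m" using points_cases[OF A(1)] .
  have h: "inv g \<otimes> k \<in> stab" using orbit_eq_iff[OF k(1) g] proj_cls[OF k(1,2)] A(2) k(3) by simp
  have "g \<otimes> (inv g \<otimes> k) = k" using g k(1) by (simp add: m_assoc[symmetric])
  then have "A = cls g (gact M (inv g \<otimes> k) m)" using cls_shift[OF g h k(2)] k(3) by simp
  then show "A \<in> cls g ` carrier M" using gact_closed[OF h k(2)] by blast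
next
  fix A assume "A \<in> cls g ` carrier M"
  then show "A \<in> carrier (stalk bal (\<phi> g x))" using cls_points[OF g] proj_cls[OF g] topspace_bal by auto
qed

lemma left_module_bal:
  assumes g: "g \<in> carrier G"
  shows "left_module R (stalk bal (\<phi> g x))"
  by (rule left_module_image[OF left_module stalk_bal[OF g]])
    (simp_all add: fadd_cls fzero_cls fsmult_cls g)

lemma fminus_cls:
  assumes g: "g \<in> carrier G" and m: "m \<in> carrier M" "n \<in> carrier M"
  shows "cls g m \<ominus>\<^bsub>stalk bal (\<phi> g x)\<^esub> cls g n = cls g (m \<ominus>\<^bsub>M\<^esub> n)"
proof -
  interpret S: abelian_group "stalk bal (\<phi> g x)" using left_module_bal[OF g] by (rule left_moduleD)
  have "\<ominus>\<^bsub>stalk bal (\<phi> g x)\<^esub> cls g n = cls g (\<ominus>\<^bsub>M\<^esub> n)"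
  proof (rule S.minus_equality)
    show "cls g (\<ominus>\<^bsub>M\<^esub> n) \<oplus>\<^bsub>stalk bal (\<phi> g x)\<^esub> cls g n = \<zero>\<^bsub>stalk bal (\<phi> g x)\<^esub>"
      using m by (simp add: fadd_cls[OF g] fzero_cls[OF g] M.l_neg)
  qed (use m in \<open>unfold stalk_bal[OF g], auto\<close>)
  then show ?thesis using m by (simp add: a_minus_def fadd_cls[OF g])
qed

section \<open>Sheaf axioms for the balanced product\<close>

text \<open>Openness is that of the orbit map applied in each slice, and local injectivity is
  \<open>cls_locally_constant\<close>.\<close>

lemma local_homeo_bal: "local_homeo (total bal) (subtopology TX orb) (proj bal)"
proof (rule local_homeo_if_open_map)
  show "continuous_map (total bal) (subtopology TX orb) (proj bal)"
  proof (rule continuous_from_bal)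
    fix m assume m: "m \<in> carrier M"
    have "continuous_map TG (subtopology TX orb) (\<lambda>k. \<phi> k x)"
      using continuous_orbit_map orbit_image topspace_group by (auto simp: continuous_map_in_subtopology)
    then show "continuous_map TG (subtopology TX orb) (\<lambda>k. proj bal (cls k m))"
      by (rule continuous_map_eq) (use proj_cls m topspace_group in auto)
  qed
  show "open_map (total bal) (subtopology TX orb) (proj bal)"
    unfolding open_map_def
  proof (intro allI impI)
    fix U assume U: "openin (total bal) U"
    have "openin (subtopology TX orb) (\<Union>m\<in>carrier M. (\<lambda>k. \<phi> k x) ` {k \<in> carrier G. cls k m \<in> U})"
      using orbit_map_open U unfolding openin_bal by blast
    moreover have "(\<Union>m\<in>carrier M. (\<lambda>k. \<phi> k x) ` {k \<in> carrier G. cls k m \<in> U}) = proj bal ` U"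
    proof (intro equalityI subsetI)
      fix y assume "y \<in> (\<Union>m\<in>carrier M. (\<lambda>k. \<phi> k x) ` {k \<in> carrier G. cls k m \<in> U})"
      then obtain m k where "m \<in> carrier M" "k \<in> carrier G" "cls k m \<in> U" "y = \<phi> k x" by blast
      then show "y \<in> proj bal ` U" using proj_cls by (metis image_eqI)
    next
      fix y assume "y \<in> proj bal ` U"
      then obtain A where A: "A \<in> U" "y = proj bal A" by blast
      obtain k m where "k \<in> carrier G" "m \<in> carrier M" "A = cls k m"
        using A(1) U points_cases unfolding openin_bal by blast
      then show "y \<in> (\<Union>m\<in>carrier M. (\<lambda>k. \<phi> k x) ` {k \<in> carrier G. cls k m \<in> U})"
        using A proj_cls by auto
    qed
    ultimately show "openin (subtopology TX orb) (proj bal ` U)" by simp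
  qed
  fix A assume "A \<in> topspace (total bal)"
  then obtain g m where g: "g \<in> carrier G" "m \<in> carrier M" "A = cls g m"
    using points_cases topspace_bal by blast
  obtain W where W: "openin TG W" "g \<in> W"
    "\<And>k k'. \<lbrakk>k \<in> W; k' \<in> W; \<phi> k x = \<phi> k' x\<rbrakk> \<Longrightarrow> cls k m = cls k' m"
    using cls_locally_constant[OF g(1,2)] by metis
  have Wc: "W \<subseteq> carrier G" using W(1) openin_subset topspace_group by blast
  have "inj_on (proj bal) ((\<lambda>k. cls k m) ` W)"
  proof (rule inj_onI)
    fix A B assume A: "A \<in> (\<lambda>k. cls k m) ` W" and B: "B \<in> (\<lambda>k. cls k m) ` W"
      and eq: "proj bal A = proj bal B"
    obtain k where k: "k \<in> W" "A = cls k m" using A by blast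
    obtain k' where k': "k' \<in> W" "B = cls k' m" using B by blast
    have "k \<in> carrier G" "k' \<in> carrier G" using k k' Wc by blast+
    then have "\<phi> k x = \<phi> k' x" using proj_cls[of k m] proj_cls[of k' m] g(2) k k' eq by simp
    then show "A = B" using W(3) k k' by blast
  qed
  then show "\<exists>U. openin (total bal) U \<and> A \<in> U \<and> inj_on (proj bal) U"
    using cls_image_open[OF W(1) g(2)] W(2) g(3) by blast
qed

text \<open>For a fixed module element \<open>m\<close> the action on the classes
  \<open>[w, m]\<close> is multiplication in \<open>G\<close>, and by \<open>cls_image_open\<close>
  such classes with \<open>w\<close> in an open set form a neighbourhood.\<close>

lemma G_space_bal: "G_space G TG (total bal) (eact bal)"
  unfolding G_space_def topspace_bal
proof
  show "group_action G points (eact bal)"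
  proof (rule group_actionI[OF group_axioms])
    show "eact bal g \<in> extensional points" for g by (simp add: balanced_sheaf_def)
    fix A assume "A \<in> points"
    then obtain k m where A: "k \<in> carrier G" "m \<in> carrier M" "A = cls k m" by (rule points_cases)
    show "eact bal \<one> A = A" using A eact_cls by simp
    fix g assume g: "g \<in> carrier G"
    show "eact bal g A \<in> points" using A g eact_cls cls_points by simp
    fix h assume h: "h \<in> carrier G"
    show "eact bal (h \<otimes> g) A = eact bal h (eact bal g A)" using A g h eact_cls by (simp add: m_assoc)
  qed
  show "continuous_map (prod_topology TG (total bal)) (total bal) (\<lambda>(g, y). eact bal g y)"
  proof (rule continuous_map_nbhdI)
    fix q assume "q \<in> topspace (prod_topology TG (total bal))"
    then obtain g A where q: "q = (g, A)" "g \<in> carrier G" "A \<in> points"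
      using topspace_group topspace_bal by auto
    obtain k m where A: "k \<in> carrier G" "m \<in> carrier M" "A = cls k m" using points_cases[OF q(3)] .
    show "(\<lambda>(g, y). eact bal g y) q \<in> topspace (total bal)"
      using q A eact_cls cls_points topspace_bal by simp
    fix U assume U: "openin (total bal) U" "(\<lambda>(g, y). eact bal g y) q \<in> U"
    define V where "V = {k \<in> carrier G. cls k m \<in> U}"
    have V: "openin TG V" using U(1) A(2) openin_bal unfolding V_def by blast
    have "g \<in> topspace TG" "k \<in> topspace TG" "g \<otimes> k \<in> V"
      using U(2) q A eact_cls topspace_group by (auto simp: V_def)
    then obtain N W where N: "openin TG N" "openin TG W" "g \<in> N" "k \<in> W"
      "\<And>n w. \<lbrakk>n \<in> N; w \<in> W\<rbrakk> \<Longrightarrow> n \<otimes> w \<in> V"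
      using continuous_map_prod_nbhd[OF continuous_mult _ _ V] by metis
    have "(\<lambda>(g, y). eact bal g y) b \<in> U" if mem: "b \<in> N \<times> (\<lambda>k. cls k m) ` W" for b
    proof -
      obtain n w where b: "b = (n, cls w m)" "n \<in> N" "w \<in> W" using mem by blast
      have nw: "n \<in> carrier G" "w \<in> carrier G" using b N(1,2) openin_subset topspace_group by blast+
      show ?thesis using N(5)[OF b(2,3)] b(1) eact_cls[OF nw A(2)] by (simp add: V_def)
    qed
    moreover have "openin (prod_topology TG (total bal)) (N \<times> (\<lambda>k. cls k m) ` W)"
      using N(1) cls_image_open[OF N(2) A(2)] by (simp add: openin_prod_Times_iff)
    moreover have "q \<in> N \<times> (\<lambda>k. cls k m) ` W" using q(1) A(3) N(3,4) by blast
    ultimately show "\<exists>V. openin (prod_topology TG (total bal)) V \<and> q \<in> V \<and>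
        (\<forall>b\<in>V. (\<lambda>(g, y). eact bal g y) b \<in> U)" by blast
  qed
qed

text \<open>Nearby pairs have the form \<open>[k, m]\<close>, \<open>[k', n]\<close>. When their
  projections agree, local constancy allows \<open>k'\<close> to be replaced by \<open>k\<close>,
  and the difference becomes \<open>[k, m - n]\<close>, which varies continuously with
  \<open>k\<close>.\<close>

lemma continuous_fminus_bal:
  "continuous_map (subtopology (prod_topology (total bal) (total bal)) {(a, b). proj bal a = proj bal b})
    (total bal) (\<lambda>(a, b). a \<ominus>\<^bsub>stalk bal (proj bal a)\<^esub> b)"
proof (rule continuous_map_nbhdI)
  let ?X = "subtopology (prod_topology (total bal) (total bal)) {(a, b). proj bal a = proj bal b}"
  fix q assume "q \<in> topspace ?X"
  then obtain A B where q: "q = (A, B)" "A \<in> points" "B \<in> points" "proj bal A = proj bal B"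
    using topspace_bal by auto
  obtain g m where A: "g \<in> carrier G" "m \<in> carrier M" "A = cls g m" using points_cases[OF q(2)] .
  have "B \<in> carrier (stalk bal (\<phi> g x))"
    using q(3,4) A(3) proj_cls[OF A(1,2)] topspace_bal by simp
  then obtain n where n: "n \<in> carrier M" "B = cls g n" using stalk_bal[OF A(1)] by blast
  have minus: "(\<lambda>(a, b). a \<ominus>\<^bsub>stalk bal (proj bal a)\<^esub> b) (cls k m, cls k n) = cls k (m \<ominus>\<^bsub>M\<^esub> n)"
    if "k \<in> carrier G" for k
    using fminus_cls[OF that A(2) n(1)] proj_cls[OF that A(2)] by simp
  show "(\<lambda>(a, b). a \<ominus>\<^bsub>stalk bal (proj bal a)\<^esub> b) q \<in> topspace (total bal)"
    using minus[OF A(1)] q(1) A n cls_points[OF A(1) M.minus_closed[OF A(2) n(1)]] topspace_bal by simp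
  fix U assume U: "openin (total bal) U" "(\<lambda>(a, b). a \<ominus>\<^bsub>stalk bal (proj bal a)\<^esub> b) q \<in> U"
  obtain W2 where W2: "openin TG W2" "g \<in> W2"
    "\<And>k k'. \<lbrakk>k \<in> W2; k' \<in> W2; \<phi> k x = \<phi> k' x\<rbrakk> \<Longrightarrow> cls k n = cls k' n"
    using cls_locally_constant[OF A(1) n(1)] by metis
  define W where "W = W2 \<inter> {k \<in> carrier G. cls k (m \<ominus>\<^bsub>M\<^esub> n) \<in> U}"
  have W: "openin TG W" "g \<in> W"
    using W2(1,2) U minus[OF A(1)] q(1) A n M.minus_closed[OF A(2) n(1)] unfolding W_def openin_bal by auto
  let ?N = "((\<lambda>k. cls k m) ` W \<times> (\<lambda>k. cls k n) ` W) \<inter> {(a, b). proj bal a = proj bal b}"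
  have "openin (prod_topology (total bal) (total bal)) ((\<lambda>k. cls k m) ` W \<times> (\<lambda>k. cls k n) ` W)"
    using cls_image_open[OF W(1) A(2)] cls_image_open[OF W(1) n(1)] by (simp add: openin_prod_Times_iff)
  then have "openin ?X ?N" unfolding openin_subtopology by blast
  moreover have "q \<in> ?N" using q A(3) n(2) W(2) by blast
  moreover have "(\<lambda>(a, b). a \<ominus>\<^bsub>stalk bal (proj bal a)\<^esub> b) b \<in> U" if b: "b \<in> ?N" for b
  proof -
    obtain k k' where k: "k \<in> W" "k' \<in> W" "b = (cls k m, cls k' n)" "proj bal (cls k m) = proj bal (cls k' n)"
      using b by blast
    have kG: "k \<in> carrier G" "k' \<in> carrier G" using k(1,2) by (auto simp: W_def)
    have "\<phi> k x = \<phi> k' x" using k(4) proj_cls[OF kG(1) A(2)] proj_cls[OF kG(2) n(1)] by simp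
    then have "cls k n = cls k' n" using W2(3)[of k k'] k by (auto simp: W_def)
    then show ?thesis using minus[OF kG(1)] k by (simp add: W_def)
  qed
  ultimately show "\<exists>V. openin ?X V \<and> q \<in> V \<and> (\<forall>b\<in>V. (\<lambda>(a, b). a \<ominus>\<^bsub>stalk bal (proj bal a)\<^esub> b) b \<in> U)"
    by blast
qed

lemma is_gsheaf_bal: "is_gsheaf G TG R (subtopology TX orb) \<phi> bal"
  unfolding is_gsheaf_def topspace_orbit
proof (intro conjI ballI)
  show "left_module R (stalk bal y)" if "y \<in> orb" for y
    using that left_module_bal unfolding orbit_def by auto
  show "proj bal (eact bal g A) = \<phi> g (proj bal A)" if g: "g \<in> carrier G" and A: "A \<in> topspace (total bal)" for g A
  proof -
    obtain k m where "k \<in> carrier G" "m \<in> carrier M" "A = cls k m" using A points_cases topspace_bal by blast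
    then show ?thesis using g eact_cls proj_cls action_mult base_point by simp
  qed
  show "continuous_map (total bal) (total bal) (fsmult bal r)" if r: "r \<in> carrier R" for r
  proof (rule continuous_from_bal)
    fix m assume m: "m \<in> carrier M"
    show "continuous_map TG (total bal) (\<lambda>k. fsmult bal r (cls k m))"
      by (rule continuous_map_eq[OF continuous_cls[OF left_moduleD(2)[OF left_module r m]]])
        (use fsmult_cls m r topspace_group in auto)
  qed
  show "eact bal g \<in> linear_maps R (stalk bal y) (stalk bal (\<phi> g y))"
    if g: "g \<in> carrier G" and y: "y \<in> orb" for g y
  proof -
    obtain k where k: "k \<in> carrier G" "y = \<phi> k x" using y by (auto simp: orbit_def)
    have gk: "g \<otimes> k \<in> carrier G" "\<phi> g y = \<phi> (g \<otimes> k) x"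
      using g k action_mult base_point by auto
    show ?thesis
      unfolding linear_maps_def gk(2) unfolding k(2) stalk_bal[OF k(1)] stalk_bal[OF gk(1)]
      using g k(1) gk(1) left_moduleD(2)[OF left_module]
      by (auto simp: eact_cls fadd_cls fsmult_cls)
  qed
qed (fact G_space_bal local_homeo_bal continuous_fminus_bal)+

end

section \<open>The skyscraper functor\<close>

lemma gmodule_homD:
  assumes "f \<in> gmodule_hom H R M N"
  shows "f \<in> extensional (carrier M)" "f \<in> linear_maps R M N"
    "m \<in> carrier M \<Longrightarrow> f m \<in> carrier N"
    "\<lbrakk>h \<in> carrier H; m \<in> carrier M\<rbrakk> \<Longrightarrow> f (gact M h m) = gact N h (f m)"
  using assms by (auto simp: gmodule_hom_def linear_maps_def)

context orbit_module
begin

sublocale sky: closed_gsheaf G TG R TX \<phi> orb bal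
  by (intro closed_gsheaf.intro gsheaf_on.intro closed_gsheaf_axioms.intro)
    (use is_gsheaf_bal left_module topspace_group G_space_base closed_orbit orbit_invariant
      in \<open>auto simp: left_module_def\<close>)

lemma is_gsheaf_skyscraper: "is_gsheaf G TG R TX \<phi> (skyscraper G TG TX \<phi> x M)"
  unfolding skyscraper_def by (rule sky.is_gsheaf_ext)

lemma orbit_module_other:
  "dmod R N \<Longrightarrow> orbit_module G TG TX \<phi> x R N"
  by (intro orbit_module.intro orbit_module_axioms.intro orbit_space_axioms)

context
  fixes N :: "('r, 'n, 'g) gmodule" and f
  assumes N: "dmod R N"
    and f: "f \<in> hom_stab R M N"
begin

interpretation N: orbit_module G TG TX \<phi> x R N using N by (rule orbit_module_other)

section \<open>Functoriality in the module\<close>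

text \<open>Equivariance of \<open>f\<close> turns a representative \<open>(k, h m)\<close> into
  \<open>(k, h (f m))\<close>, so the image of a class is an entire class.\<close>

lemma balanced_map_cls:
  assumes g: "g \<in> carrier G" and m: "m \<in> carrier M"
  shows "balanced_map G \<phi> x M f (cls g m) = N.cls g (f m)"
proof -
  have fm: "f m \<in> carrier N" using gmodule_homD(3)[OF f m] .
  have "(k, a) \<in> (\<lambda>(k, m). (k, f m)) ` cls g m \<longleftrightarrow> (\<exists>n. (k, n) \<in> cls g m \<and> a = f n)" for k a
    by (auto intro: rev_image_eqI)
  then have eq: "(k, a) \<in> (\<lambda>(k, m). (k, f m)) ` cls g m \<longleftrightarrow> (k, a) \<in> N.cls g (f m)" for k a
    unfolding mem_cls_iff[OF g m] N.mem_cls_iff[OF g fm] using gmodule_homD(4)[OF f _ m] by auto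
  have "(\<lambda>(k, m). (k, f m)) ` cls g m = N.cls g (f m)"
  proof (rule Set.set_eqI)
    show "q \<in> (\<lambda>(k, m). (k, f m)) ` cls g m \<longleftrightarrow> q \<in> N.cls g (f m)" for q
      using eq[of "fst q" "snd q"] by simp
  qed
  then show ?thesis using cls_points[OF g m] by (simp add: balanced_map_def)
qed

lemma balanced_map_hom:
  "balanced_map G \<phi> x M f \<in> gsheaf_hom G R (subtopology TX orb) bal N.bal"
proof -
  let ?b = "balanced_map G \<phi> x M f"
  have fc: "f m \<in> carrier N" if "m \<in> carrier M" for m using gmodule_homD(3)[OF f that] .
  have "?b \<in> extensional (topspace (total bal))" by (simp add: balanced_map_def topspace_bal)
  moreover have "continuous_map (total bal) (total N.bal) ?b"
  proof (rule continuous_from_bal)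
    fix m assume m: "m \<in> carrier M"
    show "continuous_map TG (total N.bal) (\<lambda>k. ?b (cls k m))"
      by (rule continuous_map_eq[OF N.continuous_cls[OF fc[OF m]]])
        (use balanced_map_cls m topspace_group in auto)
  qed
  moreover have "proj N.bal (?b A) = proj bal A \<and> (\<forall>g\<in>carrier G. ?b (eact bal g A) = eact N.bal g (?b A))"
    if A: "A \<in> topspace (total bal)" for A
  proof -
    obtain k m where "k \<in> carrier G" "m \<in> carrier M" "A = cls k m"
      using A points_cases topspace_bal by blast
    then show ?thesis by (simp add: balanced_map_cls proj_cls N.proj_cls eact_cls N.eact_cls fc)
  qed
  moreover have "?b \<in> linear_maps R (stalk bal y) (stalk N.bal y)" if "y \<in> orb" for y
  proof -
    obtain k where k: "k \<in> carrier G" "y = \<phi> k x" using \<open>y \<in> orb\<close> by (auto simp: orbit_def)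
    show ?thesis
      unfolding linear_maps_def k(2) stalk_bal[OF k(1)] N.stalk_bal[OF k(1)]
      using k(1) fc linear_mapsD[OF gmodule_homD(2)[OF f]] left_moduleD(2)[OF left_module]
      by (auto simp: balanced_map_cls fadd_cls fsmult_cls N.fadd_cls N.fsmult_cls)
  qed
  ultimately show ?thesis unfolding gsheaf_hom_def topspace_orbit by blast
qed

lemma skyscraper_map_hom:
  "skyscraper_map G TG TX \<phi> x M N f \<in>
    gsheaf_hom G R TX (skyscraper G TG TX \<phi> x M) (skyscraper G TG TX \<phi> x N)"
  unfolding skyscraper_map_def skyscraper_def
  by (rule sky.extension_by_zero_map_hom[OF N.sky.closed_gsheaf_axioms balanced_map_hom])

text \<open>The identity is checked on classes \<open>[k, m]\<close> and carried over to germs by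
  \<open>extension_by_zero_map_comp\<close>.\<close>

lemma skyscraper_map_comp:
  assumes P: "dmod R P"
    and q: "q \<in> hom_stab R N P"
    and qf: "compose (carrier M) q f \<in> hom_stab R M P"
  shows "skyscraper_map G TG TX \<phi> x M P (compose (carrier M) q f) =
    compose (topspace (total (skyscraper G TG TX \<phi> x M)))
      (skyscraper_map G TG TX \<phi> x N P q) (skyscraper_map G TG TX \<phi> x M N f)"
proof (rule extensionalityI[of _ "topspace (total (skyscraper G TG TX \<phi> x M))"])
  interpret P: orbit_module G TG TX \<phi> x R P using P by (rule orbit_module_other)
  show "skyscraper_map G TG TX \<phi> x M P (compose (carrier M) q f) \<in>
      extensional (topspace (total (skyscraper G TG TX \<phi> x M)))"
    by (simp add: skyscraper_map_def extension_by_zero_map_def skyscraper_def)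
  show "compose (topspace (total (skyscraper G TG TX \<phi> x M)))
      (skyscraper_map G TG TX \<phi> x N P q) (skyscraper_map G TG TX \<phi> x M N f) \<in>
      extensional (topspace (total (skyscraper G TG TX \<phi> x M)))"
    by simp
  have "balanced_map G \<phi> x M (compose (carrier M) q f) =
      compose (topspace (total bal)) (balanced_map G \<phi> x N q) (balanced_map G \<phi> x M f)"
    unfolding topspace_bal
  proof (rule extensionalityI[of _ points])
    fix A assume A: "A \<in> points"
    obtain k m where km: "k \<in> carrier G" "m \<in> carrier M" "A = cls k m" using points_cases[OF A] .
    have "balanced_map G \<phi> x M (compose (carrier M) q f) A = P.cls k (q (f m))"
      using orbit_module.balanced_map_cls[OF orbit_module_axioms P qf km(1,2)] km
      by (simp add: compose_def)
    moreover have "balanced_map G \<phi> x N q (balanced_map G \<phi> x M f A) = P.cls k (q (f m))"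
      using orbit_module.balanced_map_cls[OF N.orbit_module_axioms P q km(1) gmodule_homD(3)[OF f km(2)]]
        balanced_map_cls[OF km(1,2)] km(3) by simp
    ultimately show "balanced_map G \<phi> x M (compose (carrier M) q f) A =
        compose points (balanced_map G \<phi> x N q) (balanced_map G \<phi> x M f) A"
      using A by (simp add: compose_def)
  qed (simp_all add: balanced_map_def)
  then show "skyscraper_map G TG TX \<phi> x M P (compose (carrier M) q f) a =
      compose (topspace (total (skyscraper G TG TX \<phi> x M)))
        (skyscraper_map G TG TX \<phi> x N P q) (skyscraper_map G TG TX \<phi> x M N f) a"
    if a: "a \<in> topspace (total (skyscraper G TG TX \<phi> x M))" for a
    using sky.extension_by_zero_map_comp[OF balanced_map_hom, of a P.bal] a
    by (simp add: compose_def skyscraper_map_def skyscraper_def)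
qed

end

lemma skyscraper_map_id:
  "skyscraper_map G TG TX \<phi> x M M (\<lambda>m\<in>carrier M. m) =
    (\<lambda>a\<in>topspace (total (skyscraper G TG TX \<phi> x M)). a)"
proof (rule extensionalityI[of _ "topspace (total (skyscraper G TG TX \<phi> x M))"])
  fix a assume a: "a \<in> topspace (total (skyscraper G TG TX \<phi> x M))"
  have "balanced_map G \<phi> x M (\<lambda>m\<in>carrier M. m) A = A" if A: "A \<in> topspace (total bal)" for A
  proof -
    have "A \<in> points" using A topspace_bal by simp
    then obtain g l where gl: "g \<in> carrier G" "l \<in> carrier M" "A = cls g l" by (rule points_cases)
    have "(\<lambda>(k, m). (k, (\<lambda>m\<in>carrier M. m) m)) q = q" if "q \<in> A" for q
      using cls_mem_eq(3)[OF gl(1,2), of "fst q" "snd q"] that gl(3) by (cases q) simp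
    then have "(\<lambda>(k, m). (k, (\<lambda>m\<in>carrier M. m) m)) ` A = (\<lambda>q. q) ` A"
      by (rule image_cong[OF refl])
    then show ?thesis using \<open>A \<in> points\<close> by (simp add: balanced_map_def)
  qed
  from extension_by_zero_map_id[OF this, where a = a and TX = TX and Z = orb]
  show "skyscraper_map G TG TX \<phi> x M M (\<lambda>m\<in>carrier M. m) a =
      (\<lambda>a\<in>topspace (total (skyscraper G TG TX \<phi> x M)). a) a"
    using a by (simp add: skyscraper_map_def skyscraper_def)
qed (simp_all add: skyscraper_map_def extension_by_zero_map_def skyscraper_def)

end

section \<open>The counit\<close>

text \<open>The description is definite because \<open>(1, n)\<close> lies in the class \<open>[1, m]\<close> only for \<open>n = m\<close>.\<close>

definition counit ::
  "('g, 'b) monoid_scheme \<Rightarrow> 'x \<Rightarrow> ('r, 'm, 'g) gmodule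
    \<Rightarrow> 'x \<times> ('x set \<times> ('x \<Rightarrow> ('g \<times> 'm) set)) set \<Rightarrow> 'm" where
  "counit G x M a = (THE m. \<exists>(U, s)\<in>snd a. (\<one>\<^bsub>G\<^esub>, m) \<in> s x)"

context orbit_module
begin

abbreviation cu :: "'x \<times> ('x set \<times> ('x \<Rightarrow> ('g \<times> 'm) set)) set \<Rightarrow> 'm" where
  "cu \<equiv> counit G x M"

lemma action_one: "\<phi> \<one> x = x"
  using group_action_one[OF action_base base_point] .

lemma base_point_orbit: "x \<in> orb"
  using action_one by (force simp: orbit_def)

lemma one_mem_cls: "m \<in> carrier M \<Longrightarrow> (\<one>, n) \<in> cls \<one> m \<longleftrightarrow> n = m"
  using mem_cls_iff[of \<one> m \<one> n] gact_one subgroup.one_closed[OF subgroup_stab] by auto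

text \<open>All representatives of a germ at \<open>x\<close> have the same value at
  \<open>x\<close>, because \<open>x\<close> lies in the orbit; the description therefore has
  exactly one solution.\<close>

lemma counit_germ:
  assumes s: "sky.lsec U s" "x \<in> U" and m: "m \<in> carrier M" "s x = cls \<one> m"
  shows "cu (x, sky.gm x U s) = m"
proof -
  have "(\<exists>(V, t)\<in>sky.gm x U s. (\<one>, n) \<in> t x) \<longleftrightarrow> n = m" for n
  proof
    assume "\<exists>(V, t)\<in>sky.gm x U s. (\<one>, n) \<in> t x"
    then obtain V t where V: "(V, t) \<in> sky.gm x U s" "(\<one>, n) \<in> t x" by blast
    obtain W where "x \<in> W" "\<And>z. z \<in> W \<inter> orb \<Longrightarrow> s z = t z"
      using germ_eqD[OF s germ_memD(3)[OF V(1), symmetric]] by metis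
    then have "t x = s x" using base_point_orbit by auto
    then show "n = m" using V(2) m one_mem_cls by simp
  next
    assume "n = m"
    then have "(\<one>, n) \<in> s x" using m one_mem_cls by simp
    then show "\<exists>(V, t)\<in>sky.gm x U s. (\<one>, n) \<in> t x" using germ_mem[OF s] by blast
  qed
  then show ?thesis by (simp add: counit_def)
qed

lemma section_at_base_point:
  assumes "sky.lsec U s" "x \<in> U"
  obtains m where "m \<in> carrier M" "s x = cls \<one> m"
  using sky.lsec_stalk(1)[OF assms base_point_orbit] stalk_bal[OF one_closed] action_one by auto

lemma counit_closed:
  assumes "a \<in> carrier (stalk sky.ext x)"
  shows "cu a \<in> carrier M"
proof -
  obtain U s where a: "a = (x, sky.gm x U s)" "sky.lsec U s" "x \<in> U"
    using sky.ext_cases[of a] assms by auto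
  obtain m where "m \<in> carrier M" "s x = cls \<one> m" using section_at_base_point[OF a(2,3)] .
  then show ?thesis using counit_germ[OF a(2,3)] a(1) by simp
qed

text \<open>Equal counits mean equal values at \<open>x\<close>, and two sections of the balanced
  sheaf that agree at \<open>x\<close> agree on a neighbourhood of \<open>x\<close> in the orbit.
  This neighbourhood is the trace of an open subset of \<open>X\<close>, so the germs
  coincide.\<close>

lemma counit_inject:
  assumes ab: "a \<in> carrier (stalk sky.ext x)" "b \<in> carrier (stalk sky.ext x)" and eq: "cu a = cu b"
  shows "a = b"
proof -
  have "a \<in> topspace (total sky.ext)" "b \<in> topspace (total sky.ext)" "fst b = fst a" "fst a = x"
    using ab by auto
  then obtain U s t where st: "a = (x, sky.gm x U s)" "b = (x, sky.gm x U t)"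
    "sky.lsec U s" "sky.lsec U t" "x \<in> U" using sky.ext_cases_common[of a b] by metis
  obtain m where m: "m \<in> carrier M" "s x = cls \<one> m" using section_at_base_point[OF st(3,5)] .
  obtain n where n: "n \<in> carrier M" "t x = cls \<one> n" using section_at_base_point[OF st(4,5)] .
  have "s x = t x" using counit_germ[OF st(3,5) m] counit_germ[OF st(4,5) n] eq st m n by simp
  moreover have o: "openin (subtopology TX orb) (U \<inter> orb)"
    using st(3) by (auto simp: local_section_def openin_subtopology)
  have "openin (subtopology TX orb) {z \<in> (U \<inter> orb) \<inter> (U \<inter> orb). s z = t z}"
    using sky.sections_agree_open[OF _ _ o o] st(3,4) by (simp add: local_section_def)
  then obtain W where W: "openin TX W" "{z \<in> (U \<inter> orb) \<inter> (U \<inter> orb). s z = t z} = W \<inter> orb"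
    unfolding openin_subtopology by blast
  ultimately have xW: "x \<in> W" using base_point_orbit st(5) by blast
  have "sky.gm x U s = sky.gm x U t"
  proof (rule germ_eqI[of _ "W \<inter> U"])
    show "openin TX (W \<inter> U)" using W(1) st(3) by (auto simp: local_section_def)
  qed (use xW st(5) W(2) in blast)+
  then show ?thesis using st by simp
qed

lemma counit_linear: "cu \<in> linear_maps R (stalk sky.ext x) M"
proof -
  have "cu (fadd sky.ext a b) = cu a \<oplus>\<^bsub>M\<^esub> cu b \<and> (\<forall>r\<in>carrier R. cu (fsmult sky.ext r a) = r \<odot>\<^bsub>M\<^esub> cu a)"
    if ab: "a \<in> carrier (stalk sky.ext x)" "b \<in> carrier (stalk sky.ext x)" for a b
  proof -
    have "a \<in> topspace (total sky.ext)" "b \<in> topspace (total sky.ext)" "fst b = fst a" "fst a = x"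
      using ab by auto
    then obtain U s t where st: "a = (x, sky.gm x U s)" "b = (x, sky.gm x U t)"
      "sky.lsec U s" "sky.lsec U t" "x \<in> U" using sky.ext_cases_common[of a b] by metis
    obtain m where m: "m \<in> carrier M" "s x = cls \<one> m" using section_at_base_point[OF st(3,5)] .
    obtain n where n: "n \<in> carrier M" "t x = cls \<one> n" using section_at_base_point[OF st(4,5)] .
    have "cu (fadd sky.ext a b) = m \<oplus>\<^bsub>M\<^esub> n"
      unfolding st(1,2) sky.fadd_germ_same[OF st(3-5)]
      by (rule counit_germ[OF sky.lsec_add[OF st(3,4)] st(5)])
        (use m n st(5) base_point_orbit fadd_cls[OF one_closed m(1) n(1)] in auto)
    moreover have "cu (fsmult sky.ext r a) = r \<odot>\<^bsub>M\<^esub> m" if r: "r \<in> carrier R" for r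
      unfolding st(1) sky.fsmult_germ[OF st(3,5)]
      by (rule counit_germ[OF sky.lsec_smult[OF st(3) r] st(5)])
        (use m r st(5) base_point_orbit fsmult_cls[OF one_closed m(1) r] left_moduleD(2)[OF left_module] in auto)
    ultimately show ?thesis using counit_germ[OF st(3,5) m] counit_germ[OF st(4,5) n] st(1,2) by simp
  qed
  then show ?thesis unfolding linear_maps_def using counit_closed by auto
qed

text \<open>As \<open>h\<close> fixes \<open>x\<close>, the translated section takes the value
  \<open>h [1, m] = [h, m] = [1, h m]\<close> at \<open>x\<close>.\<close>

lemma counit_equivariant:
  assumes a: "a \<in> carrier (stalk sky.ext x)" and h: "h \<in> stab"
  shows "cu (eact sky.ext h a) = gact M h (cu a)"
proof -
  have hG: "h \<in> carrier G" and hx: "\<phi> h x = x" using h by (auto simp: stab_iff)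
  obtain U s where s: "a = (x, sky.gm x U s)" "sky.lsec U s" "x \<in> U"
    using sky.ext_cases[of a] a by auto
  obtain m where m: "m \<in> carrier M" "s x = cls \<one> m" using section_at_base_point[OF s(2,3)] .
  have xU: "x \<in> \<phi> h ` U" using hx s(3) by force
  have "eact bal h (s x) = cls \<one> (gact M h m)"
    using cls_shift[OF one_closed h m(1)] eact_cls[OF hG one_closed m(1)] m(2) hG by simp
  moreover have "\<phi> (inv h) x = x" using group_action_inv(1)[OF action_base hG base_point] hx by simp
  ultimately have "sky.actsec h U s x = cls \<one> (gact M h m)" using xU base_point_orbit by simp
  then have "cu (x, sky.gm x (\<phi> h ` U) (sky.actsec h U s)) = gact M h m"
    using counit_germ[OF sky.lsec_act[OF hG s(2)] xU] gact_closed[OF h m(1)] by blast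
  then show ?thesis using sky.eact_germ[OF hG s(2,3)] hx s(1) counit_germ[OF s(2,3) m] by simp
qed

lemma counit_natural:
  assumes N: "dmod R N"
    and f: "f \<in> hom_stab R M N"
    and a: "a \<in> carrier (stalk sky.ext x)"
  shows "counit G x N (skyscraper_map G TG TX \<phi> x M N f a) = f (cu a)"
proof -
  interpret N: orbit_module G TG TX \<phi> x R N using N by (rule orbit_module_other)
  obtain U s where s: "a = (x, sky.gm x U s)" "sky.lsec U s" "x \<in> U"
    using sky.ext_cases[of a] a by auto
  obtain m where m: "m \<in> carrier M" "s x = cls \<one> m" using section_at_base_point[OF s(2,3)] .
  have "counit G x N (x, N.sky.gm x U (\<lambda>z\<in>U \<inter> orb. balanced_map G \<phi> x M f (s z))) = f m"
    by (rule N.counit_germ[OF sky.lsec_map[OF balanced_map_hom[OF N f] s(2)] s(3)])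
      (use m s(3) base_point_orbit balanced_map_cls[OF N f one_closed m(1)] gmodule_homD(3)[OF f] in auto)
  then show ?thesis
    unfolding skyscraper_map_def s(1) extension_by_zero_map_germ[OF s(2,3)]
    using counit_germ[OF s(2,3) m] by simp
qed

end

section \<open>The stalk functor\<close>

context orbit_space
begin

lemma group_stab: "group (stab_group G \<phi> x)"
  unfolding stab_group_def using subgroup.subgroup_is_group[OF subgroup_stab group_axioms] .

text \<open>The action on the stalk is cut down to the fibre to make it extensional; elements of the
  stabilizer map the fibre over \<open>x\<close> to itself.\<close>

lemma stalk_act:
  assumes E: "is_gsheaf G TG R TX \<phi> E" and h: "h \<in> stab" and e: "e \<in> carrier (stalk E x)"
  shows "gact (stalk E x) h e = eact E h e" "eact E h e \<in> carrier (stalk E x)"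
proof -
  interpret E: gsheaf_on G TG R TX \<phi> E by (simp add: gsheaf_on_def E)
  show "gact (stalk E x) h e = eact E h e" using e by simp
  show "eact E h e \<in> carrier (stalk E x)"
    using E.eact_linear[OF stab_carrier[OF h] base_point] linear_mapsD(1)[OF _ e] h
    by (simp only: stab_iff) blast
qed

text \<open>Fibres of a local homeomorphism are discrete: a neighbourhood of \<open>h e\<close> on
  which the projection is injective meets the fibre over \<open>x\<close> only in
  \<open>h e\<close>. Continuity of the action on the total space then gives
  \<open>k e = h e\<close> for all \<open>k\<close> near \<open>h\<close> in the stabilizer.\<close>

lemma discrete_gmodule_stalk:
  assumes E: "is_gsheaf G TG R TX \<phi> E"
  shows "dmod R (stalk E x)"
  unfolding discrete_gmodule_def
proof (intro conjI ballI)
  interpret E: gsheaf_on G TG R TX \<phi> E by (simp add: gsheaf_on_def E)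
  have sg: "carrier (stab_group G \<phi> x) = stab" "mult (stab_group G \<phi> x) = mult G"
    "one (stab_group G \<phi> x) = one G" by (simp_all add: stab_group_def)
  note act = stalk_act[OF E]
  show "left_module R (stalk E x)" by (rule E.left_module_stalk[OF base_point])
  show "group_action (stab_group G \<phi> x) (carrier (stalk E x)) (gact (stalk E x))"
  proof (rule group_actionI[OF group_stab], unfold sg)
    fix h e assume h: "h \<in> stab" and e: "e \<in> carrier (stalk E x)"
    show "gact (stalk E x) h e \<in> carrier (stalk E x)" using act[OF h e] by (simp only:)
  next
    fix e assume e: "e \<in> carrier (stalk E x)"
    show "gact (stalk E x) \<one> e = e"
      using act(1)[OF subgroup.one_closed[OF subgroup_stab] e] group_action_one[OF E.action_total] e by simp
  next
    fix g h e assume g: "g \<in> stab" and h: "h \<in> stab" and e: "e \<in> carrier (stalk E x)"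
    have "eact E (g \<otimes> h) e = eact E g (eact E h e)"
      using group_action.composition_rule[OF E.action_total] e g h stab_carrier by simp
    then show "gact (stalk E x) (g \<otimes> h) e = gact (stalk E x) g (gact (stalk E x) h e)"
      using act(1)[OF subgroup.m_closed[OF subgroup_stab g h] e] act(1)[OF h e] act(1)[OF g act(2)[OF h e]]
      by (simp only:)
  qed simp
  show "gact (stalk E x) h \<in> linear_maps R (stalk E x) (stalk E x)" if "h \<in> carrier (stab_group G \<phi> x)" for h
  proof -
    have h: "h \<in> stab" using that sg by simp
    have l: "eact E h \<in> linear_maps R (stalk E x) (stalk E x)"
      using E.eact_linear[OF stab_carrier[OF h] base_point] h by (simp add: stab_iff)
    interpret S: abelian_group "stalk E x" using E.abelian_group_stalk[OF base_point] .
    show ?thesis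
      unfolding linear_maps_def
      using act[OF h] linear_mapsD[OF l] S.a_closed left_moduleD(2)[OF E.left_module_stalk[OF base_point]]
      by simp
  qed
  let ?D = "discrete_topology (carrier (stalk E x))"
  show "continuous_map (prod_topology (stab_topology G TG \<phi> x) ?D) ?D (\<lambda>(h, m). gact (stalk E x) h m)"
  proof (rule continuous_map_nbhdI)
    fix q assume "q \<in> topspace (prod_topology (stab_topology G TG \<phi> x) ?D)"
    then obtain h e where q: "q = (h, e)" and h: "h \<in> stab" and e: "e \<in> carrier (stalk E x)"
      by (auto simp: stab_topology_def)
    have eq: "gact (stalk E x) h e = eact E h e" using act(1)[OF h e] .
    show "(\<lambda>(h, m). gact (stalk E x) h m) q \<in> topspace ?D" using act[OF h e] q by simp
    fix U assume "openin ?D U" and U: "(\<lambda>(h, m). gact (stalk E x) h m) q \<in> U"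
    have he: "eact E h e \<in> topspace (total E)" "proj E (eact E h e) = x" using act(2)[OF h e] by auto
    obtain V where V: "openin (total E) V" "eact E h e \<in> V" "inj_on (proj E) V"
      using local_homeo_locally_inj[OF E.local_homeo_proj he(1)] .
    have c: "continuous_map (prod_topology TG (total E)) (total E) (\<lambda>(g, e). eact E g e)"
      using E.G_space_total by (simp add: G_space_def)
    have "h \<in> topspace TG" "e \<in> topspace (total E)" using stab_carrier[OF h] topspace_group e by auto
    then obtain N W where N: "openin TG N" "openin (total E) W" "h \<in> N" "e \<in> W"
      "\<And>k a. \<lbrakk>k \<in> N; a \<in> W\<rbrakk> \<Longrightarrow> eact E k a \<in> V"
      using continuous_map_prod_nbhd[OF c _ _ V(1,2)] by metis
    have "gact (stalk E x) k e \<in> U" if k: "k \<in> N \<inter> stab" for k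
    proof -
      have ks: "k \<in> stab" using k by blast
      have "eact E k e \<in> V" using N(4,5) k by blast
      moreover have "proj E (eact E k e) = x" using act(2)[OF ks e] by simp
      ultimately have "eact E k e = eact E h e" using V(2,3) he(2) by (metis inj_onD)
      then show ?thesis using act(1)[OF ks e] eq U q by simp
    qed
    moreover have "openin (prod_topology (stab_topology G TG \<phi> x) ?D) ((N \<inter> stab) \<times> {e})"
      using N(1) e unfolding openin_prod_Times_iff stab_topology_def by (auto simp: openin_subtopology)
    moreover have "q \<in> (N \<inter> stab) \<times> {e}" using q N(3) h by blast
    ultimately show "\<exists>V. openin (prod_topology (stab_topology G TG \<phi> x) ?D) V \<and> q \<in> V \<and>
        (\<forall>b\<in>V. (\<lambda>(h, m). gact (stalk E x) h m) b \<in> U)"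
      by (intro exI[of _ "(N \<inter> stab) \<times> {e}"]) auto
  qed
qed

lemma stalk_map_hom:
  assumes E: "is_gsheaf G TG R TX \<phi> E" and F: "is_gsheaf G TG R TX \<phi> F"
    and f: "f \<in> gsheaf_hom G R TX E F"
  shows "stalk_map x E F f \<in> hom_stab R (stalk E x) (stalk F x)"
proof -
  note l = gsheaf_homD(6)[OF f base_point]
  interpret E: gsheaf_on G TG R TX \<phi> E by (simp add: gsheaf_on_def E)
  interpret S: abelian_group "stalk E x" using E.abelian_group_stalk[OF base_point] .
  have "stalk_map x E F f \<in> linear_maps R (stalk E x) (stalk F x)"
    unfolding linear_maps_def stalk_map_def
    using linear_mapsD[OF l] S.a_closed left_moduleD(2)[OF E.left_module_stalk[OF base_point]] by simp
  moreover have "stalk_map x E F f (gact (stalk E x) h e) = gact (stalk F x) h (stalk_map x E F f e)"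
    if h: "h \<in> stab" and e: "e \<in> carrier (stalk E x)" for h e
  proof -
    have "f e \<in> carrier (stalk F x)" using linear_mapsD(1)[OF l e] .
    then have "gact (stalk F x) h (f e) = eact F h (f e)" using stalk_act(1)[OF F h] by blast
    moreover have "f (eact E h e) = eact F h (f e)" using gsheaf_homD(5)[OF f stab_carrier[OF h]] e by simp
    ultimately show ?thesis
      unfolding stalk_map_def stalk_act(1)[OF E h e] using e stalk_act(2)[OF E h e] by (simp only: restrict_apply')
  qed
  ultimately show ?thesis by (auto simp: gmodule_hom_def stalk_map_def stab_group_def)
qed

end

section \<open>The adjunction\<close>

context orbit_module
begin

text \<open>The set of all representatives \<open>(k, f (k\<^sup>-\<^sup>1 e))\<close> is a full class, so no choice of \<open>k\<close> is needed.\<close>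

definition transpose :: "('x, 'e, 'r, 'g) gsheaf \<Rightarrow> ('e \<Rightarrow> 'm) \<Rightarrow> 'e \<Rightarrow> ('g \<times> 'm) set" where
  "transpose E f e = {(k, f (eact E (inv k) e)) | k. k \<in> carrier G \<and> \<phi> k x = proj E e}"

context
  fixes E :: "('x, 'e, 'r, 'g) gsheaf" and f
  assumes E: "is_gsheaf G TG R TX \<phi> E"
    and f: "f \<in> hom_stab R (stalk E x) M"
begin

interpretation E: gsheaf_on G TG R TX \<phi> E by (simp add: gsheaf_on_def E)

section \<open>The morphism extending a given map on the stalk\<close>

lemma back_to_stalk:
  assumes g: "g \<in> carrier G" and e: "e \<in> topspace (total E)" "proj E e = \<phi> g x"
  shows "eact E (inv g) e \<in> carrier (stalk E x)"
  using E.proj_eact[OF inv_closed[OF g] e(1)] group_action_closed[OF E.action_total inv_closed[OF g] e(1)]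
    group_action_inv(1)[OF action_base g base_point] e(2) by simp

text \<open>For \<open>k x = g x\<close> the translates of \<open>e\<close> by \<open>inv k\<close>
  and \<open>inv g\<close> differ by the stabilizer element \<open>inv k \<otimes> g\<close>, with
  which \<open>f\<close> commutes.\<close>

lemma transpose_cls:
  assumes g: "g \<in> carrier G" and e: "e \<in> topspace (total E)" "proj E e = \<phi> g x"
  shows "transpose E f e = cls g (f (eact E (inv g) e))"
proof -
  note b = back_to_stalk[OF g e]
  have "k \<in> carrier G \<and> \<phi> k x = proj E e \<and> n = f (eact E (inv k) e) \<longleftrightarrow>
      (k, n) \<in> cls g (f (eact E (inv g) e))" for k n
  proof -
    have "f (eact E (inv k) e) = gact M (inv k \<otimes> g) (f (eact E (inv g) e))"
      if k: "k \<in> carrier G" and h: "inv k \<otimes> g \<in> stab"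
    proof -
      have "(inv k \<otimes> g) \<otimes> inv g = inv k" using g k by (simp add: m_assoc)
      then have "eact E (inv k) e = eact E (inv k \<otimes> g) (eact E (inv g) e)"
        using group_action.composition_rule[OF E.action_total e(1) stab_carrier[OF h] inv_closed[OF g]] by simp
      then show ?thesis using gmodule_homD(4)[OF f, of "inv k \<otimes> g"] h b stalk_act(1)[OF E h b] by simp
    qed
    moreover have "\<phi> k x = proj E e \<longleftrightarrow> inv k \<otimes> g \<in> stab" if "k \<in> carrier G"
      using orbit_eq_iff[OF g that] e(2) by auto
    ultimately show ?thesis unfolding mem_cls_iff[OF g gmodule_homD(3)[OF f b]] by auto
  qed
  then show ?thesis unfolding transpose_def by auto
qed

lemma transpose_section:
  assumes U: "openin TX U" and s: "s \<in> sections TX E U"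
  shows "sky.lsec U (\<lambda>z\<in>U \<inter> orb. transpose E f (s z))"
  unfolding local_section_def
proof (intro conjI U sectionsI)
  have Ut: "U \<subseteq> topspace TX" using U openin_subset by blast
  have st: "s z \<in> topspace (total E)" "proj E (s z) = z" if "z \<in> U" for z
    using E.sections_stalk[OF s that Ut] by auto
  have pos: "transpose E f (s z) = cls g (f (eact E (inv g) (s z)))"
    "eact E (inv g) (s z) \<in> carrier (stalk E x)"
    if "z \<in> U" "g \<in> carrier G" "z = \<phi> g x" for z g
    using transpose_cls[OF that(2)] back_to_stalk[OF that(2)] st[OF that(1)] that(3) by auto
  show "proj bal (transpose E f (s z)) = z" if z: "z \<in> U \<inter> orb" for z
  proof -
    obtain g where g: "g \<in> carrier G" "z = \<phi> g x" using z by (auto simp: orbit_def)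
    then show ?thesis using pos[of z g] z proj_cls[OF g(1) gmodule_homD(3)[OF f]] by simp
  qed
  let ?T = "subtopology (subtopology TX orb) (U \<inter> orb)"
  show "continuous_map ?T (total bal) (\<lambda>z. transpose E f (s z))"
  proof (rule continuous_map_nbhdI)
    fix z assume "z \<in> topspace ?T"
    then have z: "z \<in> U" "z \<in> orb" by auto
    obtain g where g: "g \<in> carrier G" "z = \<phi> g x" using z(2) by (auto simp: orbit_def)
    let ?e = "eact E (inv g) (s z)"
    let ?m = "f ?e"
    note p = pos[OF z(1) g]
    have m: "?m \<in> carrier M" using gmodule_homD(3)[OF f p(2)] .
    show "transpose E f (s z) \<in> topspace (total bal)"
      using p(1) cls_points[OF g(1) m] topspace_bal by simp
    fix B assume B: "openin (total bal) B" "transpose E f (s z) \<in> B"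
    \<comment> \<open>Two demands on \<open>k\<close>: the class \<open>[k, ?m]\<close> lies in
      \<open>B\<close>, and \<open>k ?e\<close> is a value of \<open>s\<close>. The latter can only
      be the value at \<open>k x\<close>, where the transposed section is then
      \<open>[k, ?m]\<close>.\<close>
    define W where "W = {k \<in> carrier G. cls k ?m \<in> B} \<inter> {k \<in> topspace TG. eact E k ?e \<in> s ` U}"
    have et: "?e \<in> topspace (total E)" "proj E ?e = x" using p(2) by auto
    have "continuous_map TG (prod_topology TG (total E)) (\<lambda>k. (k, ?e))"
      using et by (intro continuous_map_pairedI) auto
    then have "continuous_map TG (total E) ((\<lambda>(g, e). eact E g e) \<circ> (\<lambda>k. (k, ?e)))"
      using E.G_space_total unfolding G_space_def by (blast intro: continuous_map_compose)
    then have "continuous_map TG (total E) (\<lambda>k. eact E k ?e)" by (simp add: comp_def)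
    then have "openin TG {k \<in> topspace TG. eact E k ?e \<in> s ` U}"
      using E.section_image_open[OF s U] by (rule openin_continuous_map_preimage)
    moreover have "openin TG {k \<in> carrier G. cls k ?m \<in> B}" using B(1) m unfolding openin_bal by blast
    ultimately have W: "openin TG W" unfolding W_def by blast
    have "eact E g ?e = s z" using group_action_inv(2)[OF E.action_total g(1)] st[OF z(1)] by blast
    then have gW: "g \<in> W" using g(1) B(2) p(1) z(1) topspace_group by (simp add: W_def)
    have key: "\<phi> k x \<in> U \<and> transpose E f (s (\<phi> k x)) \<in> B" if k: "k \<in> W" for k
    proof -
      obtain u where u: "u \<in> U" "eact E k ?e = s u" and kG: "k \<in> carrier G" and kB: "cls k ?m \<in> B"
        using k by (auto simp: W_def)
      have ux: "u = \<phi> k x" using E.proj_eact[OF kG et(1)] et(2) u st(2)[OF u(1)] by simp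
      have "eact E (inv k) (s u) = ?e" using group_action_inv(1)[OF E.action_total kG et(1)] u(2) by simp
      then have "transpose E f (s u) = cls k ?m" using pos(1)[OF u(1) kG ux] by simp
      then show ?thesis using ux u(1) kB by simp
    qed
    have "openin (subtopology TX orb) ((\<lambda>k. \<phi> k x) ` W)" by (rule orbit_map_open[OF W])
    moreover have "(\<lambda>k. \<phi> k x) ` W \<subseteq> U \<inter> orb" using key unfolding W_def orbit_def by blast
    ultimately have "openin ?T ((\<lambda>k. \<phi> k x) ` W)" by (rule subset_openin_subtopology)
    moreover have "z \<in> (\<lambda>k. \<phi> k x) ` W" using gW g(2) by blast
    ultimately show "\<exists>V. openin ?T V \<and> z \<in> V \<and> (\<forall>b\<in>V. transpose E f (s b) \<in> B)"
      using key by blast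
  qed
qed

lemma germ_lift_transpose_hom:
  "germ_lift TX orb bal E (transpose E f) \<in> gsheaf_hom G R TX E (skyscraper G TG TX \<phi> x M)"
  unfolding skyscraper_def
proof (rule sky.germ_lift_hom[OF E transpose_section])
  fix g e assume g: "g \<in> carrier G" and e: "e \<in> topspace (total E)" "proj E e \<in> orb"
  obtain k where k: "k \<in> carrier G" "proj E e = \<phi> k x" using e(2) by (auto simp: orbit_def)
  have gk: "g \<otimes> k \<in> carrier G" using g k by simp
  have "proj E (eact E g e) = \<phi> (g \<otimes> k) x"
    using E.proj_eact[OF g e(1)] k action_mult[OF g k(1) base_point] by simp
  then have "transpose E f (eact E g e) = cls (g \<otimes> k) (f (eact E (inv (g \<otimes> k)) (eact E g e)))"
    by (rule transpose_cls[OF gk group_action_closed[OF E.action_total g e(1)]])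
  also have "eact E (inv (g \<otimes> k)) (eact E g e) = eact E (inv k) e"
  proof -
    have "inv (g \<otimes> k) \<otimes> g = inv k" using g k(1) by (simp add: inv_mult_group m_assoc)
    then show ?thesis using group_action.composition_rule[OF E.action_total e(1) inv_closed[OF gk] g] by simp
  qed
  also have "cls (g \<otimes> k) (f (eact E (inv k) e)) = eact bal g (transpose E f e)"
    unfolding transpose_cls[OF k(1) e(1) k(2)]
    using eact_cls[OF g k(1) gmodule_homD(3)[OF f back_to_stalk[OF k(1) e(1) k(2)]]] by simp
  finally show "transpose E f (eact E g e) = eact bal g (transpose E f e)" .
next
  fix z assume z: "z \<in> orb" "z \<in> topspace TX"
  obtain g where g: "g \<in> carrier G" "z = \<phi> g x" using z(1) by (auto simp: orbit_def)
  \<comment> \<open>On the fibre over \<open>z = g x\<close> the map is a composite of three linear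
    maps: translation to the fibre over \<open>x\<close>, then \<open>f\<close>, then
    \<open>m \<mapsto> [g, m]\<close>.\<close>
  have "\<phi> (inv g) z = x" using group_action_inv(1)[OF action_base g(1) base_point] g(2) by simp
  then have l: "eact E (inv g) \<in> linear_maps R (stalk E z) (stalk E x)"
    using E.eact_linear[OF inv_closed[OF g(1)] z(2)] by simp
  have t: "transpose E f e = cls g (f (eact E (inv g) e))" if "e \<in> carrier (stalk E z)" for e
    using transpose_cls[OF g(1)] that g(2) by simp
  note fl = linear_mapsD[OF gmodule_homD(2)[OF f]]
  interpret S: abelian_group "stalk E z" using E.abelian_group_stalk[OF z(2)] .
  show "transpose E f \<in> linear_maps R (stalk E z) (stalk bal z)"
    unfolding linear_maps_def
  proof (intro CollectI conjI ballI Pi_I)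
    fix a assume a: "a \<in> carrier (stalk E z)"
    note la = linear_mapsD(1)[OF l a]
    show "transpose E f a \<in> carrier (stalk bal z)"
      unfolding t[OF a] unfolding g(2) stalk_bal[OF g(1)] using fl(1)[OF la] by blast
    fix b assume b: "b \<in> carrier (stalk E z)"
    note lb = linear_mapsD(1)[OF l b]
    show "transpose E f (a \<oplus>\<^bsub>stalk E z\<^esub> b) = transpose E f a \<oplus>\<^bsub>stalk bal z\<^esub> transpose E f b"
      unfolding t[OF a] t[OF b] t[OF S.a_closed[OF a b]] linear_mapsD(2)[OF l a b] fl(2)[OF la lb]
      using fadd_cls[OF g(1) fl(1)[OF la] fl(1)[OF lb]] by simp
  next
    fix r a assume r: "r \<in> carrier R" and a: "a \<in> carrier (stalk E z)"
    note la = linear_mapsD(1)[OF l a]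
    show "transpose E f (r \<odot>\<^bsub>stalk E z\<^esub> a) = r \<odot>\<^bsub>stalk bal z\<^esub> transpose E f a"
      unfolding t[OF a] t[OF left_moduleD(2)[OF E.left_module_stalk[OF z(2)] r a]]
        linear_mapsD(3)[OF l r a] fl(3)[OF r la]
      using fsmult_cls[OF g(1) fl(1)[OF la] r] by simp
  qed
qed

text \<open>At \<open>x\<close> one may take \<open>g = \<one>\<close>, so the germ has the value
  \<open>[1, f e]\<close>, from which the counit reads off \<open>f e\<close>.\<close>

lemma counit_germ_lift:
  assumes e: "e \<in> carrier (stalk E x)"
  shows "cu (germ_lift TX orb bal E (transpose E f) e) = f e"
proof -
  obtain U s where U: "openin TX U" "x \<in> U" "s \<in> sections TX E U" "s x = e"
    using E.section_through[of e] e by auto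
  have "transpose E f e = cls \<one> (f e)"
    using transpose_cls[OF one_closed, of e] e action_one group_action_one[OF E.action_total, of e] by simp
  then show ?thesis
    using sky.germ_lift_section[OF E.gsheaf_on_axioms U(1-3), of "transpose E f"] U
      counit_germ[OF transpose_section[OF U(1,3)] U(2) gmodule_homD(3)[OF f e]] base_point_orbit by simp
qed

end

lemma skyscraper_stalk_outside:
  assumes "a \<in> topspace (total sky.ext)" "b \<in> topspace (total sky.ext)" "fst b = fst a" "fst a \<notin> orb"
  shows "a = b"
proof -
  obtain U s t where "a = (fst a, sky.gm (fst a) U s)" "b = (fst a, sky.gm (fst a) U t)"
    "sky.lsec U s" "sky.lsec U t" "fst a \<in> U" using sky.ext_cases_common[OF assms(1-3)] .
  then show ?thesis using germ_outside[OF closed_orbit assms(4)] by metis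
qed

section \<open>The bijection of morphism sets\<close>

lemma adjunct_hom:
  assumes E: "is_gsheaf G TG R TX \<phi> E"
    and F: "F \<in> gsheaf_hom G R TX E (skyscraper G TG TX \<phi> x M)"
  shows "(\<lambda>e\<in>carrier (stalk E x). cu (F e)) \<in> hom_stab R (stalk E x) M"
proof -
  interpret E: gsheaf_on G TG R TX \<phi> E by (simp add: gsheaf_on_def E)
  interpret S: abelian_group "stalk E x" using E.abelian_group_stalk[OF base_point] .
  note F' = F[unfolded skyscraper_def]
  note l = linear_mapsD[OF gsheaf_homD(6)[OF F' base_point]]
  note c = linear_mapsD[OF counit_linear]
  have "(\<lambda>e\<in>carrier (stalk E x). cu (F e)) \<in> linear_maps R (stalk E x) M"
    unfolding linear_maps_def
    using l c S.a_closed left_moduleD(2)[OF E.left_module_stalk[OF base_point]] by simp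
  moreover have "cu (F (eact E h e)) = gact M h (cu (F e))"
    if h: "h \<in> stab" and e: "e \<in> carrier (stalk E x)" for h e
    using gsheaf_homD(5)[OF F' stab_carrier[OF h]] e counit_equivariant[OF l(1)[OF e] h] by simp
  ultimately show ?thesis
    unfolding gmodule_hom_def using stalk_act[OF E] by simp
qed

lemma adjunct_bij:
  assumes E: "is_gsheaf G TG R TX \<phi> E"
  shows "bij_betw (\<lambda>F. \<lambda>e\<in>carrier (stalk E x). cu (F e))
    (gsheaf_hom G R TX E (skyscraper G TG TX \<phi> x M))
    (hom_stab R (stalk E x) M)"
proof -
  interpret E: gsheaf_on G TG R TX \<phi> E by (simp add: gsheaf_on_def E)
  have "inj_on (\<lambda>F. \<lambda>e\<in>carrier (stalk E x). cu (F e)) (gsheaf_hom G R TX E sky.ext)"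
  proof (rule inj_onI)
    fix F F' assume F: "F \<in> gsheaf_hom G R TX E sky.ext" and F': "F' \<in> gsheaf_hom G R TX E sky.ext"
      and eq: "(\<lambda>e\<in>carrier (stalk E x). cu (F e)) = (\<lambda>e\<in>carrier (stalk E x). cu (F' e))"
    have at_x: "F e = F' e" if e: "e \<in> carrier (stalk E x)" for e
    proof (rule counit_inject)
      show "F e \<in> carrier (stalk sky.ext x)" "F' e \<in> carrier (stalk sky.ext x)"
        using linear_mapsD(1)[OF gsheaf_homD(6)[OF F base_point] e]
          linear_mapsD(1)[OF gsheaf_homD(6)[OF F' base_point] e] by blast+
      show "cu (F e) = cu (F' e)" using fun_cong[OF eq, of e] e by simp
    qed
    show "F = F'"
    proof (rule extensionalityI[OF gsheaf_homD(1)[OF F] gsheaf_homD(1)[OF F']])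
      fix e assume e: "e \<in> topspace (total E)"
      note m = gsheaf_homD(3,4)[OF F e] gsheaf_homD(3,4)[OF F' e]
      show "F e = F' e"
      proof (cases "proj E e \<in> orb")
        case False
        then show ?thesis using skyscraper_stalk_outside[OF m(2,4)] m(1,3) by simp
      next
        case True
        then obtain g where g: "g \<in> carrier G" "proj E e = \<phi> g x" by (auto simp: orbit_def)
        let ?e = "eact E (inv g) e"
        have s: "?e \<in> carrier (stalk E x)"
          using E.proj_eact[OF inv_closed[OF g(1)] e] group_action_closed[OF E.action_total inv_closed[OF g(1)] e]
            group_action_inv(1)[OF action_base g(1) base_point] g(2) by simp
        have "eact E g ?e = e" using group_action_inv(2)[OF E.action_total g(1) e] .
        then show ?thesis
          using gsheaf_homD(5)[OF F g(1), of ?e] gsheaf_homD(5)[OF F' g(1), of ?e] at_x[OF s] s by simp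
      qed
    qed
  qed
  moreover have "f \<in> (\<lambda>F. \<lambda>e\<in>carrier (stalk E x). cu (F e)) ` gsheaf_hom G R TX E (skyscraper G TG TX \<phi> x M)"
    if f: "f \<in> hom_stab R (stalk E x) M" for f
  proof (rule image_eqI[OF _ germ_lift_transpose_hom[OF E f]])
    show "f = (\<lambda>e\<in>carrier (stalk E x). cu (germ_lift TX orb bal E (transpose E f) e))"
      by (rule extensionalityI[OF gmodule_homD(1)[OF f]]) (simp_all add: counit_germ_lift[OF E f])
  qed
  ultimately show ?thesis
    unfolding bij_betw_def skyscraper_def[symmetric] using adjunct_hom[OF E] by blast
qed

end

section \<open>The two categories and the two functors\<close>

text \<open>Morphisms in both categories are extensional functions, so the identity and
  associativity laws are those of \<open>compose\<close>; only closure under identities and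
  composition depends on the structure.\<close>

lemma is_category_concrete:
  assumes "\<And>A. A \<in> Ob \<Longrightarrow> (\<lambda>a\<in>U A. a) \<in> H A A"
    and "\<And>A B D f g. \<lbrakk>A \<in> Ob; B \<in> Ob; D \<in> Ob; f \<in> H A B; g \<in> H B D\<rbrakk> \<Longrightarrow> compose (U A) g f \<in> H A D"
    and ext: "\<And>A B f. f \<in> H A B \<Longrightarrow> f \<in> extensional (U A)"
    and maps: "\<And>A B f. f \<in> H A B \<Longrightarrow> f \<in> U A \<rightarrow> U B"
  shows "is_category \<lparr>Obj = Ob, Hom = H, Ident = (\<lambda>A. \<lambda>a\<in>U A. a),
    Comp = (\<lambda>A B D g f. compose (U A) g f)\<rparr>"
  unfolding is_category_def cat.simps
  using assms(1,2) compose_Id[OF maps ext] Id_compose[OF maps ext] compose_assoc[OF maps]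
  by (intro conjI ballI) simp_all

lemma is_category_gsheaf_cat: "is_category (gsheaf_cat G TG R TX \<phi>)"
proof -
  have id: "(\<lambda>e\<in>topspace (total E). e) \<in> gsheaf_hom G R TX E E" if "is_gsheaf G TG R TX \<phi> E" for E
  proof -
    interpret E: gsheaf_on G TG R TX \<phi> E by (simp add: gsheaf_on_def that)
    have "(\<lambda>e\<in>topspace (total E). e) \<in> linear_maps R (stalk E y) (stalk E y)" if y: "y \<in> topspace TX" for y
    proof -
      interpret S: abelian_group "stalk E y" using E.abelian_group_stalk[OF y] .
      show ?thesis
        unfolding linear_maps_def
        using S.a_closed left_moduleD(2)[OF E.left_module_stalk[OF y]] by simp
    qed
    moreover have "continuous_map (total E) (total E) (\<lambda>e\<in>topspace (total E). e)"
      by (rule continuous_map_eq[OF continuous_map_id]) simp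
    ultimately show ?thesis
      unfolding gsheaf_hom_def using group_action_closed[OF E.action_total] by simp
  qed
  have comp: "compose (topspace (total E)) g f \<in> gsheaf_hom G R TX E D"
    if E: "is_gsheaf G TG R TX \<phi> E" and f: "f \<in> gsheaf_hom G R TX E F" and g: "g \<in> gsheaf_hom G R TX F D"
    for E F D f g
  proof -
    interpret E: gsheaf_on G TG R TX \<phi> E by (simp add: gsheaf_on_def E)
    have "compose (topspace (total E)) g f \<in> linear_maps R (stalk E y) (stalk D y)" if y: "y \<in> topspace TX" for y
    proof -
      interpret S: abelian_group "stalk E y" using E.abelian_group_stalk[OF y] .
      show ?thesis
        unfolding linear_maps_def compose_def
        using linear_mapsD[OF gsheaf_homD(6)[OF f y]] linear_mapsD[OF gsheaf_homD(6)[OF g y]]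
          S.a_closed left_moduleD(2)[OF E.left_module_stalk[OF y]] by simp
    qed
    moreover have "continuous_map (total E) (total D) (compose (topspace (total E)) g f)"
      by (rule continuous_map_eq[OF continuous_map_compose[OF gsheaf_homD(2)[OF f] gsheaf_homD(2)[OF g]]])
        (simp add: compose_def)
    ultimately show ?thesis
      unfolding gsheaf_hom_def
      using group_action_closed[OF E.action_total] gsheaf_homD(3-5)[OF f] gsheaf_homD(3-5)[OF g]
      by (simp add: compose_def)
  qed
  show ?thesis
    unfolding gsheaf_cat_def
  proof (rule is_category_concrete)
    show "f \<in> topspace (total E) \<rightarrow> topspace (total F)" if "f \<in> gsheaf_hom G R TX E F" for E F f
      using gsheaf_homD(4)[OF that] by (rule Pi_I)
  qed (simp_all add: id comp gsheaf_homD(1))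
qed

lemma gmodule_hom_compose:
  assumes M: "discrete_gmodule H TH R M"
    and f: "f \<in> gmodule_hom H R M N" and g: "g \<in> gmodule_hom H R N P"
  shows "compose (carrier M) g f \<in> gmodule_hom H R M P"
proof -
  have l: "left_module R M" and a: "group_action H (carrier M) (gact M)"
    using M by (auto simp: discrete_gmodule_def)
  interpret abelian_group M using l by (rule left_moduleD)
  show ?thesis
    unfolding gmodule_hom_def linear_maps_def compose_def
    using left_moduleD(2)[OF l] group_action_closed[OF a] gmodule_homD(3,4)[OF f] gmodule_homD(3,4)[OF g]
      linear_mapsD[OF gmodule_homD(2)[OF f]] linear_mapsD[OF gmodule_homD(2)[OF g]] by simp
qed

lemma is_category_gmodule_cat: "is_category (gmodule_cat H TH R)"
proof -
  have id: "(\<lambda>m\<in>carrier M. m) \<in> gmodule_hom H R M M" if M: "discrete_gmodule H TH R M" for M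
  proof -
    have l: "left_module R M" and a: "group_action H (carrier M) (gact M)"
      using M by (auto simp: discrete_gmodule_def)
    interpret abelian_group M using l by (rule left_moduleD)
    show ?thesis
      unfolding gmodule_hom_def linear_maps_def
      using left_moduleD(2)[OF l] group_action_closed[OF a] by simp
  qed
  show ?thesis
    unfolding gmodule_cat_def
  proof (rule is_category_concrete)
    show "f \<in> carrier M \<rightarrow> carrier N" if "f \<in> gmodule_hom H R M N" for M N f
      using gmodule_homD(3)[OF that] by (rule Pi_I)
  qed (simp_all add: id gmodule_hom_compose gmodule_homD(1))
qed

lemma gsheaf_cat_simps [simp]:
  "Obj (gsheaf_cat G TG R TX \<phi>) = {E. is_gsheaf G TG R TX \<phi> E}"
  "Hom (gsheaf_cat G TG R TX \<phi>) = gsheaf_hom G R TX"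
  "Ident (gsheaf_cat G TG R TX \<phi>) = (\<lambda>E. \<lambda>e\<in>topspace (total E). e)"
  "Comp (gsheaf_cat G TG R TX \<phi>) = (\<lambda>E F D g f. compose (topspace (total E)) g f)"
  by (simp_all add: gsheaf_cat_def)

lemma gmodule_cat_simps [simp]:
  "Obj (gmodule_cat H TH R) = {M. discrete_gmodule H TH R M}"
  "Hom (gmodule_cat H TH R) = gmodule_hom H R"
  "Ident (gmodule_cat H TH R) = (\<lambda>M. \<lambda>m\<in>carrier M. m)"
  "Comp (gmodule_cat H TH R) = (\<lambda>M N P g f. compose (carrier M) g f)"
  by (simp_all add: gmodule_cat_def)

context orbit_space
begin

lemma is_functor_stalk:
  "is_functor (gsheaf_cat G TG R TX \<phi> :: (('x, 'e, 'r, 'g) gsheaf, 'e \<Rightarrow> 'e) cat)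
    (gmodule_cat (stab_group G \<phi> x) (stab_topology G TG \<phi> x) R) (\<lambda>E. stalk E x) (stalk_map x)"
  unfolding is_functor_def gsheaf_cat_simps gmodule_cat_simps
proof (intro conjI ballI)
  fix A B D :: "('x, 'e, 'r, 'g) gsheaf" and f g
  assume f: "f \<in> gsheaf_hom G R TX A B"
  show "stalk_map x A D (compose (topspace (total A)) g f) =
      compose (carrier (stalk A x)) (stalk_map x B D g) (stalk_map x A B f)"
  proof
    fix e show "stalk_map x A D (compose (topspace (total A)) g f) e =
        compose (carrier (stalk A x)) (stalk_map x B D g) (stalk_map x A B f) e"
      using gsheaf_homD(3,4)[OF f, of e] by (simp add: stalk_map_def compose_def)
  qed
next
  fix A :: "('x, 'e, 'r, 'g) gsheaf"
  show "stalk_map x A A (\<lambda>e\<in>topspace (total A). e) = (\<lambda>m\<in>carrier (stalk A x). m)"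
    by (auto simp: stalk_map_def fun_eq_iff)
qed (use is_category_gsheaf_cat is_category_gmodule_cat discrete_gmodule_stalk stalk_map_hom in auto)

lemma is_functor_skyscraper:
  "is_functor (gmodule_cat (stab_group G \<phi> x) (stab_topology G TG \<phi> x) R
      :: (('r, 'm, 'g) gmodule, 'm \<Rightarrow> 'm) cat)
    (gsheaf_cat G TG R TX \<phi>) (skyscraper G TG TX \<phi> x) (skyscraper_map G TG TX \<phi> x)"
proof -
  have om: "orbit_module G TG TX \<phi> x R M"
    if "dmod R M" for M :: "('r, 'm, 'g) gmodule"
    using that by (intro orbit_module.intro orbit_module_axioms.intro orbit_space_axioms)
  show ?thesis
    unfolding is_functor_def gsheaf_cat_simps gmodule_cat_simps
  proof (intro conjI ballI)
    fix A B D :: "('r, 'm, 'g) gmodule" and f g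
    assume "A \<in> {M. dmod R M}"
      "B \<in> {M. dmod R M}"
      "D \<in> {M. dmod R M}"
      and fg: "f \<in> hom_stab R A B" "g \<in> hom_stab R B D"
    then have d: "dmod R A"
      "dmod R B"
      "dmod R D" by auto
    show "skyscraper_map G TG TX \<phi> x A D (compose (carrier A) g f) =
        compose (topspace (total (skyscraper G TG TX \<phi> x A)))
          (skyscraper_map G TG TX \<phi> x B D g) (skyscraper_map G TG TX \<phi> x A B f)"
      by (rule orbit_module.skyscraper_map_comp[OF om[OF d(1)] d(2) fg(1) d(3) fg(2) gmodule_hom_compose[OF d(1) fg]])
  next
    fix A B :: "('r, 'm, 'g) gmodule" and f
    assume "A \<in> {M. dmod R M}"
      "B \<in> {M. dmod R M}"
      and f: "f \<in> hom_stab R A B"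
    then show "skyscraper_map G TG TX \<phi> x A B f \<in>
        gsheaf_hom G R TX (skyscraper G TG TX \<phi> x A) (skyscraper G TG TX \<phi> x B)"
      using orbit_module.skyscraper_map_hom[OF om] by blast
  next
    fix A :: "('r, 'm, 'g) gmodule"
    assume A: "A \<in> {M. dmod R M}"
    show "skyscraper_map G TG TX \<phi> x A A (\<lambda>m\<in>carrier A. m) =
        (\<lambda>e\<in>topspace (total (skyscraper G TG TX \<phi> x A)). e)"
      using orbit_module.skyscraper_map_id[OF om] A by blast
    show "skyscraper G TG TX \<phi> x A \<in> {E. is_gsheaf G TG R TX \<phi> E}"
      using orbit_module.is_gsheaf_skyscraper[OF om] A by blast
  qed (rule is_category_gsheaf_cat is_category_gmodule_cat)+
qed

end

theorem proposition8p5: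
  fixes G :: "('g, 'b) monoid_scheme" and TG :: "'g topology"
    and R :: "('r, 'c) ring_scheme"
    and TX :: "'x topology" and \<phi> :: "'g \<Rightarrow> 'x \<Rightarrow> 'x" and x :: 'x
  assumes "profinite_group G TG"
    and "ring R"
    and "profinite_space TX" and "G_space G TG TX \<phi>"
    and "x \<in> topspace TX"
  shows
    "is_functor
       (gsheaf_cat G TG R TX \<phi> :: (('x, 'e, 'r, 'g) gsheaf, 'e \<Rightarrow> 'e) cat)
       (gmodule_cat (stab_group G \<phi> x) (stab_topology G TG \<phi> x) R)
       (\<lambda>E. stalk E x) (stalk_map x)
     \<and> is_functor
       (gmodule_cat (stab_group G \<phi> x) (stab_topology G TG \<phi> x) R
          :: (('r, 'm, 'g) gmodule, 'm \<Rightarrow> 'm) cat)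
       (gsheaf_cat G TG R TX \<phi>)
       (skyscraper G TG TX \<phi> x) (skyscraper_map G TG TX \<phi> x)
     \<and> (\<exists>\<Phi>.
       (\<forall>(E :: ('x, 'e, 'r, 'g) gsheaf) (M :: ('r, 'm, 'g) gmodule).
          is_gsheaf G TG R TX \<phi> E
          \<and> discrete_gmodule (stab_group G \<phi> x) (stab_topology G TG \<phi> x) R M
          \<longrightarrow> bij_betw (\<Phi> E M)
                (gsheaf_hom G R TX E (skyscraper G TG TX \<phi> x M))
                (gmodule_hom (stab_group G \<phi> x) R (stalk E x) M))
       \<and> (\<forall>(E :: ('x, 'e, 'r, 'g) gsheaf) (E' :: ('x, 'e, 'r, 'g) gsheaf)
            (M :: ('r, 'm, 'g) gmodule) (M' :: ('r, 'm, 'g) gmodule) u v F.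
          is_gsheaf G TG R TX \<phi> E \<and> is_gsheaf G TG R TX \<phi> E'
          \<and> discrete_gmodule (stab_group G \<phi> x) (stab_topology G TG \<phi> x) R M
          \<and> discrete_gmodule (stab_group G \<phi> x) (stab_topology G TG \<phi> x) R M'
          \<and> u \<in> gsheaf_hom G R TX E' E
          \<and> v \<in> gmodule_hom (stab_group G \<phi> x) R M M'
          \<and> F \<in> gsheaf_hom G R TX E (skyscraper G TG TX \<phi> x M)
          \<longrightarrow> \<Phi> E' M'
                (compose (topspace (total E')) (skyscraper_map G TG TX \<phi> x M M' v)
                  (compose (topspace (total E')) F u))
              = compose (carrier (stalk E' x)) v
                  (compose (carrier (stalk E' x)) (\<Phi> E M F) (stalk_map x E' E u))))"
proof -
  interpret orbit_space G TG TX \<phi> x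
    using assms unfolding profinite_group_def profinite_space_def by (intro orbit_space.intro) auto
  let ?H = "stab_group G \<phi> x" and ?TH = "stab_topology G TG \<phi> x" and ?i = "skyscraper G TG TX \<phi> x"
  have om: "orbit_module G TG TX \<phi> x R M" if "discrete_gmodule ?H ?TH R M" for M :: "('r, 'm, 'g) gmodule"
    using that by (intro orbit_module.intro orbit_module_axioms.intro orbit_space_axioms)
  \<comment> \<open>Composition with the counit on stalks: naturality in \<open>E\<close> is then
    associativity of composition, and naturality in \<open>M\<close> is
    \<open>counit_natural\<close>.\<close>
  define \<Phi> :: "('x, 'e, 'r, 'g) gsheaf \<Rightarrow> ('r, 'm, 'g) gmodule \<Rightarrow> _ \<Rightarrow> 'e \<Rightarrow> 'm"
    where "\<Phi> = (\<lambda>E M F. \<lambda>e\<in>carrier (stalk E x). counit G x M (F e))"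
  have "bij_betw (\<Phi> E M) (gsheaf_hom G R TX E (?i M)) (gmodule_hom ?H R (stalk E x) M)"
    if "is_gsheaf G TG R TX \<phi> E \<and> discrete_gmodule ?H ?TH R M" for E M
    unfolding \<Phi>_def using orbit_module.adjunct_bij[OF om] that by blast
  moreover have "\<Phi> E' M' (compose (topspace (total E')) (skyscraper_map G TG TX \<phi> x M M' v)
        (compose (topspace (total E')) F u)) =
      compose (carrier (stalk E' x)) v (compose (carrier (stalk E' x)) (\<Phi> E M F) (stalk_map x E' E u))"
    if "is_gsheaf G TG R TX \<phi> E \<and> is_gsheaf G TG R TX \<phi> E' \<and>
        discrete_gmodule ?H ?TH R M \<and> discrete_gmodule ?H ?TH R M' \<and> u \<in> gsheaf_hom G R TX E' E \<and>
        v \<in> gmodule_hom ?H R M M' \<and> F \<in> gsheaf_hom G R TX E (?i M)"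
    for E E' M M' u v F
  proof -
    have M: "discrete_gmodule ?H ?TH R M" "discrete_gmodule ?H ?TH R M'"
      and u: "u \<in> gsheaf_hom G R TX E' E" and v: "v \<in> gmodule_hom ?H R M M'"
      and F: "F \<in> gsheaf_hom G R TX E (?i M)" using that by auto
    have "counit G x M' (skyscraper_map G TG TX \<phi> x M M' v (F (u e))) = v (counit G x M (F (u e)))"
      if e: "e \<in> carrier (stalk E' x)" for e
    proof -
      have "u e \<in> carrier (stalk E x)" using linear_mapsD(1)[OF gsheaf_homD(6)[OF u base_point] e] .
      then have "F (u e) \<in> carrier (stalk (?i M) x)"
        by (rule linear_mapsD(1)[OF gsheaf_homD(6)[OF F base_point]])
      then show ?thesis
        by (intro orbit_module.counit_natural[OF om[OF M(1)] M(2) v]) (simp add: skyscraper_def)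
    qed
    then show ?thesis
      using gsheaf_homD(3,4)[OF u] by (auto simp: \<Phi>_def stalk_map_def compose_def fun_eq_iff)
  qed
  ultimately show ?thesis
    using is_functor_stalk is_functor_skyscraper by blast
qed

end
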